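(* Let $k$ be a field and let $\Lambda$ and $\Gamma$ be augmented $k$-algebras. Then $$\operatorname{Ext}^*_{\Lambda\sqcup\Gamma}(k,k)\;\cong\;\operatorname{Ext}^*_\Lambda(k,k)*\operatorname{Ext}^*_\Gamma(k,k)$$ as augmented $k$-algebras.
   Context: An augmented $k$-algebra is a unital $k$-algebra $\Lambda$ together with a $k$-algebra homomorphism $\varepsilon_\Lambda:\Lambda\to k$; write $I(\Lambda)=\ker\varepsilon_\Lambda$. Morphisms of augmented algebras are $k$-algebra homomorphisms $f:\Lambda\to\Gamma$ with $\varepsilon_\Gamma\circ f=\varepsilon_\Lambda$. The field $k$ is a $\Lambda$-module via $\varepsilon_\Lambda$. Product: $\Lambda*\Gamma=\{(\lambda,\gamma)\in\Lambda\oplus\Gamma:\varepsilon_\Lambda(\lambda)=\varepsilon_\Gamma(\gamma)\}$, augmented by $(\lambda,\gamma)\mapsto\varepsilon_\Lambda(\lambda)=\varepsilon_\Gamma(\gamma)$. Coproduct (free product): $\Lambda\sqcup\Gamma=\bigoplus_{n\ge 0}R_n$, where $R_0=k$ and, for $n>0$, $R_n=(I(\Lambda)\otimes_k I(\Gamma)\otimes_k\cdots)\oplus(I(\Gamma)\otimes_k I(\Lambda)\otimes_k\cdots)$ with both summands alternating tensor products of length $n$. Multiplication is $(u_1\otimes\cdots\otimes u_r)(v_1\otimes\cdots\otimes v_s)=u_1\otimes\cdots\otimes(u_rv_1)\otimes v_2\otimes\cdots\otimes v_s$ if $u_r,v_1$ are both in $\Lambda$ or both in $\Gamma$, and $u_1\otimes\cdots\otimes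 u_r\otimes v_1\otimes\cdots\otimes v_s$ otherwise. The augmentation kills all $R_n$ with $n>0$. $\operatorname{Ext}^*_\Lambda(k,k)$ is a graded $k$-algebra under the Yoneda product, augmented by the map killing all elements of positive degree. *)

theory Defs
  imports "HOL-Algebra.Algebra"
begin

section \<open>Modules over a possibly noncommutative ring\<close>

text \<open>The locale \<^locale>\<open>module\<close> requires a commutative base ring; here are its axioms for left
  modules over an arbitrary ring.  The fields \<^const>\<open>monoid.mult\<close> and \<^const>\<open>one\<close> of a record
  representing a module are never used.\<close>

locale left_module = R?: ring R + M?: abelian_group M
  for R :: "('a, 'r) ring_scheme" (structure) and M :: "('a, 'm, 'c) module_scheme" (structure) +
  assumes smult_closed:
      "\<lbrakk>a \<in> carrier R; x \<in> carrier M\<rbrakk> \<Longrightarrow> a \<odot>\<^bsub>M\<^esub> x \<in> carrier M"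
    and smult_l_distr:
      "\<lbrakk>a \<in> carrier R; b \<in> carrier R; x \<in> carrier M\<rbrakk> \<Longrightarrow>
        (a \<oplus> b) \<odot>\<^bsub>M\<^esub> x = a \<odot>\<^bsub>M\<^esub> x \<oplus>\<^bsub>M\<^esub> b \<odot>\<^bsub>M\<^esub> x"
    and smult_r_distr:
      "\<lbrakk>a \<in> carrier R; x \<in> carrier M; y \<in> carrier M\<rbrakk> \<Longrightarrow>
        a \<odot>\<^bsub>M\<^esub> (x \<oplus>\<^bsub>M\<^esub> y) = a \<odot>\<^bsub>M\<^esub> x \<oplus>\<^bsub>M\<^esub> a \<odot>\<^bsub>M\<^esub> y"
    and smult_assoc1:
      "\<lbrakk>a \<in> carrier R; b \<in> carrier R; x \<in> carrier M\<rbrakk> \<Longrightarrow>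
        (a \<otimes> b) \<odot>\<^bsub>M\<^esub> x = a \<odot>\<^bsub>M\<^esub> (b \<odot>\<^bsub>M\<^esub> x)"
    and smult_one:
      "x \<in> carrier M \<Longrightarrow> \<one> \<odot>\<^bsub>M\<^esub> x = x"

text \<open>Linear maps are extensional functions, so that equal maps are equal as HOL functions.\<close>

definition lin_maps ::
    "('a, 'r) ring_scheme \<Rightarrow> ('a, 'm, 'c) module_scheme \<Rightarrow> ('a, 'n, 'd) module_scheme
      \<Rightarrow> ('m \<Rightarrow> 'n) set"
  where "lin_maps R M N = {f \<in> carrier M \<rightarrow>\<^sub>E carrier N.
    (\<forall>x\<in>carrier M. \<forall>y\<in>carrier M. f (x \<oplus>\<^bsub>M\<^esub> y) = f x \<oplus>\<^bsub>N\<^esub> f y) \<and>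
    (\<forall>a\<in>carrier R. \<forall>x\<in>carrier M. f (a \<odot>\<^bsub>M\<^esub> x) = a \<odot>\<^bsub>N\<^esub> f x)}"

definition free_module :: "('a, 'r) ring_scheme \<Rightarrow> 'x set \<Rightarrow> ('a, 'x \<Rightarrow> 'a) module"
  where "free_module R B =
    \<lparr>carrier = {f. (\<forall>x. f x \<in> carrier R) \<and> finite {x. f x \<noteq> \<zero>\<^bsub>R\<^esub>} \<and>
                   (\<forall>x. x \<notin> B \<longrightarrow> f x = \<zero>\<^bsub>R\<^esub>)},
     monoid.mult = undefined, one = undefined,
     ring.zero = (\<lambda>x. \<zero>\<^bsub>R\<^esub>),
     add = (\<lambda>f g x. f x \<oplus>\<^bsub>R\<^esub> g x),
     smult = (\<lambda>a f x. a \<otimes>\<^bsub>R\<^esub> f x)\<rparr>"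

definition basis_vec :: "('a, 'r) ring_scheme \<Rightarrow> 'x \<Rightarrow> 'x \<Rightarrow> 'a"
  where "basis_vec R x = (\<lambda>y. if y = x then \<one>\<^bsub>R\<^esub> else \<zero>\<^bsub>R\<^esub>)"

definition submodule_gen :: "('a, 'r) ring_scheme \<Rightarrow> ('a, 'm, 'c) module_scheme \<Rightarrow> 'm set \<Rightarrow> 'm set"
  where "submodule_gen R M S = \<Inter>{H. submodule H R M \<and> S \<subseteq> H}"

text \<open>The quotient of a module by a submodule; if \<open>M\<close> also carries a multiplication for which
  \<open>H\<close> is a two-sided ideal, this is the quotient algebra.\<close>

definition quot_module :: "('a, 'm, 'c) module_scheme \<Rightarrow> 'm set \<Rightarrow> ('a, 'm set) module"
  where "quot_module M H =
    ring.extend (M Quot H) (module.fields (\<lambda>a C. \<Union>x\<in>C. H +>\<^bsub>M\<^esub> (a \<odot>\<^bsub>M\<^esub> x)))"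

text \<open>A module is projective if it is a direct summand of a free module, i.e. if the canonical
  epimorphism from the free module on its underlying set, which sends the basis vector at \<open>x\<close>
  to \<open>x\<close>, has a linear section \<open>s\<close>.  (The lifting property quantifies over modules of
  arbitrary type and so cannot be used as the definition.)\<close>

definition projective_module :: "('a, 'r) ring_scheme \<Rightarrow> ('a, 'm, 'c) module_scheme \<Rightarrow> bool"
  where "projective_module R M \<longleftrightarrow> left_module R M \<and>
    (\<exists>s \<in> lin_maps R M (free_module R (carrier M)).
      \<forall>m\<in>carrier M. (\<Oplus>\<^bsub>M\<^esub>x\<in>{x \<in> carrier M. s m x \<noteq> \<zero>\<^bsub>R\<^esub>}. s m x \<odot>\<^bsub>M\<^esub> x) = m)"


section \<open>Augmented algebras\<close>

locale k_algebra = K?: field K + A?: ring A + module K A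
  for K :: "('k, 'r) ring_scheme" (structure) and A :: "('k, 'a, 'c) module_scheme" (structure) +
  assumes smult_mult_left:
      "\<lbrakk>c \<in> carrier K; x \<in> carrier A; y \<in> carrier A\<rbrakk> \<Longrightarrow>
        (c \<odot>\<^bsub>A\<^esub> x) \<otimes>\<^bsub>A\<^esub> y = c \<odot>\<^bsub>A\<^esub> (x \<otimes>\<^bsub>A\<^esub> y)"
    and smult_mult_right:
      "\<lbrakk>c \<in> carrier K; x \<in> carrier A; y \<in> carrier A\<rbrakk> \<Longrightarrow>
        x \<otimes>\<^bsub>A\<^esub> (c \<odot>\<^bsub>A\<^esub> y) = c \<odot>\<^bsub>A\<^esub> (x \<otimes>\<^bsub>A\<^esub> y)"

locale augmented_algebra = k_algebra K A
  for K :: "('k, 'r) ring_scheme" (structure) and A :: "('k, 'a, 'c) module_scheme" (structure) +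
  fixes aug :: "'a \<Rightarrow> 'k"
  assumes aug_ring_hom: "aug \<in> ring_hom A K"
    and aug_smult: "\<lbrakk>c \<in> carrier K; x \<in> carrier A\<rbrakk> \<Longrightarrow> aug (c \<odot>\<^bsub>A\<^esub> x) = c \<otimes>\<^bsub>K\<^esub> aug x"

definition aug_algebra_iso ::
    "('k, 'r) ring_scheme \<Rightarrow> ('k, 'a, 'c) module_scheme \<Rightarrow> ('a \<Rightarrow> 'k)
      \<Rightarrow> ('k, 'b, 'd) module_scheme \<Rightarrow> ('b \<Rightarrow> 'k) \<Rightarrow> ('a \<Rightarrow> 'b) set"
  where "aug_algebra_iso K A \<epsilon> B \<eta> = {f \<in> ring_iso A B.
    (\<forall>c\<in>carrier K. \<forall>x\<in>carrier A. f (c \<odot>\<^bsub>A\<^esub> x) = c \<odot>\<^bsub>B\<^esub> f x) \<and>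
    (\<forall>x\<in>carrier A. \<eta> (f x) = \<epsilon> x)}"

definition aug_algebra_isomorphic ::
    "('k, 'r) ring_scheme \<Rightarrow> ('k, 'a, 'c) module_scheme \<Rightarrow> ('a \<Rightarrow> 'k)
      \<Rightarrow> ('k, 'b, 'd) module_scheme \<Rightarrow> ('b \<Rightarrow> 'k) \<Rightarrow> bool"
  where "aug_algebra_isomorphic K A \<epsilon> B \<eta> \<longleftrightarrow> aug_algebra_iso K A \<epsilon> B \<eta> \<noteq> {}"

text \<open>The field \<open>K\<close> as a module over \<open>A\<close> via the augmentation \<open>\<epsilon>\<close> of \<open>A\<close>.\<close>

definition aug_module :: "('k, 'r) ring_scheme \<Rightarrow> ('a \<Rightarrow> 'k) \<Rightarrow> ('a, 'k) module"
  where "aug_module K \<epsilon> =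
    \<lparr>carrier = carrier K, monoid.mult = undefined, one = undefined, ring.zero = \<zero>\<^bsub>K\<^esub>,
     add = add K, smult = (\<lambda>a c. \<epsilon> a \<otimes>\<^bsub>K\<^esub> c)\<rparr>"


section \<open>Product and coproduct\<close>

definition aug_prod ::
    "('k, 'a, 'c) module_scheme \<Rightarrow> ('a \<Rightarrow> 'k) \<Rightarrow> ('k, 'b, 'd) module_scheme \<Rightarrow> ('b \<Rightarrow> 'k)
      \<Rightarrow> ('k, 'a \<times> 'b) module"
  where "aug_prod A \<epsilon> B \<eta> =
    \<lparr>carrier = {(x, y). x \<in> carrier A \<and> y \<in> carrier B \<and> \<epsilon> x = \<eta> y},
     monoid.mult = (\<lambda>(x, y) (x', y'). (x \<otimes>\<^bsub>A\<^esub> x', y \<otimes>\<^bsub>B\<^esub> y')),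
     one = (\<one>\<^bsub>A\<^esub>, \<one>\<^bsub>B\<^esub>),
     ring.zero = (\<zero>\<^bsub>A\<^esub>, \<zero>\<^bsub>B\<^esub>),
     add = (\<lambda>(x, y) (x', y'). (x \<oplus>\<^bsub>A\<^esub> x', y \<oplus>\<^bsub>B\<^esub> y')),
     smult = (\<lambda>c (x, y). (c \<odot>\<^bsub>A\<^esub> x, c \<odot>\<^bsub>B\<^esub> y))\<rparr>"

definition aug_prod_aug :: "('a \<Rightarrow> 'k) \<Rightarrow> 'a \<times> 'b \<Rightarrow> 'k"
  where "aug_prod_aug \<epsilon> = (\<lambda>(x, y). \<epsilon> x)"

text \<open>The coproduct is the direct sum, over all alternating patterns of factors, of the tensor
  products \<open>I(A) \<otimes> I(B) \<otimes> \<dots>\<close> and \<open>I(B) \<otimes> I(A) \<otimes> \<dots>\<close>, including the empty tensor product \<open>K\<close>.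
  Each tensor product is the free module on the words \<open>[u\<^sub>1, \<dots>, u\<^sub>n]\<close> of its pattern modulo the
  multilinearity relations, and the word represents \<open>u\<^sub>1 \<otimes> \<dots> \<otimes> u\<^sub>n\<close>.  All of them are formed at
  once, as a quotient of the free module on the set of all alternating words: every relation only
  involves words of one pattern, so the quotient is the direct sum of the tensor products.  The
  zero vectors of the augmentation ideals are admitted as letters.\<close>

definition alt_words ::
    "('k, 'r) ring_scheme \<Rightarrow> ('k, 'a, 'c) module_scheme \<Rightarrow> ('a \<Rightarrow> 'k)
      \<Rightarrow> ('k, 'b, 'd) module_scheme \<Rightarrow> ('b \<Rightarrow> 'k) \<Rightarrow> ('a + 'b) list set"
  where "alt_words K A \<epsilon> B \<eta> =
    {w. set w \<subseteq> Inl ` a_kernel A K \<epsilon> \<union> Inr ` a_kernel B K \<eta> \<and>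
        successively (\<lambda>s t. isl s \<noteq> isl t) w}"

inductive_set tensor_relations ::
    "('k, 'r) ring_scheme \<Rightarrow> ('k, 'a, 'c) module_scheme \<Rightarrow> ('a \<Rightarrow> 'k)
      \<Rightarrow> ('k, 'b, 'd) module_scheme \<Rightarrow> ('b \<Rightarrow> 'k) \<Rightarrow> (('a + 'b) list \<Rightarrow> 'k) set"
  for K A \<epsilon> B \<eta>
  where
    add_l: "\<lbrakk>u @ Inl x # v \<in> alt_words K A \<epsilon> B \<eta>; u @ Inl y # v \<in> alt_words K A \<epsilon> B \<eta>\<rbrakk> \<Longrightarrow>
      basis_vec K (u @ Inl (x \<oplus>\<^bsub>A\<^esub> y) # v)
        \<ominus>\<^bsub>free_module K (alt_words K A \<epsilon> B \<eta>)\<^esub>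
        (basis_vec K (u @ Inl x # v)
          \<oplus>\<^bsub>free_module K (alt_words K A \<epsilon> B \<eta>)\<^esub> basis_vec K (u @ Inl y # v))
      \<in> tensor_relations K A \<epsilon> B \<eta>"
  | add_r: "\<lbrakk>u @ Inr x # v \<in> alt_words K A \<epsilon> B \<eta>; u @ Inr y # v \<in> alt_words K A \<epsilon> B \<eta>\<rbrakk> \<Longrightarrow>
      basis_vec K (u @ Inr (x \<oplus>\<^bsub>B\<^esub> y) # v)
        \<ominus>\<^bsub>free_module K (alt_words K A \<epsilon> B \<eta>)\<^esub>
        (basis_vec K (u @ Inr x # v)
          \<oplus>\<^bsub>free_module K (alt_words K A \<epsilon> B \<eta>)\<^esub> basis_vec K (u @ Inr y # v))
      \<in> tensor_relations K A \<epsilon> B \<eta>"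
  | smult_l: "\<lbrakk>c \<in> carrier K; u @ Inl x # v \<in> alt_words K A \<epsilon> B \<eta>\<rbrakk> \<Longrightarrow>
      basis_vec K (u @ Inl (c \<odot>\<^bsub>A\<^esub> x) # v)
        \<ominus>\<^bsub>free_module K (alt_words K A \<epsilon> B \<eta>)\<^esub>
        (c \<odot>\<^bsub>free_module K (alt_words K A \<epsilon> B \<eta>)\<^esub> basis_vec K (u @ Inl x # v))
      \<in> tensor_relations K A \<epsilon> B \<eta>"
  | smult_r: "\<lbrakk>c \<in> carrier K; u @ Inr x # v \<in> alt_words K A \<epsilon> B \<eta>\<rbrakk> \<Longrightarrow>
      basis_vec K (u @ Inr (c \<odot>\<^bsub>B\<^esub> x) # v)
        \<ominus>\<^bsub>free_module K (alt_words K A \<epsilon> B \<eta>)\<^esub>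
        (c \<odot>\<^bsub>free_module K (alt_words K A \<epsilon> B \<eta>)\<^esub> basis_vec K (u @ Inr x # v))
      \<in> tensor_relations K A \<epsilon> B \<eta>"

definition word_mult ::
    "('a, 'r) ring_scheme \<Rightarrow> ('b, 's) ring_scheme \<Rightarrow> ('a + 'b) list \<Rightarrow> ('a + 'b) list
      \<Rightarrow> ('a + 'b) list"
  where "word_mult A B u v =
    (if u = [] \<or> v = [] then u @ v
     else case (last u, hd v) of
         (Inl x, Inl y) \<Rightarrow> butlast u @ Inl (x \<otimes>\<^bsub>A\<^esub> y) # tl v
       | (Inr x, Inr y) \<Rightarrow> butlast u @ Inr (x \<otimes>\<^bsub>B\<^esub> y) # tl v
       | _ \<Rightarrow> u @ v)"

text \<open>The free module on the alternating words, with the bilinear extension of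
  \<^const>\<open>word_mult\<close> as multiplication.\<close>

definition word_algebra ::
    "('k, 'r) ring_scheme \<Rightarrow> ('k, 'a, 'c) module_scheme \<Rightarrow> ('a \<Rightarrow> 'k)
      \<Rightarrow> ('k, 'b, 'd) module_scheme \<Rightarrow> ('b \<Rightarrow> 'k) \<Rightarrow> ('k, ('a + 'b) list \<Rightarrow> 'k) module"
  where "word_algebra K A \<epsilon> B \<eta> = (free_module K (alt_words K A \<epsilon> B \<eta>))
    \<lparr>monoid.mult := (\<lambda>f g w. \<Oplus>\<^bsub>K\<^esub>p\<in>{(u, v). f u \<noteq> \<zero>\<^bsub>K\<^esub> \<and> g v \<noteq> \<zero>\<^bsub>K\<^esub> \<and> word_mult A B u v = w}.
       f (fst p) \<otimes>\<^bsub>K\<^esub> g (snd p)),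
     one := basis_vec K []\<rparr>"

definition aug_coprod ::
    "('k, 'r) ring_scheme \<Rightarrow> ('k, 'a, 'c) module_scheme \<Rightarrow> ('a \<Rightarrow> 'k)
      \<Rightarrow> ('k, 'b, 'd) module_scheme \<Rightarrow> ('b \<Rightarrow> 'k) \<Rightarrow> ('k, (('a + 'b) list \<Rightarrow> 'k) set) module"
  where "aug_coprod K A \<epsilon> B \<eta> =
    quot_module (word_algebra K A \<epsilon> B \<eta>)
      (submodule_gen K (word_algebra K A \<epsilon> B \<eta>) (tensor_relations K A \<epsilon> B \<eta>))"

text \<open>The projection to the summand \<open>K\<close> spanned by the empty word.  No relation involves the
  empty word, so its coefficient is the same for all representatives of a class.\<close>

definition aug_coprod_aug :: "(('a + 'b) list \<Rightarrow> 'k) set \<Rightarrow> 'k"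
  where "aug_coprod_aug C = the_elem ((\<lambda>f. f []) ` C)"


section \<open>The algebra \<open>Ext\<^sub>A(K, K)\<close>\<close>

text \<open>A complex of modules \<open>\<dots> \<rightarrow> P\<^sub>2 \<rightarrow> P\<^sub>1 \<rightarrow> P\<^sub>0\<close> with a map from \<open>P\<^sub>0\<close> to a module, where
  \<open>P\<^sub>n\<close> is \<open>ob P n\<close> and \<open>bd P n\<close> is the map from \<open>P\<^sub>n\<^sub>+\<^sub>1\<close> to \<open>P\<^sub>n\<close>.\<close>

record ('a, 'p, 'm) augmented_complex =
  ob :: "nat \<Rightarrow> ('a, 'p) module"
  bd :: "nat \<Rightarrow> 'p \<Rightarrow> 'p"
  to_base :: "'p \<Rightarrow> 'm"

definition projective_resolution ::
    "('a, 'r) ring_scheme \<Rightarrow> ('a, 'm, 'c) module_scheme \<Rightarrow> ('a, 'p, 'm) augmented_complex \<Rightarrow> bool"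
  where "projective_resolution A M P \<longleftrightarrow>
    (\<forall>n. projective_module A (ob P n)) \<and>
    (\<forall>n. bd P n \<in> lin_maps A (ob P (Suc n)) (ob P n)) \<and>
    to_base P \<in> lin_maps A (ob P 0) M \<and>
    (\<forall>n. {x \<in> carrier (ob P (Suc n)). bd P n x = \<zero>\<^bsub>ob P n\<^esub>}
          = bd P (Suc n) ` carrier (ob P (Suc (Suc n)))) \<and>
    {x \<in> carrier (ob P 0). to_base P x = \<zero>\<^bsub>M\<^esub>} = bd P 0 ` carrier (ob P (Suc 0)) \<and>
    to_base P ` carrier (ob P 0) = carrier M"

text \<open>In the following, \<open>A\<close> is an algebra over \<open>K\<close> with augmentation \<open>\<epsilon>\<close> and \<open>P\<close> is a projective
  resolution of \<open>K\<close> over \<open>A\<close>.\<close>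

definition cochains ::
    "('k, 'r) ring_scheme \<Rightarrow> ('a, 's) ring_scheme \<Rightarrow> ('a \<Rightarrow> 'k) \<Rightarrow> ('a, 'p, 'k) augmented_complex
      \<Rightarrow> nat \<Rightarrow> ('k, 'p \<Rightarrow> 'k) module"
  where "cochains K A \<epsilon> P n =
    \<lparr>carrier = lin_maps A (ob P n) (aug_module K \<epsilon>),
     monoid.mult = undefined, one = undefined,
     ring.zero = (\<lambda>x\<in>carrier (ob P n). \<zero>\<^bsub>K\<^esub>),
     add = (\<lambda>f g. \<lambda>x\<in>carrier (ob P n). f x \<oplus>\<^bsub>K\<^esub> g x),
     smult = (\<lambda>c f. \<lambda>x\<in>carrier (ob P n). c \<otimes>\<^bsub>K\<^esub> f x)\<rparr>"

definition cocycles ::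
    "('k, 'r) ring_scheme \<Rightarrow> ('a, 's) ring_scheme \<Rightarrow> ('a \<Rightarrow> 'k) \<Rightarrow> ('a, 'p, 'k) augmented_complex
      \<Rightarrow> nat \<Rightarrow> ('p \<Rightarrow> 'k) set"
  where "cocycles K A \<epsilon> P n =
    {f \<in> carrier (cochains K A \<epsilon> P n). \<forall>x\<in>carrier (ob P (Suc n)). f (bd P n x) = \<zero>\<^bsub>K\<^esub>}"

fun coboundaries ::
    "('k, 'r) ring_scheme \<Rightarrow> ('a, 's) ring_scheme \<Rightarrow> ('a \<Rightarrow> 'k) \<Rightarrow> ('a, 'p, 'k) augmented_complex
      \<Rightarrow> nat \<Rightarrow> ('p \<Rightarrow> 'k) set"
  where
    "coboundaries K A \<epsilon> P 0 = {\<zero>\<^bsub>cochains K A \<epsilon> P 0\<^esub>}"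
  | "coboundaries K A \<epsilon> P (Suc n) =
      (\<lambda>f. compose (carrier (ob P (Suc n))) f (bd P n)) ` carrier (cochains K A \<epsilon> P n)"

definition Ext ::
    "('k, 'r) ring_scheme \<Rightarrow> ('a, 's) ring_scheme \<Rightarrow> ('a \<Rightarrow> 'k) \<Rightarrow> ('a, 'p, 'k) augmented_complex
      \<Rightarrow> nat \<Rightarrow> ('k, ('p \<Rightarrow> 'k) set) module"
  where "Ext K A \<epsilon> P n =
    quot_module ((cochains K A \<epsilon> P n)\<lparr>carrier := cocycles K A \<epsilon> P n\<rparr>) (coboundaries K A \<epsilon> P n)"

text \<open>The chain maps \<open>G\<^sub>i : P\<^sub>n\<^sub>+\<^sub>i \<rightarrow> P\<^sub>i\<close> lifting a cocycle \<open>g : P\<^sub>n \<rightarrow> K\<close>.\<close>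

definition cocycle_lifts ::
    "('a, 's) ring_scheme \<Rightarrow> ('a, 'p, 'k) augmented_complex \<Rightarrow> nat \<Rightarrow> ('p \<Rightarrow> 'k)
      \<Rightarrow> (nat \<Rightarrow> 'p \<Rightarrow> 'p) set"
  where "cocycle_lifts A P n g = {G.
    (\<forall>i. G i \<in> lin_maps A (ob P (n + i)) (ob P i)) \<and>
    (\<forall>x\<in>carrier (ob P n). to_base P (G 0 x) = g x) \<and>
    (\<forall>i. \<forall>x\<in>carrier (ob P (Suc (n + i))). bd P i (G (Suc i) x) = G i (bd P (n + i) x))}"

text \<open>The Yoneda product of the classes of \<open>f : P\<^sub>m \<rightarrow> K\<close> and \<open>g : P\<^sub>n \<rightarrow> K\<close> is the class of
  \<open>f \<circ> G\<^sub>m\<close> for any lift \<open>G\<close> of \<open>g\<close>.  As in \<^const>\<open>rcoset_mult\<close>, the union is taken over all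
  choices, each of which yields the same class.  No sign is introduced.\<close>

definition yoneda_mult ::
    "('k, 'r) ring_scheme \<Rightarrow> ('a, 's) ring_scheme \<Rightarrow> ('a \<Rightarrow> 'k) \<Rightarrow> ('a, 'p, 'k) augmented_complex
      \<Rightarrow> nat \<Rightarrow> nat \<Rightarrow> ('p \<Rightarrow> 'k) set \<Rightarrow> ('p \<Rightarrow> 'k) set \<Rightarrow> ('p \<Rightarrow> 'k) set"
  where "yoneda_mult K A \<epsilon> P m n F H =
    (\<Union>f\<in>F. \<Union>g\<in>H. \<Union>G\<in>cocycle_lifts A P n g.
      coboundaries K A \<epsilon> P (n + m) +>\<^bsub>cochains K A \<epsilon> P (n + m)\<^esub>
        compose (carrier (ob P (n + m))) f (G m))"

definition Ext_algebra ::
    "('k, 'r) ring_scheme \<Rightarrow> ('a, 's) ring_scheme \<Rightarrow> ('a \<Rightarrow> 'k) \<Rightarrow> ('a, 'p, 'k) augmented_complex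
      \<Rightarrow> ('k, nat \<Rightarrow> ('p \<Rightarrow> 'k) set) module"
  where "Ext_algebra K A \<epsilon> P =
    \<lparr>carrier = {\<xi>. (\<forall>n. \<xi> n \<in> carrier (Ext K A \<epsilon> P n)) \<and>
                  finite {n. \<xi> n \<noteq> \<zero>\<^bsub>Ext K A \<epsilon> P n\<^esub>}},
     monoid.mult = (\<lambda>\<xi> \<upsilon> n. \<Oplus>\<^bsub>Ext K A \<epsilon> P n\<^esub>i\<in>{..n}. yoneda_mult K A \<epsilon> P i (n - i) (\<xi> i) (\<upsilon> (n - i))),
     one = (\<lambda>n. if n = 0 then coboundaries K A \<epsilon> P 0 +>\<^bsub>cochains K A \<epsilon> P 0\<^esub> to_base P
                else \<zero>\<^bsub>Ext K A \<epsilon> P n\<^esub>),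
     ring.zero = (\<lambda>n. \<zero>\<^bsub>Ext K A \<epsilon> P n\<^esub>),
     add = (\<lambda>\<xi> \<upsilon> n. \<xi> n \<oplus>\<^bsub>Ext K A \<epsilon> P n\<^esub> \<upsilon> n),
     smult = (\<lambda>c \<xi> n. c \<odot>\<^bsub>Ext K A \<epsilon> P n\<^esub> \<xi> n)\<rparr>"

text \<open>The projection to \<open>Ext\<^sup>0\<^sub>A(K, K)\<close>, which is identified with \<open>K\<close>: its elements are
  the classes of the multiples \<open>c\<close> of the map \<open>P\<^sub>0 \<rightarrow> K\<close> of the resolution.\<close>

definition Ext_aug ::
    "('k, 'r) ring_scheme \<Rightarrow> ('a, 'p, 'k) augmented_complex \<Rightarrow> (nat \<Rightarrow> ('p \<Rightarrow> 'k) set) \<Rightarrow> 'k"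
  where "Ext_aug K P \<xi> =
    (THE c. c \<in> carrier K \<and> (\<lambda>x\<in>carrier (ob P 0). c \<otimes>\<^bsub>K\<^esub> to_base P x) \<in> \<xi> 0)"

end

theory Submission
  imports Defs
begin

text \<open>
  Write \<open>R\<close> for the coproduct.  Restriction along \<open>\<Lambda> \<rightarrow> R\<close> and \<open>\<Gamma> \<rightarrow> R\<close> gives morphisms of augmented
  algebras from \<open>Ext\<^sub>R(K, K)\<close> to both factors; in degree \<open>0\<close> all three are \<open>K\<close>.  By the normal form of
  words, \<open>R\<close> has the lifting property of a free left module over \<open>\<Lambda>\<close> and over \<open>\<Gamma>\<close>, so a projective resolution \<open>S\<close>
  over \<open>R\<close> also computes Ext over the factors.  The words that start in \<open>\<Lambda>\<close> and those that start in
  \<open>\<Gamma>\<close> span independent subspaces, hence every \<open>K\<close>-linear map from a projective \<open>R\<close>-module to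
  \<open>K\<close> is the sum of a \<open>\<Lambda>\<close>-linear and a \<open>\<Gamma>\<close>-linear one.  A map linear over both factors is linear over
  \<open>R\<close>, so there is an exact sequence of complexes
  \<open>0 \<rightarrow> Hom\<^sub>R(S, K) \<rightarrow> Hom\<^sub>\<Lambda>(S, K) \<oplus> Hom\<^sub>\<Gamma>(S, K) \<rightarrow> Hom\<^sub>K(S, K) \<rightarrow> 0\<close>.  The last complex is exact in
  positive degrees, which makes the product of the two restrictions bijective there.
\<close>

section \<open>Linear maps and linear relations\<close>

text \<open>The exact sequence alone does not settle degree 1: Hom over \<open>K\<close> has
  cohomology \<open>K\<close> in degree 0, so a connecting map into degree 1 could interfere. It
  vanishes because those classes are the multiples of \<open>to_base S\<close>, which are already
  linear over the coproduct. Hence the case \<open>k = 0\<close> is treated apart in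
  \<open>coboundary_if_both\<close>. No long exact sequence is formed; both halves of bijectivity
  are chases with explicit cochains. Nor is a basis of the coproduct over a factor ever chosen. What
  the comparison of resolutions uses is that linear maps lift along surjections, so this property is
  proved for the coproduct and passed on to direct summands of free modules, which covers the terms
  of \<open>S\<close>.\<close>

lemma lin_mapsI:
  assumes "f \<in> carrier U \<rightarrow>\<^sub>E carrier V"
    and "\<And>x y. \<lbrakk>x \<in> carrier U; y \<in> carrier U\<rbrakk> \<Longrightarrow> f (x \<oplus>\<^bsub>U\<^esub> y) = f x \<oplus>\<^bsub>V\<^esub> f y"
    and "\<And>a x. \<lbrakk>a \<in> carrier A; x \<in> carrier U\<rbrakk> \<Longrightarrow> f (a \<odot>\<^bsub>U\<^esub> x) = a \<odot>\<^bsub>V\<^esub> f x"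
  shows "f \<in> lin_maps A U V"
  using assms by (simp add: lin_maps_def)

lemma lin_maps_closed: "\<lbrakk>f \<in> lin_maps A U V; x \<in> carrier U\<rbrakk> \<Longrightarrow> f x \<in> carrier V"
  by (auto simp: lin_maps_def)

lemma lin_maps_add:
  "\<lbrakk>f \<in> lin_maps A U V; x \<in> carrier U; y \<in> carrier U\<rbrakk> \<Longrightarrow> f (x \<oplus>\<^bsub>U\<^esub> y) = f x \<oplus>\<^bsub>V\<^esub> f y"
  by (auto simp: lin_maps_def)

lemma lin_maps_smult:
  "\<lbrakk>f \<in> lin_maps A U V; a \<in> carrier A; x \<in> carrier U\<rbrakk> \<Longrightarrow> f (a \<odot>\<^bsub>U\<^esub> x) = a \<odot>\<^bsub>V\<^esub> f x"
  by (auto simp: lin_maps_def)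

lemma lin_maps_eqI:
  "\<lbrakk>f \<in> lin_maps A U V; g \<in> lin_maps B U Z; \<And>x. x \<in> carrier U \<Longrightarrow> f x = g x\<rbrakk> \<Longrightarrow> f = g"
  by (rule extensionalityI[of _ "carrier U"]) (auto simp: lin_maps_def PiE_def)

lemma left_module_ring: "left_module A U \<Longrightarrow> ring A"
  by (rule left_module.axioms(1))

lemma left_module_abelian_group: "left_module A U \<Longrightarrow> abelian_group U"
  by (rule left_module.axioms(2))

text \<open>Additivity is asked for at the pair of zeros only, so that this also applies to maps
  such as \<open>H x\<close>, \<open>res n\<close> or an augmentation, which are not elements of
  \<open>lin_maps\<close>.\<close>

lemma additive_zero:
  assumes "abelian_group U" "abelian_group V" "f \<zero>\<^bsub>U\<^esub> \<in> carrier V"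
    and "f (\<zero>\<^bsub>U\<^esub> \<oplus>\<^bsub>U\<^esub> \<zero>\<^bsub>U\<^esub>) = f \<zero>\<^bsub>U\<^esub> \<oplus>\<^bsub>V\<^esub> f \<zero>\<^bsub>U\<^esub>"
  shows "f \<zero>\<^bsub>U\<^esub> = \<zero>\<^bsub>V\<^esub>"
proof -
  interpret U: abelian_group U by fact
  interpret V: abelian_group V by fact
  show ?thesis using assms(3,4) by simp
qed

lemma lin_maps_zero:
  assumes "abelian_group U" "abelian_group V" "f \<in> lin_maps A U V"
  shows "f \<zero>\<^bsub>U\<^esub> = \<zero>\<^bsub>V\<^esub>"
proof -
  interpret U: abelian_group U by fact
  show ?thesis
    by (rule additive_zero[OF assms(1,2)])
      (use assms(3) in \<open>auto simp: lin_maps_closed lin_maps_add simp del: U.l_zero U.r_zero\<close>)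
qed

lemma lin_maps_minus:
  assumes U: "abelian_group U" and V: "abelian_group V" and f: "f \<in> lin_maps A U V"
    and x: "x \<in> carrier U" and y: "y \<in> carrier U"
  shows "f (x \<ominus>\<^bsub>U\<^esub> y) = f x \<ominus>\<^bsub>V\<^esub> f y"
proof -
  interpret U: abelian_group U by fact
  interpret V: abelian_group V by fact
  have "f (x \<ominus>\<^bsub>U\<^esub> y) \<oplus>\<^bsub>V\<^esub> f y = f ((x \<ominus>\<^bsub>U\<^esub> y) \<oplus>\<^bsub>U\<^esub> y)"
    using x y f by (simp add: lin_maps_add)
  also have "(x \<ominus>\<^bsub>U\<^esub> y) \<oplus>\<^bsub>U\<^esub> y = x"
    using x y by (simp add: U.minus_eq U.a_assoc U.l_neg)
  finally have "f (x \<ominus>\<^bsub>U\<^esub> y) \<oplus>\<^bsub>V\<^esub> f y = f x" .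
  moreover have "f (x \<ominus>\<^bsub>U\<^esub> y) = (f (x \<ominus>\<^bsub>U\<^esub> y) \<oplus>\<^bsub>V\<^esub> f y) \<ominus>\<^bsub>V\<^esub> f y"
    using x y lin_maps_closed[OF f] by (simp add: V.minus_eq V.a_assoc V.r_neg)
  ultimately show ?thesis by simp
qed

lemma (in abelian_group) minus_add_cancel:
  "\<lbrakk>x \<in> carrier G; y \<in> carrier G\<rbrakk> \<Longrightarrow> (x \<ominus> y) \<oplus> y = x"
  by (simp add: minus_eq a_assoc l_neg)

lemma (in abelian_group) minus_eq_zero_iff:
  "\<lbrakk>x \<in> carrier G; y \<in> carrier G\<rbrakk> \<Longrightarrow> x \<ominus> y = \<zero> \<longleftrightarrow> x = y"
  by (metis l_zero minus_add_cancel minus_eq r_neg)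

lemma (in abelian_group) minus_eq_iff:
  "\<lbrakk>x \<in> carrier G; y \<in> carrier G; z \<in> carrier G\<rbrakk> \<Longrightarrow> x \<ominus> y = z \<longleftrightarrow> x = z \<oplus> y"
  by (metis a_closed a_inv_closed a_assoc minus_eq r_neg l_neg r_zero)

lemma (in abelian_group) add_minus_add:
  "\<lbrakk>a \<in> carrier G; b \<in> carrier G; c \<in> carrier G; d \<in> carrier G\<rbrakk> \<Longrightarrow>
    (a \<oplus> b) \<ominus> (c \<oplus> d) = (a \<ominus> c) \<oplus> (b \<ominus> d)"
  by (simp add: minus_eq minus_add a_ac)

lemma (in left_module) smult_r_zero: "a \<in> carrier R \<Longrightarrow> a \<odot>\<^bsub>M\<^esub> \<zero>\<^bsub>M\<^esub> = \<zero>\<^bsub>M\<^esub>"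
  using smult_r_distr[of a "\<zero>\<^bsub>M\<^esub>" "\<zero>\<^bsub>M\<^esub>"] smult_closed[of a "\<zero>\<^bsub>M\<^esub>"] by simp

lemma (in left_module) smult_l_zero: "x \<in> carrier M \<Longrightarrow> \<zero> \<odot>\<^bsub>M\<^esub> x = \<zero>\<^bsub>M\<^esub>"
  using smult_l_distr[of "\<zero>" "\<zero>" x] smult_closed[of "\<zero>" x] by simp

lemma (in left_module) smult_minus_distr:
  assumes "a \<in> carrier R" "x \<in> carrier M" "y \<in> carrier M"
  shows "a \<odot>\<^bsub>M\<^esub> (x \<ominus>\<^bsub>M\<^esub> y) = a \<odot>\<^bsub>M\<^esub> x \<ominus>\<^bsub>M\<^esub> a \<odot>\<^bsub>M\<^esub> y"
proof -
  have "a \<odot>\<^bsub>M\<^esub> (x \<ominus>\<^bsub>M\<^esub> y) \<oplus>\<^bsub>M\<^esub> a \<odot>\<^bsub>M\<^esub> y = a \<odot>\<^bsub>M\<^esub> x"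
    using assms by (simp add: smult_r_distr[symmetric] M.minus_add_cancel)
  then show ?thesis using assms by (metis M.minus_eq_iff smult_closed M.minus_closed)
qed

lemma lin_maps_compose:
  assumes "f \<in> lin_maps A U V" "g \<in> lin_maps A V Z" "left_module A U"
  shows "compose (carrier U) g f \<in> lin_maps A U Z"
proof -
  interpret U: left_module A U by fact
  show ?thesis
    by (rule lin_mapsI)
      (use assms(1,2) in \<open>auto simp: compose_def lin_maps_closed lin_maps_add lin_maps_smult U.smult_closed\<close>)
qed

lemma lin_maps_sum:
  assumes "left_module A U" "left_module A V" "f \<in> lin_maps A U V" "g \<in> lin_maps A U V"
  shows "(\<lambda>x\<in>carrier U. f x \<oplus>\<^bsub>V\<^esub> g x) \<in> lin_maps A U V"
proof -
  interpret U: left_module A U by fact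
  interpret V: left_module A V by fact
  show ?thesis
    by (rule lin_mapsI)
      (use assms(3,4) in \<open>auto simp: lin_maps_closed lin_maps_add lin_maps_smult
        U.smult_closed V.smult_closed V.smult_r_distr V.a_ac\<close>)
qed

lemma lin_maps_diff:
  assumes "left_module A U" "left_module A V" "f \<in> lin_maps A U V" "g \<in> lin_maps A U V"
  shows "(\<lambda>x\<in>carrier U. f x \<ominus>\<^bsub>V\<^esub> g x) \<in> lin_maps A U V"
proof -
  interpret U: left_module A U by fact
  interpret V: left_module A V by fact
  show ?thesis
    by (rule lin_mapsI)
      (use assms(3,4) in \<open>auto simp: lin_maps_closed lin_maps_add lin_maps_smult
        U.smult_closed V.smult_closed V.smult_minus_distr V.M.add_minus_add\<close>)
qed

section \<open>Restriction of scalars\<close>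

definition restrict_scalars :: "('b \<Rightarrow> 'a) \<Rightarrow> ('a, 'm, 'c) module_scheme \<Rightarrow> ('b, 'm) module"
  where "restrict_scalars h M =
    \<lparr>carrier = carrier M, monoid.mult = undefined, one = undefined, ring.zero = \<zero>\<^bsub>M\<^esub>,
     add = add M, smult = (\<lambda>b x. h b \<odot>\<^bsub>M\<^esub> x)\<rparr>"

lemma restrict_scalars_simps [simp]:
  "carrier (restrict_scalars h M) = carrier M"
  "\<zero>\<^bsub>restrict_scalars h M\<^esub> = \<zero>\<^bsub>M\<^esub>"
  "x \<oplus>\<^bsub>restrict_scalars h M\<^esub> y = x \<oplus>\<^bsub>M\<^esub> y"
  "b \<odot>\<^bsub>restrict_scalars h M\<^esub> x = h b \<odot>\<^bsub>M\<^esub> x"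
  by (simp_all add: restrict_scalars_def)

lemma restrict_scalars_abelian_group:
  assumes "abelian_group M"
  shows "abelian_group (restrict_scalars h M)"
proof -
  interpret abelian_group M by fact
  show ?thesis
    by (rule abelian_groupI) (auto simp: a_ac intro: l_neg)
qed

lemma restrict_scalars_left_module:
  assumes "left_module A M" "ring B" "h \<in> ring_hom B A"
  shows "left_module B (restrict_scalars h M)"
proof -
  interpret left_module A M by fact
  note hom = ring_hom_closed[OF assms(3)] ring_hom_add[OF assms(3)] ring_hom_mult[OF assms(3)]
    ring_hom_one[OF assms(3)]
  show ?thesis
    by (intro left_module.intro left_module_axioms.intro assms(2) restrict_scalars_abelian_group)
      (auto simp: hom smult_closed smult_l_distr smult_r_distr smult_assoc1 smult_one M.abelian_group_axioms)
qed

lemma lin_maps_restrict_scalars: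
  assumes "f \<in> lin_maps A U V" "h \<in> ring_hom B A"
  shows "f \<in> lin_maps B (restrict_scalars h U) (restrict_scalars h V)"
  using assms by (auto simp: lin_maps_def ring_hom_closed)

text \<open>A submodule of the direct sum of \<open>U\<close> and \<open>V\<close>, read as a
  relation; the graphs of linear maps are the total single-valued ones.\<close>

definition lin_rel ::
    "('a, 'r) ring_scheme \<Rightarrow> ('a, 'm, 'c) module_scheme \<Rightarrow> ('a, 'n, 'd) module_scheme
      \<Rightarrow> ('m \<times> 'n) set \<Rightarrow> bool"
  where "lin_rel A U V \<rho> \<longleftrightarrow> \<rho> \<subseteq> carrier U \<times> carrier V \<and> (\<zero>\<^bsub>U\<^esub>, \<zero>\<^bsub>V\<^esub>) \<in> \<rho> \<and>
    (\<forall>x y x' y'. (x, y) \<in> \<rho> \<longrightarrow> (x', y') \<in> \<rho> \<longrightarrow> (x \<oplus>\<^bsub>U\<^esub> x', y \<oplus>\<^bsub>V\<^esub> y') \<in> \<rho>) \<and>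
    (\<forall>a x y. a \<in> carrier A \<longrightarrow> (x, y) \<in> \<rho> \<longrightarrow> (a \<odot>\<^bsub>U\<^esub> x, a \<odot>\<^bsub>V\<^esub> y) \<in> \<rho>)"

text \<open>Phrasing the lifting property of \<open>U\<close> through total linear relations instead of
  surjections \<open>V \<rightarrow> Z\<close> avoids a quantification over the type of \<open>Z\<close>.\<close>

definition selections ::
    "('a, 'r) ring_scheme \<Rightarrow> ('a, 'm, 'c) module_scheme \<Rightarrow> ('a, 'n, 'd) module_scheme \<Rightarrow> bool"
  where "selections A U V \<longleftrightarrow> (\<forall>\<rho>. lin_rel A U V \<rho> \<and> carrier U \<subseteq> Domain \<rho> \<longrightarrow>
    (\<exists>f\<in>lin_maps A U V. \<forall>x\<in>carrier U. (x, f x) \<in> \<rho>))"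

lemma lin_relI:
  assumes "\<rho> \<subseteq> carrier U \<times> carrier V" "(\<zero>\<^bsub>U\<^esub>, \<zero>\<^bsub>V\<^esub>) \<in> \<rho>"
    and "\<And>x y x' y'. \<lbrakk>(x, y) \<in> \<rho>; (x', y') \<in> \<rho>\<rbrakk> \<Longrightarrow> (x \<oplus>\<^bsub>U\<^esub> x', y \<oplus>\<^bsub>V\<^esub> y') \<in> \<rho>"
    and "\<And>a x y. \<lbrakk>a \<in> carrier A; (x, y) \<in> \<rho>\<rbrakk> \<Longrightarrow> (a \<odot>\<^bsub>U\<^esub> x, a \<odot>\<^bsub>V\<^esub> y) \<in> \<rho>"
  shows "lin_rel A U V \<rho>"
  using assms by (simp add: lin_rel_def)

lemma lin_relD:
  assumes "lin_rel A U V \<rho>"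
  shows "(x, y) \<in> \<rho> \<Longrightarrow> x \<in> carrier U" "(x, y) \<in> \<rho> \<Longrightarrow> y \<in> carrier V"
    and "(\<zero>\<^bsub>U\<^esub>, \<zero>\<^bsub>V\<^esub>) \<in> \<rho>"
    and "\<lbrakk>(x, y) \<in> \<rho>; (x', y') \<in> \<rho>\<rbrakk> \<Longrightarrow> (x \<oplus>\<^bsub>U\<^esub> x', y \<oplus>\<^bsub>V\<^esub> y') \<in> \<rho>"
    and "\<lbrakk>a \<in> carrier A; (x, y) \<in> \<rho>\<rbrakk> \<Longrightarrow> (a \<odot>\<^bsub>U\<^esub> x, a \<odot>\<^bsub>V\<^esub> y) \<in> \<rho>"
  using assms by (auto simp: lin_rel_def)

lemma selectionsI:
  assumes "\<And>\<rho>. \<lbrakk>lin_rel A U V \<rho>; \<And>x. x \<in> carrier U \<Longrightarrow> \<exists>y. (x, y) \<in> \<rho>\<rbrakk> \<Longrightarrow>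
    \<exists>f\<in>lin_maps A U V. \<forall>x\<in>carrier U. (x, f x) \<in> \<rho>"
  shows "selections A U V"
  using assms unfolding selections_def by (meson Domain.simps subsetD Domain_iff)

lemma selectionsD:
  assumes "selections A U V" "lin_rel A U V \<rho>" "\<And>x. x \<in> carrier U \<Longrightarrow> \<exists>y. (x, y) \<in> \<rho>"
  shows "\<exists>f\<in>lin_maps A U V. \<forall>x\<in>carrier U. (x, f x) \<in> \<rho>"
  using assms unfolding selections_def by (meson Domain.simps subsetI)

text \<open>Select from the pullback of \<open>f\<close> and \<open>p\<close>, which is total
  because \<open>f\<close> lands in the image of \<open>p\<close>. Comparing images is the form in
  which exactness of a complex can be fed in.\<close>

lemma selections_lift:
  assumes sel: "selections A U V" and U: "left_module A U" and V: "left_module A V"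
    and Z: "abelian_group Z"
    and p: "p \<in> lin_maps A V Z" and f: "f \<in> lin_maps A U Z"
    and sub: "\<And>x. x \<in> carrier U \<Longrightarrow> f x \<in> p ` carrier V"
  obtains g where "g \<in> lin_maps A U V" "\<And>x. x \<in> carrier U \<Longrightarrow> p (g x) = f x"
proof -
  interpret U: left_module A U by fact
  interpret V: left_module A V by fact
  let ?\<rho> = "{(x, y). x \<in> carrier U \<and> y \<in> carrier V \<and> p y = f x}"
  have "lin_rel A U V ?\<rho>"
    by (rule lin_relI)
      (use p f in \<open>auto simp: lin_maps_add lin_maps_smult U.smult_closed V.smult_closed
        lin_maps_zero[OF U.abelian_group_axioms Z] lin_maps_zero[OF V.abelian_group_axioms Z]\<close>)
  moreover have "\<exists>y. (x, y) \<in> ?\<rho>" if "x \<in> carrier U" for x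
    using sub[OF that] that by auto
  ultimately obtain g where "g \<in> lin_maps A U V" "\<forall>x\<in>carrier U. (x, g x) \<in> ?\<rho>"
    using selectionsD[OF sel] by blast
  then show thesis using that by blast
qed

text \<open>A maximal single-valued subspace of a total linear relation is total.\<close>

lemma vector_space_selections:
  assumes K: "field K" and U: "left_module K U" and V: "left_module K V"
  shows "selections K U V"
proof (rule selectionsI)
  interpret K: field K by fact
  interpret U: left_module K U by fact
  interpret V: left_module K V by fact
  fix \<rho> assume \<rho>: "lin_rel K U V \<rho>" and total: "\<And>x. x \<in> carrier U \<Longrightarrow> \<exists>y. (x, y) \<in> \<rho>"
  \<comment> \<open>For a linear relation, being single-valued over zero implies being single-valued
    everywhere, as \<open>uniq\<close> shows below; in this form the condition passes to unions of
    chains at once.\<close>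
  define \<G> where "\<G> = {G. lin_rel K U V G \<and> G \<subseteq> \<rho> \<and> (\<forall>y. (\<zero>\<^bsub>U\<^esub>, y) \<in> G \<longrightarrow> y = \<zero>\<^bsub>V\<^esub>)}"
  have zero: "{(\<zero>\<^bsub>U\<^esub>, \<zero>\<^bsub>V\<^esub>)} \<in> \<G>"
    unfolding \<G>_def using lin_relD(3)[OF \<rho>]
    by (auto intro!: lin_relI simp: U.smult_r_zero V.smult_r_zero)
  have "\<exists>M\<in>\<G>. \<forall>G\<in>\<G>. M \<subseteq> G \<longrightarrow> G = M"
  proof (rule subset_Zorn_nonempty)
    show "\<G> \<noteq> {}" using zero by blast
    fix C assume C: "C \<noteq> {}" "subset.chain \<G> C"
    then have sub: "C \<subseteq> \<G>" and ch: "\<And>a b. \<lbrakk>a \<in> C; b \<in> C\<rbrakk> \<Longrightarrow> a \<subseteq> b \<or> b \<subseteq> a"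
      by (auto simp: subset_chain_def)
    have lr: "lin_rel K U V G" if "G \<in> C" for G using that sub by (auto simp: \<G>_def)
    have "lin_rel K U V (\<Union>C)"
    proof (rule lin_relI)
      show "\<Union>C \<subseteq> carrier U \<times> carrier V" using lr unfolding lin_rel_def by blast
      show "(\<zero>\<^bsub>U\<^esub>, \<zero>\<^bsub>V\<^esub>) \<in> \<Union>C" using C(1) lr lin_relD(3) by blast
      show "(a \<odot>\<^bsub>U\<^esub> x, a \<odot>\<^bsub>V\<^esub> y) \<in> \<Union>C" if "a \<in> carrier K" "(x, y) \<in> \<Union>C" for a x y
        using that(2) lin_relD(5)[OF lr that(1)] by blast
      show "(x \<oplus>\<^bsub>U\<^esub> x', y \<oplus>\<^bsub>V\<^esub> y') \<in> \<Union>C" if p: "(x, y) \<in> \<Union>C" and q: "(x', y') \<in> \<Union>C" for x y x' y'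
      proof -
        obtain G G' where G: "G \<in> C" "(x, y) \<in> G" "G' \<in> C" "(x', y') \<in> G'" using p q by blast
        then obtain H where "H \<in> C" "(x, y) \<in> H" "(x', y') \<in> H" using ch[of G G'] by blast
        then show ?thesis using lin_relD(4)[OF lr] by blast
      qed
    qed
    then show "\<Union>C \<in> \<G>" using sub by (auto simp: \<G>_def)
  qed
  then obtain G where G: "G \<in> \<G>" and max: "\<And>G'. \<lbrakk>G' \<in> \<G>; G \<subseteq> G'\<rbrakk> \<Longrightarrow> G' = G" by blast
  have lin: "lin_rel K U V G" and G\<rho>: "G \<subseteq> \<rho>" and sv: "\<And>y. (\<zero>\<^bsub>U\<^esub>, y) \<in> G \<Longrightarrow> y = \<zero>\<^bsub>V\<^esub>"
    using G by (auto simp: \<G>_def)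
  note GD = lin_relD[OF lin] and \<rho>D = lin_relD[OF \<rho>]
  have dom: "\<exists>y. (x, y) \<in> G" if x: "x \<in> carrier U" for x
  proof (rule ccontr)
    assume nd: "\<nexists>y. (x, y) \<in> G"
    obtain y where y: "(x, y) \<in> \<rho>" using total[OF x] by blast
    have yc: "y \<in> carrier V" using y \<rho>D by blast
    \<comment> \<open>Adjoins the multiples of one pair from \<open>\<rho>\<close>. Linearity of
      \<open>\<rho>\<close> keeps \<open>G'\<close> inside it, and \<open>x\<close> lying outside
      the domain of \<open>G\<close> keeps \<open>G'\<close> single-valued.\<close>
    define G' where "G' = {(u \<oplus>\<^bsub>U\<^esub> c \<odot>\<^bsub>U\<^esub> x, v \<oplus>\<^bsub>V\<^esub> c \<odot>\<^bsub>V\<^esub> y) | u v c. (u, v) \<in> G \<and> c \<in> carrier K}"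
    have "lin_rel K U V G'"
    proof (rule lin_relI)
      show "G' \<subseteq> carrier U \<times> carrier V"
        using GD x yc by (auto simp: G'_def U.smult_closed V.smult_closed)
      show "(\<zero>\<^bsub>U\<^esub>, \<zero>\<^bsub>V\<^esub>) \<in> G'"
        unfolding G'_def using GD(3) x yc
        by (auto intro!: exI[of _ "\<zero>\<^bsub>U\<^esub>"] exI[of _ "\<zero>\<^bsub>V\<^esub>"] exI[of _ "\<zero>\<^bsub>K\<^esub>"] simp: U.smult_l_zero V.smult_l_zero)
      show "(a \<odot>\<^bsub>U\<^esub> u, a \<odot>\<^bsub>V\<^esub> v) \<in> G'" if a: "a \<in> carrier K" and "(u, v) \<in> G'" for a u v
      proof -
        obtain u' v' c where *: "(u', v') \<in> G" "c \<in> carrier K" "u = u' \<oplus>\<^bsub>U\<^esub> c \<odot>\<^bsub>U\<^esub> x" "v = v' \<oplus>\<^bsub>V\<^esub> c \<odot>\<^bsub>V\<^esub> y"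
          using \<open>(u, v) \<in> G'\<close> by (auto simp: G'_def)
        have "a \<odot>\<^bsub>U\<^esub> u = a \<odot>\<^bsub>U\<^esub> u' \<oplus>\<^bsub>U\<^esub> (a \<otimes>\<^bsub>K\<^esub> c) \<odot>\<^bsub>U\<^esub> x" "a \<odot>\<^bsub>V\<^esub> v = a \<odot>\<^bsub>V\<^esub> v' \<oplus>\<^bsub>V\<^esub> (a \<otimes>\<^bsub>K\<^esub> c) \<odot>\<^bsub>V\<^esub> y"
          using * a x yc GD
          by (simp_all add: U.smult_r_distr V.smult_r_distr U.smult_closed V.smult_closed U.smult_assoc1 V.smult_assoc1)
        moreover have "(a \<odot>\<^bsub>U\<^esub> u', a \<odot>\<^bsub>V\<^esub> v') \<in> G" "a \<otimes>\<^bsub>K\<^esub> c \<in> carrier K" using * a GD(5) by auto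
        ultimately show ?thesis unfolding G'_def by blast
      qed
      show "(u1 \<oplus>\<^bsub>U\<^esub> u2, v1 \<oplus>\<^bsub>V\<^esub> v2) \<in> G'" if *: "(u1, v1) \<in> G'" "(u2, v2) \<in> G'" for u1 v1 u2 v2
      proof -
        note ** = *
        obtain p q c where *: "(p, q) \<in> G" "c \<in> carrier K" "u1 = p \<oplus>\<^bsub>U\<^esub> c \<odot>\<^bsub>U\<^esub> x" "v1 = q \<oplus>\<^bsub>V\<^esub> c \<odot>\<^bsub>V\<^esub> y"
          using ** by (auto simp: G'_def)
        obtain p' q' c' where **: "(p', q') \<in> G" "c' \<in> carrier K" "u2 = p' \<oplus>\<^bsub>U\<^esub> c' \<odot>\<^bsub>U\<^esub> x" "v2 = q' \<oplus>\<^bsub>V\<^esub> c' \<odot>\<^bsub>V\<^esub> y"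
          using ** by (auto simp: G'_def)
        have "u1 \<oplus>\<^bsub>U\<^esub> u2 = (p \<oplus>\<^bsub>U\<^esub> p') \<oplus>\<^bsub>U\<^esub> (c \<oplus>\<^bsub>K\<^esub> c') \<odot>\<^bsub>U\<^esub> x" "v1 \<oplus>\<^bsub>V\<^esub> v2 = (q \<oplus>\<^bsub>V\<^esub> q') \<oplus>\<^bsub>V\<^esub> (c \<oplus>\<^bsub>K\<^esub> c') \<odot>\<^bsub>V\<^esub> y"
          using * ** x yc GD
          by (simp_all add: U.smult_l_distr V.smult_l_distr U.smult_closed V.smult_closed U.a_ac V.a_ac)
        moreover have "(p \<oplus>\<^bsub>U\<^esub> p', q \<oplus>\<^bsub>V\<^esub> q') \<in> G" "c \<oplus>\<^bsub>K\<^esub> c' \<in> carrier K" using * ** GD(4) by auto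
        ultimately show ?thesis unfolding G'_def by blast
      qed
    qed
    moreover have "G' \<subseteq> \<rho>"
      using G\<rho> \<rho>D(4,5) y by (auto simp: G'_def)
    moreover have "v = \<zero>\<^bsub>V\<^esub>" if v: "(\<zero>\<^bsub>U\<^esub>, v) \<in> G'" for v
    proof -
      obtain p q c where *: "(p, q) \<in> G" "c \<in> carrier K" "\<zero>\<^bsub>U\<^esub> = p \<oplus>\<^bsub>U\<^esub> c \<odot>\<^bsub>U\<^esub> x" "v = q \<oplus>\<^bsub>V\<^esub> c \<odot>\<^bsub>V\<^esub> y"
        using v by (auto simp: G'_def)
      have pc: "p \<in> carrier U" "q \<in> carrier V" using * GD by auto
      have c0: "c = \<zero>\<^bsub>K\<^esub>"
      proof (rule ccontr)
        assume c: "c \<noteq> \<zero>\<^bsub>K\<^esub>"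
        \<comment> \<open>Scaling \<open>p + c x = 0\<close> by minus the inverse of
          \<open>c\<close> gives \<open>x = d p\<close>, which would put \<open>x\<close> into the
          domain of \<open>G\<close>.\<close>
        define d where "d = \<ominus>\<^bsub>K\<^esub> (inv\<^bsub>K\<^esub> c)"
        have dc: "d \<in> carrier K" "d \<otimes>\<^bsub>K\<^esub> c = \<ominus>\<^bsub>K\<^esub> \<one>\<^bsub>K\<^esub>"
          using c * by (auto simp: d_def K.field_Units K.l_minus)
        have "d \<odot>\<^bsub>U\<^esub> p \<oplus>\<^bsub>U\<^esub> (\<ominus>\<^bsub>K\<^esub> \<one>\<^bsub>K\<^esub>) \<odot>\<^bsub>U\<^esub> x = \<zero>\<^bsub>U\<^esub>"
          using *(2,3) dc x pc U.smult_r_zero[OF dc(1)]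
          by (simp add: U.smult_r_distr U.smult_closed U.smult_assoc1[symmetric])
        then have "d \<odot>\<^bsub>U\<^esub> p \<oplus>\<^bsub>U\<^esub> ((\<ominus>\<^bsub>K\<^esub> \<one>\<^bsub>K\<^esub>) \<odot>\<^bsub>U\<^esub> x \<oplus>\<^bsub>U\<^esub> \<one>\<^bsub>K\<^esub> \<odot>\<^bsub>U\<^esub> x) = x"
          using x pc dc by (simp add: U.a_assoc[symmetric] U.smult_closed U.smult_one)
        then have "d \<odot>\<^bsub>U\<^esub> p = x"
          using x pc dc by (simp add: U.smult_l_distr[symmetric] U.smult_closed K.l_neg U.smult_l_zero)
        then show False using nd GD(5)[OF dc(1) *(1)] by auto
      qed
      then have "\<zero>\<^bsub>U\<^esub> = p" using * pc x by (simp add: U.smult_l_zero)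
      then have "q = \<zero>\<^bsub>V\<^esub>" using * sv by simp
      then show ?thesis using * c0 yc by (simp add: V.smult_l_zero)
    qed
    ultimately have "G' \<in> \<G>" by (auto simp: \<G>_def)
    moreover have "G \<subseteq> G'"
    proof
      fix z assume z: "z \<in> G"
      obtain u v where [simp]: "z = (u, v)" by (cases z)
      have "u = u \<oplus>\<^bsub>U\<^esub> \<zero>\<^bsub>K\<^esub> \<odot>\<^bsub>U\<^esub> x" "v = v \<oplus>\<^bsub>V\<^esub> \<zero>\<^bsub>K\<^esub> \<odot>\<^bsub>V\<^esub> y"
        using z GD x yc by (auto simp: U.smult_l_zero V.smult_l_zero)
      then show "z \<in> G'" unfolding G'_def using z by auto
    qed
    ultimately have "G' = G" by (rule max)
    moreover have "(x, y) \<in> G'"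
      unfolding G'_def using GD(3) x yc
      by (auto intro!: exI[of _ "\<zero>\<^bsub>U\<^esub>"] exI[of _ "\<zero>\<^bsub>V\<^esub>"] exI[of _ "\<one>\<^bsub>K\<^esub>"] simp: U.smult_one V.smult_one)
    ultimately show False using nd by blast
  qed
  have uniq: "y = y'" if "(x, y) \<in> G" "(x, y') \<in> G" for x y y'
  proof -
    let ?m = "\<ominus>\<^bsub>K\<^esub> \<one>\<^bsub>K\<^esub>"
    have c: "x \<in> carrier U" "y \<in> carrier V" "y' \<in> carrier V" using that GD by auto
    have "(x \<oplus>\<^bsub>U\<^esub> ?m \<odot>\<^bsub>U\<^esub> x, y \<oplus>\<^bsub>V\<^esub> ?m \<odot>\<^bsub>V\<^esub> y') \<in> G" using that GD(4,5) by simp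
    moreover have "x \<oplus>\<^bsub>U\<^esub> ?m \<odot>\<^bsub>U\<^esub> x = \<zero>\<^bsub>U\<^esub>"
      using U.smult_l_distr[of "\<one>\<^bsub>K\<^esub>" ?m x] c by (simp add: U.smult_one K.r_neg U.smult_l_zero)
    ultimately have "y \<oplus>\<^bsub>V\<^esub> ?m \<odot>\<^bsub>V\<^esub> y' = \<zero>\<^bsub>V\<^esub>" using sv by simp
    moreover have "y' \<oplus>\<^bsub>V\<^esub> ?m \<odot>\<^bsub>V\<^esub> y' = \<zero>\<^bsub>V\<^esub>"
      using V.smult_l_distr[of "\<one>\<^bsub>K\<^esub>" ?m y'] c by (simp add: V.smult_one K.r_neg V.smult_l_zero)
    ultimately show ?thesis
      using c by (metis K.a_inv_closed K.one_closed V.add.right_cancel V.smult_closed)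
  qed
  define g where "g = (\<lambda>x\<in>carrier U. THE y. (x, y) \<in> G)"
  have g: "(x, g x) \<in> G" if "x \<in> carrier U" for x
  proof -
    have "\<exists>!y. (x, y) \<in> G" using dom[OF that] uniq by blast
    then show ?thesis using theI'[of "\<lambda>y. (x, y) \<in> G"] that by (simp add: g_def)
  qed
  have gI: "g x = y" if "(x, y) \<in> G" for x y
    using uniq[OF g that] GD(1)[OF that] by blast
  have "g \<in> lin_maps K U V"
  proof (rule lin_mapsI)
    show "g \<in> carrier U \<rightarrow>\<^sub>E carrier V"
      using g[THEN GD(2)] by (auto simp: g_def)
  qed (auto intro!: gI GD(4,5) g)
  then show "\<exists>f\<in>lin_maps K U V. \<forall>x\<in>carrier U. (x, f x) \<in> \<rho>"
    using g G\<rho> by blast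
qed

section \<open>Projective modules\<close>

text \<open>The map out of a direct sum of copies of \<open>R\<close> that is \<open>H x\<close> on
  the copy at \<open>x\<close>. Each \<open>H x\<close> may be any additive map, not just
  \<open>r \<mapsto> r m\<close>, which makes room for maps that are linear over another ring
  only.\<close>

definition supp_sum ::
    "('a, 'r) ring_scheme \<Rightarrow> ('m, 'c) ring_scheme \<Rightarrow> ('x \<Rightarrow> 'a \<Rightarrow> 'm) \<Rightarrow> ('x \<Rightarrow> 'a) \<Rightarrow> 'm"
  where "supp_sum R M H f = (\<Oplus>\<^bsub>M\<^esub>x\<in>{x. f x \<noteq> \<zero>\<^bsub>R\<^esub>}. H x (f x))"

lemma free_module_simps [simp]:
  "\<zero>\<^bsub>free_module R B\<^esub> = (\<lambda>x. \<zero>\<^bsub>R\<^esub>)"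
  "f \<oplus>\<^bsub>free_module R B\<^esub> g = (\<lambda>x. f x \<oplus>\<^bsub>R\<^esub> g x)"
  "a \<odot>\<^bsub>free_module R B\<^esub> f = (\<lambda>x. a \<otimes>\<^bsub>R\<^esub> f x)"
  by (simp_all add: free_module_def)

lemma free_module_carrier_iff:
  "f \<in> carrier (free_module R B) \<longleftrightarrow>
    (\<forall>x. f x \<in> carrier R) \<and> finite {x. f x \<noteq> \<zero>\<^bsub>R\<^esub>} \<and> (\<forall>x. x \<notin> B \<longrightarrow> f x = \<zero>\<^bsub>R\<^esub>)"
  by (simp add: free_module_def)

lemma free_module_left_module:
  assumes "ring R"
  shows "left_module R (free_module R B)"
proof -
  interpret R: ring R by fact
  have add: "(\<lambda>x. f x \<oplus>\<^bsub>R\<^esub> g x) \<in> carrier (free_module R B)"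
    if "f \<in> carrier (free_module R B)" "g \<in> carrier (free_module R B)" for f g
  proof -
    have "{x. f x \<oplus>\<^bsub>R\<^esub> g x \<noteq> \<zero>\<^bsub>R\<^esub>} \<subseteq> {x. f x \<noteq> \<zero>\<^bsub>R\<^esub>} \<union> {x. g x \<noteq> \<zero>\<^bsub>R\<^esub>}" by auto
    then show ?thesis using that by (auto simp: free_module_carrier_iff intro: finite_subset)
  qed
  have smult: "(\<lambda>x. a \<otimes>\<^bsub>R\<^esub> f x) \<in> carrier (free_module R B)"
    if "a \<in> carrier R" "f \<in> carrier (free_module R B)" for a f
  proof -
    have "{x. a \<otimes>\<^bsub>R\<^esub> f x \<noteq> \<zero>\<^bsub>R\<^esub>} \<subseteq> {x. f x \<noteq> \<zero>\<^bsub>R\<^esub>}" using that by auto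
    then show ?thesis using that by (auto simp: free_module_carrier_iff intro: finite_subset)
  qed
  have c: "f x \<in> carrier R" if "f \<in> carrier (free_module R B)" for f x
    using that by (simp add: free_module_carrier_iff)
  have "abelian_group (free_module R B)"
  proof (rule abelian_groupI)
    fix f assume f: "f \<in> carrier (free_module R B)"
    have "(\<lambda>x. \<ominus>\<^bsub>R\<^esub> \<one>\<^bsub>R\<^esub> \<otimes>\<^bsub>R\<^esub> f x) \<oplus>\<^bsub>free_module R B\<^esub> f = \<zero>\<^bsub>free_module R B\<^esub>"
      using c[OF f] by (auto simp: R.l_minus R.l_neg)
    moreover have "(\<lambda>x. \<ominus>\<^bsub>R\<^esub> \<one>\<^bsub>R\<^esub> \<otimes>\<^bsub>R\<^esub> f x) \<in> carrier (free_module R B)"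
      by (rule smult[OF _ f]) simp
    ultimately show "\<exists>g\<in>carrier (free_module R B). g \<oplus>\<^bsub>free_module R B\<^esub> f = \<zero>\<^bsub>free_module R B\<^esub>" by blast
  qed (auto simp: add c R.a_ac, simp add: free_module_carrier_iff)
  then show ?thesis
    by (intro left_module.intro left_module_axioms.intro assms)
      (auto simp: smult c R.l_distr R.r_distr R.m_assoc)
qed

lemma basis_vec_carrier: "\<lbrakk>ring R; x \<in> B\<rbrakk> \<Longrightarrow> basis_vec R x \<in> carrier (free_module R B)"
  by (auto simp: free_module_carrier_iff basis_vec_def ring.ring_simprules)

locale supp_sum_setup = R?: ring R + M?: abelian_group M
  for R :: "('a, 'r) ring_scheme" (structure) and M :: "('m, 'c) ring_scheme" (structure) +
  fixes B :: "'x set" and H :: "'x \<Rightarrow> 'a \<Rightarrow> 'm"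
  assumes H_closed: "\<lbrakk>x \<in> B; r \<in> carrier R\<rbrakk> \<Longrightarrow> H x r \<in> carrier M"
    and H_add: "\<lbrakk>x \<in> B; r \<in> carrier R; s \<in> carrier R\<rbrakk> \<Longrightarrow> H x (r \<oplus> s) = H x r \<oplus>\<^bsub>M\<^esub> H x s"
begin

lemma H_zero: "x \<in> B \<Longrightarrow> H x \<zero> = \<zero>\<^bsub>M\<^esub>"
  by (rule additive_zero[of R M]) (auto simp: H_closed H_add[symmetric] R.abelian_group_axioms M.abelian_group_axioms)

text \<open>Lets the sums for \<open>f\<close>, \<open>g\<close> and \<open>f + g\<close> run over
  one index set.\<close>

lemma supp_sum_superset:
  assumes f: "f \<in> carrier (free_module R B)" and T: "finite T" "{x. f x \<noteq> \<zero>} \<subseteq> T" "T \<subseteq> B"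
  shows "supp_sum R M H f = (\<Oplus>\<^bsub>M\<^esub>x\<in>T. H x (f x))"
  unfolding supp_sum_def
  by (rule M.add.finprod_mono_neutral_cong_left)
    (use f T in \<open>auto simp: free_module_carrier_iff H_zero intro!: H_closed\<close>)

lemma supp_sum_closed:
  assumes "f \<in> carrier (free_module R B)"
  shows "supp_sum R M H f \<in> carrier M"
  unfolding supp_sum_def
  by (rule M.finsum_closed) (use assms in \<open>auto simp: free_module_carrier_iff intro!: H_closed\<close>)

lemma supp_sum_add:
  assumes f: "f \<in> carrier (free_module R B)" and g: "g \<in> carrier (free_module R B)"
  shows "supp_sum R M H (f \<oplus>\<^bsub>free_module R B\<^esub> g) = supp_sum R M H f \<oplus>\<^bsub>M\<^esub> supp_sum R M H g"
proof -
  interpret F: left_module R "free_module R B"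
    by (rule free_module_left_module) (rule R.ring_axioms)
  let ?T = "{x. f x \<noteq> \<zero>} \<union> {x. g x \<noteq> \<zero>}"
  have T: "finite ?T" "?T \<subseteq> B" using f g by (auto simp: free_module_carrier_iff)
  have fg: "f \<oplus>\<^bsub>free_module R B\<^esub> g \<in> carrier (free_module R B)" using f g by (rule F.M.a_closed)
  have cl: "f x \<in> carrier R" "g x \<in> carrier R" for x using f g by (auto simp: free_module_carrier_iff)
  have "supp_sum R M H (f \<oplus>\<^bsub>free_module R B\<^esub> g) = (\<Oplus>\<^bsub>M\<^esub>x\<in>?T. H x (f x \<oplus> g x))"
    by (subst supp_sum_superset[OF fg T(1) _ T(2)]) auto
  also have "\<dots> = (\<Oplus>\<^bsub>M\<^esub>x\<in>?T. H x (f x) \<oplus>\<^bsub>M\<^esub> H x (g x))"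
    by (rule M.finsum_cong') (use T(2) cl in \<open>auto simp: H_add H_closed\<close>)
  also have "\<dots> = (\<Oplus>\<^bsub>M\<^esub>x\<in>?T. H x (f x)) \<oplus>\<^bsub>M\<^esub> (\<Oplus>\<^bsub>M\<^esub>x\<in>?T. H x (g x))"
    by (rule M.finsum_addf) (use T(2) cl in \<open>auto simp: H_closed\<close>)
  also have "\<dots> = supp_sum R M H f \<oplus>\<^bsub>M\<^esub> supp_sum R M H g"
    using supp_sum_superset[OF f T(1) _ T(2)] supp_sum_superset[OF g T(1) _ T(2)] by auto
  finally show ?thesis .
qed

lemma supp_sum_hom:
  assumes N: "abelian_group N" and f: "f \<in> carrier (free_module R B)"
    and cl: "\<And>m. m \<in> carrier M \<Longrightarrow> \<theta> m \<in> carrier N"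
    and add: "\<And>m n. \<lbrakk>m \<in> carrier M; n \<in> carrier M\<rbrakk> \<Longrightarrow> \<theta> (m \<oplus>\<^bsub>M\<^esub> n) = \<theta> m \<oplus>\<^bsub>N\<^esub> \<theta> n"
  shows "\<theta> (supp_sum R M H f) = supp_sum R N (\<lambda>x r. \<theta> (H x r)) f"
proof -
  interpret N: abelian_group N by fact
  have z: "\<theta> \<zero>\<^bsub>M\<^esub> = \<zero>\<^bsub>N\<^esub>"
    by (rule additive_zero[of M N]) (auto simp: cl add[symmetric] N.abelian_group_axioms M.abelian_group_axioms)
  have "\<theta> (\<Oplus>\<^bsub>M\<^esub>x\<in>T. H x (f x)) = (\<Oplus>\<^bsub>N\<^esub>x\<in>T. \<theta> (H x (f x)))" if "finite T" "T \<subseteq> B" for T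
    using that
  proof (induction T rule: finite_induct)
    case (insert x T)
    then have "(\<lambda>x. H x (f x)) \<in> T \<rightarrow> carrier M" "H x (f x) \<in> carrier M"
      using f by (auto simp: free_module_carrier_iff intro!: H_closed)
    moreover from this have "(\<Oplus>\<^bsub>M\<^esub>x\<in>T. H x (f x)) \<in> carrier M" by (intro M.finsum_closed)
    ultimately show ?case using insert cl
      by (subst M.finsum_insert, simp_all add: add) (subst N.finsum_insert, auto)
  qed (simp add: z)
  then show ?thesis
    using f unfolding supp_sum_def by (auto simp: free_module_carrier_iff)
qed

text \<open>The target is an abelian group on which \<open>a\<close> acts through an additive map
  \<open>\<theta>\<close>. Under restriction of scalars, \<open>a\<close> is the image of a scalar
  and \<open>\<theta>\<close> is the action of that scalar.\<close>

lemma supp_sum_smult: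
  assumes a: "a \<in> carrier R" and f: "f \<in> carrier (free_module R B)"
    and cl: "\<And>m. m \<in> carrier M \<Longrightarrow> \<theta> m \<in> carrier M"
    and add: "\<And>m n. \<lbrakk>m \<in> carrier M; n \<in> carrier M\<rbrakk> \<Longrightarrow> \<theta> (m \<oplus>\<^bsub>M\<^esub> n) = \<theta> m \<oplus>\<^bsub>M\<^esub> \<theta> n"
    and H: "\<And>x r. \<lbrakk>x \<in> B; r \<in> carrier R\<rbrakk> \<Longrightarrow> H x (a \<otimes> r) = \<theta> (H x r)"
  shows "supp_sum R M H (a \<odot>\<^bsub>free_module R B\<^esub> f) = \<theta> (supp_sum R M H f)"
proof -
  interpret F: left_module R "free_module R B"
    by (rule free_module_left_module) (rule R.ring_axioms)
  have af: "a \<odot>\<^bsub>free_module R B\<^esub> f \<in> carrier (free_module R B)" using a f by (rule F.smult_closed)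
  let ?T = "{x. f x \<noteq> \<zero>}"
  have T: "finite ?T" "?T \<subseteq> B" and cf: "f x \<in> carrier R" for x
    using f by (auto simp: free_module_carrier_iff)
  have "supp_sum R M H (a \<odot>\<^bsub>free_module R B\<^esub> f) = (\<Oplus>\<^bsub>M\<^esub>x\<in>?T. H x (a \<otimes> f x))"
    by (subst supp_sum_superset[OF af T(1) _ T(2)]) (use a in auto)
  also have "\<dots> = (\<Oplus>\<^bsub>M\<^esub>x\<in>?T. \<theta> (H x (f x)))"
    by (rule M.finsum_cong') (use T(2) cf in \<open>auto simp: H H_closed cl\<close>)
  also have "\<dots> = \<theta> (supp_sum R M H f)"
    using supp_sum_hom[OF M.abelian_group_axioms f cl add] unfolding supp_sum_def by simp
  finally show ?thesis .
qed

lemma supp_sum_basis_vec: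
  assumes "x \<in> B" "\<one> \<noteq> \<zero>" "c \<in> carrier R"
  shows "supp_sum R M H (c \<odot>\<^bsub>free_module R B\<^esub> basis_vec R x) = H x c"
proof -
  have f: "(c \<odot>\<^bsub>free_module R B\<^esub> basis_vec R x) \<in> carrier (free_module R B)"
    using assms by (intro left_module.smult_closed[OF free_module_left_module] basis_vec_carrier R.ring_axioms)
  have "supp_sum R M H (c \<odot>\<^bsub>free_module R B\<^esub> basis_vec R x)
      = (\<Oplus>\<^bsub>M\<^esub>y\<in>{x}. H y ((c \<odot>\<^bsub>free_module R B\<^esub> basis_vec R x) y))"
    by (rule supp_sum_superset[OF f]) (use assms in \<open>auto simp: basis_vec_def split: if_splits\<close>)
  also have "\<dots> = H x c" using assms by (simp add: basis_vec_def H_closed)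
  finally show ?thesis .
qed

end

definition regular_module :: "('a, 'r) ring_scheme \<Rightarrow> ('a, 'a) module"
  where "regular_module R =
    \<lparr>carrier = carrier R, monoid.mult = undefined, one = undefined, ring.zero = \<zero>\<^bsub>R\<^esub>,
     add = add R, smult = monoid.mult R\<rparr>"

lemma regular_module_simps [simp]:
  "carrier (regular_module R) = carrier R"
  "\<zero>\<^bsub>regular_module R\<^esub> = \<zero>\<^bsub>R\<^esub>"
  "x \<oplus>\<^bsub>regular_module R\<^esub> y = x \<oplus>\<^bsub>R\<^esub> y"
  "a \<odot>\<^bsub>regular_module R\<^esub> x = a \<otimes>\<^bsub>R\<^esub> x"
  by (simp_all add: regular_module_def)

lemma projective_module_section:
  assumes "projective_module R U"
  obtains s where "s \<in> lin_maps R U (free_module R (carrier U))"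
    and "\<And>u. u \<in> carrier U \<Longrightarrow> supp_sum R U (\<lambda>x r. r \<odot>\<^bsub>U\<^esub> x) (s u) = u"
proof -
  from assms obtain s where s: "s \<in> lin_maps R U (free_module R (carrier U))"
    and sum: "\<And>m. m \<in> carrier U \<Longrightarrow>
      (\<Oplus>\<^bsub>U\<^esub>x\<in>{x \<in> carrier U. s m x \<noteq> \<zero>\<^bsub>R\<^esub>}. s m x \<odot>\<^bsub>U\<^esub> x) = m"
    unfolding projective_module_def by blast
  have "supp_sum R U (\<lambda>x r. r \<odot>\<^bsub>U\<^esub> x) (s u) = u" if u: "u \<in> carrier U" for u
  proof -
    have "{x \<in> carrier U. s u x \<noteq> \<zero>\<^bsub>R\<^esub>} = {x. s u x \<noteq> \<zero>\<^bsub>R\<^esub>}"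
      using lin_maps_closed[OF s u] by (auto simp: free_module_carrier_iff)
    then show ?thesis using sum[OF u] by (simp add: supp_sum_def)
  qed
  with s show thesis by (rule that)
qed

text \<open>Lifting passes from \<open>R\<close> to direct sums of copies of \<open>R\<close> and on
  to direct summands: select on each copy along \<open>r \<mapsto> r x\<close>, add up, and
  precompose with the section \<open>s\<close>. As \<open>s\<close> is linear over \<open>R\<close>,
  it is linear over \<open>A\<close> as well.\<close>

lemma projective_module_selections:
  assumes P: "projective_module R U" and A: "ring A" and h: "h \<in> ring_hom A R"
    and V: "left_module A V"
    and sel: "selections A (restrict_scalars h (regular_module R)) V"
  shows "selections A (restrict_scalars h U) V"
proof (rule selectionsI)
  have U: "left_module R U" using P by (simp add: projective_module_def)
  interpret U: left_module R U by fact
  interpret V: left_module A V by fact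
  obtain s where s: "s \<in> lin_maps R U (free_module R (carrier U))"
    and sum: "\<And>u. u \<in> carrier U \<Longrightarrow> supp_sum R U (\<lambda>x r. r \<odot>\<^bsub>U\<^esub> x) (s u) = u"
    by (rule projective_module_section[OF P]) (rule that)
  fix \<rho> assume \<rho>: "lin_rel A (restrict_scalars h U) V \<rho>"
    and total: "\<And>x. x \<in> carrier (restrict_scalars h U) \<Longrightarrow> \<exists>y. (x, y) \<in> \<rho>"
  have rc: "r \<in> carrier A \<Longrightarrow> h r \<in> carrier R" for r using h by (rule ring_hom_closed)
  note \<rho>D = lin_relD[OF \<rho>, simplified]
  have "\<exists>H\<in>lin_maps A (restrict_scalars h (regular_module R)) V.
      \<forall>r\<in>carrier R. (r \<odot>\<^bsub>U\<^esub> x, H r) \<in> \<rho>" if x: "x \<in> carrier U" for x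
  proof -
    \<comment> \<open>The pullback of \<open>\<rho>\<close> along \<open>r \<mapsto> r x\<close>, a
      total relation on the copy of \<open>R\<close> that belongs to \<open>x\<close>.\<close>
    let ?\<sigma> = "{(r, v). r \<in> carrier R \<and> (r \<odot>\<^bsub>U\<^esub> x, v) \<in> \<rho>}"
    have "lin_rel A (restrict_scalars h (regular_module R)) V ?\<sigma>"
      by (rule lin_relI)
        (use x \<rho>D rc in \<open>auto simp: U.smult_l_zero U.smult_l_distr U.smult_assoc1\<close>)
    moreover have "\<exists>v. (r, v) \<in> ?\<sigma>" if "r \<in> carrier (restrict_scalars h (regular_module R))" for r
      using total[of "r \<odot>\<^bsub>U\<^esub> x"] that x by (auto simp: U.smult_closed)
    ultimately obtain H where "H \<in> lin_maps A (restrict_scalars h (regular_module R)) V"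
      "\<forall>r\<in>carrier (restrict_scalars h (regular_module R)). (r, H r) \<in> ?\<sigma>"
      using selectionsD[OF sel, of ?\<sigma>] by blast
    then show ?thesis by auto
  qed
  then obtain H where H: "\<And>x. x \<in> carrier U \<Longrightarrow> H x \<in> lin_maps A (restrict_scalars h (regular_module R)) V"
    and H\<rho>: "\<And>x r. \<lbrakk>x \<in> carrier U; r \<in> carrier R\<rbrakk> \<Longrightarrow> (r \<odot>\<^bsub>U\<^esub> x, H x r) \<in> \<rho>"
    by metis
  interpret S: supp_sum_setup R V "carrier U" H
    by unfold_locales
      (use lin_maps_closed[OF H] lin_maps_add[OF H] in auto)
  interpret SU: supp_sum_setup R U "carrier U" "\<lambda>x r. r \<odot>\<^bsub>U\<^esub> x"
    by unfold_locales (auto simp: U.smult_closed U.smult_l_distr)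
  define g where "g = (\<lambda>u\<in>carrier U. supp_sum R V H (s u))"
  have "g \<in> lin_maps A (restrict_scalars h U) V"
  proof (rule lin_mapsI)
    show "g \<in> carrier (restrict_scalars h U) \<rightarrow>\<^sub>E carrier V"
      using S.supp_sum_closed[OF lin_maps_closed[OF s]] by (auto simp: g_def)
  next
    fix u v assume "u \<in> carrier (restrict_scalars h U)" "v \<in> carrier (restrict_scalars h U)"
    then show "g (u \<oplus>\<^bsub>restrict_scalars h U\<^esub> v) = g u \<oplus>\<^bsub>V\<^esub> g v"
      using S.supp_sum_add[OF lin_maps_closed[OF s] lin_maps_closed[OF s]]
      by (simp add: g_def lin_maps_add[OF s] del: free_module_simps)
  next
    fix a u assume a: "a \<in> carrier A" and "u \<in> carrier (restrict_scalars h U)"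
    then have u: "u \<in> carrier U" by simp
    have "supp_sum R V H (h a \<odot>\<^bsub>free_module R (carrier U)\<^esub> s u) = a \<odot>\<^bsub>V\<^esub> supp_sum R V H (s u)"
      by (rule S.supp_sum_smult)
        (use a u rc lin_maps_closed[OF s] lin_maps_smult[OF H] in \<open>auto simp: V.smult_closed V.smult_r_distr\<close>)
    then show "g (a \<odot>\<^bsub>restrict_scalars h U\<^esub> u) = a \<odot>\<^bsub>V\<^esub> g u"
      using a u rc by (simp add: g_def lin_maps_smult[OF s] U.smult_closed del: free_module_simps)
  qed
  moreover have "(u, g u) \<in> \<rho>" if u: "u \<in> carrier U" for u
  proof -
    have f: "s u \<in> carrier (free_module R (carrier U))" using s u by (rule lin_maps_closed)
    \<comment> \<open>Membership in \<open>\<rho>\<close> is carried along partial sums; over the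
      full support the first component becomes \<open>u\<close> because \<open>s\<close> is a
      section.\<close>
    have "(\<Oplus>\<^bsub>U\<^esub>x\<in>T. s u x \<odot>\<^bsub>U\<^esub> x, \<Oplus>\<^bsub>V\<^esub>x\<in>T. H x (s u x)) \<in> \<rho>" if "finite T" "T \<subseteq> carrier U" for T
      using that
    proof (induction T rule: finite_induct)
      case (insert x T)
      have 1: "(\<lambda>x. s u x \<odot>\<^bsub>U\<^esub> x) \<in> T \<rightarrow> carrier U" "s u x \<odot>\<^bsub>U\<^esub> x \<in> carrier U"
        "(\<lambda>x. H x (s u x)) \<in> T \<rightarrow> carrier V" "H x (s u x) \<in> carrier V" "s u x \<in> carrier R"
        using insert.prems f by (auto simp: free_module_carrier_iff intro!: SU.H_closed S.H_closed)
      have 2: "(\<Oplus>\<^bsub>U\<^esub>x\<in>insert x T. s u x \<odot>\<^bsub>U\<^esub> x) = s u x \<odot>\<^bsub>U\<^esub> x \<oplus>\<^bsub>U\<^esub> (\<Oplus>\<^bsub>U\<^esub>x\<in>T. s u x \<odot>\<^bsub>U\<^esub> x)"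
        by (rule U.M.finsum_insert) (use insert.hyps 1 in auto)
      have 3: "(\<Oplus>\<^bsub>V\<^esub>x\<in>insert x T. H x (s u x)) = H x (s u x) \<oplus>\<^bsub>V\<^esub> (\<Oplus>\<^bsub>V\<^esub>x\<in>T. H x (s u x))"
        by (rule V.M.finsum_insert) (use insert.hyps 1 in auto)
      show ?case unfolding 2 3
        using \<rho>D(4) H\<rho>[of x "s u x"] insert 1 by auto
    qed (simp add: \<rho>D)
    from this[of "{x. s u x \<noteq> \<zero>\<^bsub>R\<^esub>}"] show ?thesis
      using f sum[OF u] u by (auto simp: g_def supp_sum_def free_module_carrier_iff)
  qed
  ultimately show "\<exists>f\<in>lin_maps A (restrict_scalars h U) V. \<forall>x\<in>carrier (restrict_scalars h U). (x, f x) \<in> \<rho>"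
    by auto
qed

text \<open>Any partner of one in the relation determines a linear map on all of \<open>R\<close>,
  and linearity of the relation keeps its graph inside.\<close>

lemma regular_module_selections:
  assumes "left_module R V"
  shows "selections R (regular_module R) V"
proof (rule selectionsI)
  interpret V: left_module R V by fact
  fix \<rho> assume \<rho>: "lin_rel R (regular_module R) V \<rho>"
    and total: "\<And>x. x \<in> carrier (regular_module R) \<Longrightarrow> \<exists>y. (x, y) \<in> \<rho>"
  obtain v where v: "(\<one>\<^bsub>R\<^esub>, v) \<in> \<rho>" using total by auto
  then have vc: "v \<in> carrier V" using lin_relD(2)[OF \<rho>] by blast
  have "(\<lambda>r\<in>carrier R. r \<odot>\<^bsub>V\<^esub> v) \<in> lin_maps R (regular_module R) V"
    by (rule lin_mapsI) (use vc in \<open>auto simp: V.smult_closed V.smult_l_distr V.smult_assoc1\<close>)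
  moreover have "(r, r \<odot>\<^bsub>V\<^esub> v) \<in> \<rho>" if "r \<in> carrier R" for r
    using lin_relD(5)[OF \<rho> that v] that by simp
  ultimately show "\<exists>f\<in>lin_maps R (regular_module R) V. \<forall>x\<in>carrier (regular_module R). (x, f x) \<in> \<rho>"
    by (auto intro!: bexI[of _ "\<lambda>r\<in>carrier R. r \<odot>\<^bsub>V\<^esub> v"])
qed

section \<open>Comparison of complexes\<close>

text \<open>\<open>projective_resolution\<close> with its terms only assumed to be modules. This is
  what restriction of scalars visibly preserves; liftings out of the restricted terms are supplied
  separately.\<close>

definition exact_resolution ::
    "('a, 'r) ring_scheme \<Rightarrow> ('a, 'm, 'c) module_scheme \<Rightarrow> ('a, 'p, 'm) augmented_complex \<Rightarrow> bool"
  where "exact_resolution A M P \<longleftrightarrow>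
    (\<forall>n. left_module A (ob P n)) \<and>
    (\<forall>n. bd P n \<in> lin_maps A (ob P (Suc n)) (ob P n)) \<and>
    to_base P \<in> lin_maps A (ob P 0) M \<and>
    (\<forall>n. {x \<in> carrier (ob P (Suc n)). bd P n x = \<zero>\<^bsub>ob P n\<^esub>}
          = bd P (Suc n) ` carrier (ob P (Suc (Suc n)))) \<and>
    {x \<in> carrier (ob P 0). to_base P x = \<zero>\<^bsub>M\<^esub>} = bd P 0 ` carrier (ob P (Suc 0)) \<and>
    to_base P ` carrier (ob P 0) = carrier M"

lemma projective_resolution_exact: "projective_resolution A M P \<Longrightarrow> exact_resolution A M P"
  by (auto simp: projective_resolution_def exact_resolution_def projective_module_def)

lemma exact_resolutionD:
  assumes "exact_resolution A M P"
  shows "left_module A (ob P n)"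
    and "bd P n \<in> lin_maps A (ob P (Suc n)) (ob P n)"
    and "to_base P \<in> lin_maps A (ob P 0) M"
    and "\<lbrakk>x \<in> carrier (ob P (Suc n)); bd P n x = \<zero>\<^bsub>ob P n\<^esub>\<rbrakk> \<Longrightarrow>
      x \<in> bd P (Suc n) ` carrier (ob P (Suc (Suc n)))"
    and "x \<in> carrier (ob P (Suc (Suc n))) \<Longrightarrow> bd P n (bd P (Suc n) x) = \<zero>\<^bsub>ob P n\<^esub>"
    and "\<lbrakk>x \<in> carrier (ob P 0); to_base P x = \<zero>\<^bsub>M\<^esub>\<rbrakk> \<Longrightarrow> x \<in> bd P 0 ` carrier (ob P (Suc 0))"
    and "x \<in> carrier (ob P (Suc 0)) \<Longrightarrow> to_base P (bd P 0 x) = \<zero>\<^bsub>M\<^esub>"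
    and "to_base P ` carrier (ob P 0) = carrier M"
proof -
  note * = assms[unfolded exact_resolution_def]
  have e: "{x \<in> carrier (ob P (Suc n)). bd P n x = \<zero>\<^bsub>ob P n\<^esub>}
      = bd P (Suc n) ` carrier (ob P (Suc (Suc n)))" for n using * by blast
  have e0: "{x \<in> carrier (ob P 0). to_base P x = \<zero>\<^bsub>M\<^esub>} = bd P 0 ` carrier (ob P (Suc 0))"
    using * by blast
  show "left_module A (ob P n)" "bd P n \<in> lin_maps A (ob P (Suc n)) (ob P n)"
    "to_base P \<in> lin_maps A (ob P 0) M" "to_base P ` carrier (ob P 0) = carrier M"
    using * by blast+
  show "\<lbrakk>x \<in> carrier (ob P (Suc n)); bd P n x = \<zero>\<^bsub>ob P n\<^esub>\<rbrakk> \<Longrightarrow>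
      x \<in> bd P (Suc n) ` carrier (ob P (Suc (Suc n)))" using e[of n] by blast
  show "x \<in> carrier (ob P (Suc (Suc n))) \<Longrightarrow> bd P n (bd P (Suc n) x) = \<zero>\<^bsub>ob P n\<^esub>"
    using e[of n] by blast
  show "\<lbrakk>x \<in> carrier (ob P 0); to_base P x = \<zero>\<^bsub>M\<^esub>\<rbrakk> \<Longrightarrow> x \<in> bd P 0 ` carrier (ob P (Suc 0))"
    using e0 by blast
  show "x \<in> carrier (ob P (Suc 0)) \<Longrightarrow> to_base P (bd P 0 x) = \<zero>\<^bsub>M\<^esub>" using e0 by blast
qed

text \<open>\<open>C\<close> is a complex with the lifting property, \<open>P\<close> is exact. No
  augmentation of \<open>C\<close> is fixed, so the setting covers a resolution, its shift by
  \<open>n\<close> when cocycles are lifted, and a restricted resolution.\<close>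

locale comparison =
  fixes A :: "('a, 'r) ring_scheme" and C :: "nat \<Rightarrow> ('a, 'x) module" and D :: "nat \<Rightarrow> 'x \<Rightarrow> 'x"
    and N :: "('a, 'n, 'c) module_scheme" and P :: "('a, 'p, 'n) augmented_complex"
  assumes C_module: "left_module A (C i)"
    and D_linear: "D i \<in> lin_maps A (C (Suc i)) (C i)"
    and D_D: "x \<in> carrier (C (Suc (Suc i))) \<Longrightarrow> D i (D (Suc i) x) = \<zero>\<^bsub>C i\<^esub>"
    and N_group: "abelian_group N"
    and exact: "exact_resolution A N P"
    and C_selections: "selections A (C i) (ob P j)"
begin

definition chain_map :: "(nat \<Rightarrow> 'x \<Rightarrow> 'p) \<Rightarrow> bool"
  where "chain_map G \<longleftrightarrow> (\<forall>i. G i \<in> lin_maps A (C i) (ob P i)) \<and>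
    (\<forall>i. \<forall>x\<in>carrier (C (Suc i)). bd P i (G (Suc i) x) = G i (D i x))"

lemma chain_mapD:
  assumes "chain_map G"
  shows "G i \<in> lin_maps A (C i) (ob P i)"
    and "x \<in> carrier (C (Suc i)) \<Longrightarrow> bd P i (G (Suc i) x) = G i (D i x)"
  using assms by (auto simp: chain_map_def)

lemmas P_module = exact_resolutionD(1)[OF exact]
  and bd_linear = exact_resolutionD(2)[OF exact]
  and to_base_linear = exact_resolutionD(3)[OF exact]

lemma P_group: "abelian_group (ob P i)" and C_group: "abelian_group (C i)"
  by (rule left_module_abelian_group, rule P_module) (rule left_module_abelian_group, rule C_module)

lemma chain_map_exists:
  assumes g: "g \<in> lin_maps A (C 0) N" and gD: "\<And>x. x \<in> carrier (C (Suc 0)) \<Longrightarrow> g (D 0 x) = \<zero>\<^bsub>N\<^esub>"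
  obtains G where "chain_map G" "\<And>x. x \<in> carrier (C 0) \<Longrightarrow> to_base P (G 0 x) = g x"
proof -
  \<comment> \<open>The second clause is the solvability of the next step. It comes from exactness
    at \<open>to_base\<close> for \<open>n = 0\<close> and from exactness at \<open>bd\<close>
    afterwards, and has the same form in both cases.\<close>
  define I where "I = (\<lambda>n G. G \<in> lin_maps A (C n) (ob P n) \<and>
    (\<forall>x\<in>carrier (C (Suc n)). G (D n x) \<in> bd P n ` carrier (ob P (Suc n))) \<and>
    (n = 0 \<longrightarrow> (\<forall>x\<in>carrier (C 0). to_base P (G x) = g x)))"
  have "\<exists>G. I 0 G"
  proof -
    obtain G where G: "G \<in> lin_maps A (C 0) (ob P 0)" "\<And>x. x \<in> carrier (C 0) \<Longrightarrow> to_base P (G x) = g x"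
      using selections_lift[OF C_selections C_module P_module N_group to_base_linear g]
        lin_maps_closed[OF g] exact_resolutionD(8)[OF exact] by metis
    then have "I 0 G"
      using gD lin_maps_closed[OF G(1)] lin_maps_closed[OF D_linear]
      by (auto simp: I_def intro!: exact_resolutionD(6)[OF exact])
    then show ?thesis by blast
  qed
  moreover have "\<exists>G'. I (Suc n) G' \<and> (\<forall>x\<in>carrier (C (Suc n)). bd P n (G' x) = G (D n x))" if I: "I n G" for n G
  proof -
    have G: "G \<in> lin_maps A (C n) (ob P n)" using I by (simp add: I_def)
    have GD: "compose (carrier (C (Suc n))) G (D n) \<in> lin_maps A (C (Suc n)) (ob P n)"
      by (rule lin_maps_compose[OF D_linear G C_module])
    obtain G' where G': "G' \<in> lin_maps A (C (Suc n)) (ob P (Suc n))"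
      "\<And>x. x \<in> carrier (C (Suc n)) \<Longrightarrow> bd P n (G' x) = G (D n x)"
      by (rule selections_lift[OF C_selections C_module P_module P_group bd_linear GD])
        (use I in \<open>auto simp: compose_def I_def\<close>)
    have "G' (D (Suc n) x) \<in> bd P (Suc n) ` carrier (ob P (Suc (Suc n)))"
      if x: "x \<in> carrier (C (Suc (Suc n)))" for x
    proof (rule exact_resolutionD(4)[OF exact])
      show "G' (D (Suc n) x) \<in> carrier (ob P (Suc n))"
        using x by (intro lin_maps_closed[OF G'(1)] lin_maps_closed[OF D_linear])
      show "bd P n (G' (D (Suc n) x)) = \<zero>\<^bsub>ob P n\<^esub>"
        using x by (simp add: G'(2) lin_maps_closed[OF D_linear] D_D lin_maps_zero[OF C_group P_group G])
    qed
    then show ?thesis using G' by (auto simp: I_def)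
  qed
  ultimately obtain G where "\<forall>n. I n (G n) \<and> (\<forall>x\<in>carrier (C (Suc n)). bd P n (G (Suc n) x) = G n (D n x))"
    using dependent_nat_choice[of I "\<lambda>n G G'. \<forall>x\<in>carrier (C (Suc n)). bd P n (G' x) = G (D n x)"] by blast
  then show thesis by (intro that[of G]) (auto simp: I_def chain_map_def)
qed

lemma null_homotopy:
  assumes G: "chain_map G" and G0: "\<And>x. x \<in> carrier (C 0) \<Longrightarrow> to_base P (G 0 x) = \<zero>\<^bsub>N\<^esub>"
  obtains h where "\<And>i. h i \<in> lin_maps A (C i) (ob P (Suc i))"
    and "\<And>x. x \<in> carrier (C 0) \<Longrightarrow> bd P 0 (h 0 x) = G 0 x"
    and "\<And>i x. x \<in> carrier (C (Suc i)) \<Longrightarrow>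
      bd P (Suc i) (h (Suc i) x) = G (Suc i) x \<ominus>\<^bsub>ob P (Suc i)\<^esub> h i (D i x)"
proof -
  note GL = chain_mapD(1)[OF G] and Gd = chain_mapD(2)[OF G]
  \<comment> \<open>The second clause makes \<open>G - h D\<close> a cycle in the next degree, hence
    a boundary. For \<open>n = 0\<close> it is contained in the first lift, later it follows from
    \<open>D D = 0\<close>.\<close>
  define I where "I = (\<lambda>n h. h \<in> lin_maps A (C n) (ob P (Suc n)) \<and>
    (\<forall>x\<in>carrier (C (Suc n)). bd P n (h (D n x)) = G n (D n x)) \<and>
    (n = 0 \<longrightarrow> (\<forall>x\<in>carrier (C 0). bd P 0 (h x) = G 0 x)))"
  define Q where "Q = (\<lambda>n h h'. \<forall>x\<in>carrier (C (Suc n)).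
    bd P (Suc n) (h' x) = G (Suc n) x \<ominus>\<^bsub>ob P (Suc n)\<^esub> h (D n x))"
  have "\<exists>h. I 0 h"
  proof -
    obtain h where h: "h \<in> lin_maps A (C 0) (ob P (Suc 0))" "\<And>x. x \<in> carrier (C 0) \<Longrightarrow> bd P 0 (h x) = G 0 x"
      by (rule selections_lift[OF C_selections C_module P_module P_group bd_linear GL])
        (use G0 lin_maps_closed[OF GL] in \<open>auto intro: exact_resolutionD(6)[OF exact]\<close>)
    then have "I 0 h" using lin_maps_closed[OF D_linear] by (auto simp: I_def)
    then show ?thesis by blast
  qed
  moreover have "\<exists>h'. I (Suc n) h' \<and> Q n h h'" if I: "I n h" for n h
  proof -
    interpret Pn: abelian_group "ob P n" by (rule P_group)
    interpret Ps: abelian_group "ob P (Suc n)" by (rule P_group)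
    have h: "h \<in> lin_maps A (C n) (ob P (Suc n))" using I by (simp add: I_def)
    have hD: "compose (carrier (C (Suc n))) h (D n) \<in> lin_maps A (C (Suc n)) (ob P (Suc n))"
      by (rule lin_maps_compose[OF D_linear h C_module])
    define f where "f = (\<lambda>x\<in>carrier (C (Suc n)). G (Suc n) x \<ominus>\<^bsub>ob P (Suc n)\<^esub>
      compose (carrier (C (Suc n))) h (D n) x)"
    have f: "f \<in> lin_maps A (C (Suc n)) (ob P (Suc n))"
      unfolding f_def by (rule lin_maps_diff[OF C_module P_module GL hD])
    have f_eq: "f x = G (Suc n) x \<ominus>\<^bsub>ob P (Suc n)\<^esub> h (D n x)" if "x \<in> carrier (C (Suc n))" for x
      using that by (simp add: f_def compose_def)
    have im: "f x \<in> bd P (Suc n) ` carrier (ob P (Suc (Suc n)))" if x: "x \<in> carrier (C (Suc n))" for x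
    proof (rule exact_resolutionD(4)[OF exact])
      show "f x \<in> carrier (ob P (Suc n))" by (rule lin_maps_closed[OF f x])
      have c: "G (Suc n) x \<in> carrier (ob P (Suc n))" "D n x \<in> carrier (C n)" "h (D n x) \<in> carrier (ob P (Suc n))"
        using x by (auto intro: lin_maps_closed[OF GL] lin_maps_closed[OF D_linear] lin_maps_closed[OF h])
      have "bd P n (f x) = bd P n (G (Suc n) x) \<ominus>\<^bsub>ob P n\<^esub> bd P n (h (D n x))"
        using x c by (simp add: f_eq lin_maps_minus[OF P_group P_group bd_linear])
      also have "bd P n (G (Suc n) x) = bd P n (h (D n x))"
        using I x Gd by (auto simp: I_def)
      finally show "bd P n (f x) = \<zero>\<^bsub>ob P n\<^esub>"
        using lin_maps_closed[OF bd_linear c(3)] by (simp add: Pn.minus_eq Pn.r_neg)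
    qed
    obtain h' where h': "h' \<in> lin_maps A (C (Suc n)) (ob P (Suc (Suc n)))"
      "\<And>x. x \<in> carrier (C (Suc n)) \<Longrightarrow> bd P (Suc n) (h' x) = f x"
      using selections_lift[OF C_selections C_module P_module P_group bd_linear f im] by blast
    have "bd P (Suc n) (h' (D (Suc n) x)) = G (Suc n) (D (Suc n) x)"
      if x: "x \<in> carrier (C (Suc (Suc n)))" for x
      using x lin_maps_closed[OF D_linear x] lin_maps_closed[OF GL lin_maps_closed[OF D_linear x]]
      by (simp add: h'(2) f_eq D_D lin_maps_zero[OF C_group P_group h] Ps.minus_eq)
    then show ?thesis using h' f_eq by (auto simp: I_def Q_def)
  qed
  ultimately obtain h where "\<forall>n. I n (h n) \<and> Q n (h n) (h (Suc n))"
    using dependent_nat_choice[of I Q] by blast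
  then show thesis by (intro that[of h]) (auto simp: I_def Q_def)
qed

text \<open>The cocycle \<open>f\<close> kills the first term of \<open>G = bd h + h D\<close>,
  which leaves \<open>f G = u D\<close> with \<open>u = f h\<close>. In degree 0 the term
  \<open>h D\<close> is absent.\<close>

lemma null_coboundary:
  assumes G: "chain_map G" and G0: "\<And>x. x \<in> carrier (C 0) \<Longrightarrow> to_base P (G 0 x) = \<zero>\<^bsub>N\<^esub>"
    and M: "abelian_group M" and f: "f \<in> lin_maps A (ob P m) M"
    and fd: "\<And>x. x \<in> carrier (ob P (Suc m)) \<Longrightarrow> f (bd P m x) = \<zero>\<^bsub>M\<^esub>"
  shows "\<lbrakk>m = 0; x \<in> carrier (C 0)\<rbrakk> \<Longrightarrow> f (G m x) = \<zero>\<^bsub>M\<^esub>"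
    and "m = Suc k \<Longrightarrow> \<exists>u\<in>lin_maps A (C k) M. \<forall>x\<in>carrier (C m). f (G m x) = u (D k x)"
proof -
  interpret M: abelian_group M by fact
  obtain h where h: "\<And>i. h i \<in> lin_maps A (C i) (ob P (Suc i))"
    and h0: "\<And>x. x \<in> carrier (C 0) \<Longrightarrow> bd P 0 (h 0 x) = G 0 x"
    and hS: "\<And>i x. x \<in> carrier (C (Suc i)) \<Longrightarrow>
      bd P (Suc i) (h (Suc i) x) = G (Suc i) x \<ominus>\<^bsub>ob P (Suc i)\<^esub> h i (D i x)"
    by (rule null_homotopy[OF G G0]) (assumption | rule that)+
  show "f (G m x) = \<zero>\<^bsub>M\<^esub>" if "m = 0" "x \<in> carrier (C 0)"
    using that fd lin_maps_closed[OF h] by (simp add: h0[symmetric])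
  assume m: "m = Suc k"
  have "f (G m x) = compose (carrier (C k)) f (h k) (D k x)" if x: "x \<in> carrier (C m)" for x
  proof -
    interpret Pm: abelian_group "ob P m" by (rule P_group)
    have c: "G m x \<in> carrier (ob P m)" "D k x \<in> carrier (C k)" "h k (D k x) \<in> carrier (ob P m)"
      "h m x \<in> carrier (ob P (Suc m))"
      using x m lin_maps_closed[OF chain_mapD(1)[OF G]] lin_maps_closed[OF D_linear] lin_maps_closed[OF h] by auto
    have "f (bd P m (h m x)) = f (G m x) \<ominus>\<^bsub>M\<^esub> f (h k (D k x))"
      using c x m by (simp add: hS lin_maps_minus[OF P_group M f[unfolded m]])
    then have "f (G m x) = f (h k (D k x))"
      using fd[OF c(4)] c lin_maps_closed[OF f] M.minus_eq_zero_iff by metis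
    then show ?thesis using c by (simp add: compose_def)
  qed
  moreover have "compose (carrier (C k)) f (h k) \<in> lin_maps A (C k) M"
    using lin_maps_compose[OF h f[unfolded m] C_module] by simp
  ultimately show "\<exists>u\<in>lin_maps A (C k) M. \<forall>x\<in>carrier (C m). f (G m x) = u (D k x)" by blast
qed

text \<open>The difference of the two chain maps lifts zero. The conclusion is written as a sum, the
  shape in which \<open>cls_eqI\<close> takes a difference by a coboundary.\<close>

lemma chain_maps_cohomologous:
  assumes G: "chain_map G" and G': "chain_map G'"
    and eq: "\<And>x. x \<in> carrier (C 0) \<Longrightarrow> to_base P (G 0 x) = to_base P (G' 0 x)"
    and M: "abelian_group M" and f: "f \<in> lin_maps A (ob P m) M"
    and fd: "\<And>x. x \<in> carrier (ob P (Suc m)) \<Longrightarrow> f (bd P m x) = \<zero>\<^bsub>M\<^esub>"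
  shows "\<lbrakk>m = 0; x \<in> carrier (C 0)\<rbrakk> \<Longrightarrow> f (G m x) = f (G' m x)"
    and "m = Suc k \<Longrightarrow> \<exists>u\<in>lin_maps A (C k) M. \<forall>x\<in>carrier (C m). f (G m x) = u (D k x) \<oplus>\<^bsub>M\<^esub> f (G' m x)"
proof -
  interpret M: abelian_group M by fact
  interpret N: abelian_group N by (rule N_group)
  define H where "H i = (\<lambda>x\<in>carrier (C i). G i x \<ominus>\<^bsub>ob P i\<^esub> G' i x)" for i
  note l = chain_mapD(1)[OF G] chain_mapD(1)[OF G'] and d = chain_mapD(2)[OF G] chain_mapD(2)[OF G']
  note c = lin_maps_closed[OF l(1)] lin_maps_closed[OF l(2)]
  have H: "H i \<in> lin_maps A (C i) (ob P i)" for i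
    unfolding H_def by (rule lin_maps_diff[OF C_module P_module l])
  have H_map: "chain_map H"
    unfolding chain_map_def
    by (auto simp: H) (simp add: H_def lin_maps_minus[OF P_group P_group bd_linear] c d lin_maps_closed[OF D_linear])
  have H0: "to_base P (H 0 x) = \<zero>\<^bsub>N\<^esub>" if "x \<in> carrier (C 0)" for x
    using that lin_maps_closed[OF to_base_linear c(2)]
    by (simp add: H_def lin_maps_minus[OF P_group N_group to_base_linear] c eq N.minus_eq N.r_neg)
  have fH: "f (H m x) = f (G m x) \<ominus>\<^bsub>M\<^esub> f (G' m x)" if "x \<in> carrier (C m)" for x
    using that by (simp add: H_def lin_maps_minus[OF P_group M f] c)
  note null = null_coboundary[OF H_map H0 M f fd]
  show "f (G m x) = f (G' m x)" if "m = 0" "x \<in> carrier (C 0)"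
  proof -
    have "f (G m x) \<in> carrier M" "f (G' m x) \<in> carrier M" using that lin_maps_closed[OF f] c by auto
    then show ?thesis using null(1)[OF _ _ that] fH[of x] that M.minus_eq_zero_iff by metis
  qed
  assume m: "m = Suc k"
  obtain u where u: "u \<in> lin_maps A (C k) M" "\<And>x. x \<in> carrier (C m) \<Longrightarrow> f (H m x) = u (D k x)"
    using null(2)[OF _ _ m] by blast
  have "f (G m x) = u (D k x) \<oplus>\<^bsub>M\<^esub> f (G' m x)" if x: "x \<in> carrier (C m)" for x
  proof -
    have "f (G m x) \<in> carrier M" "f (G' m x) \<in> carrier M"
      using x lin_maps_closed[OF f] c by auto
    then show ?thesis using u(2)[OF x] fH[OF x] M.minus_add_cancel by metis
  qed
  then show "\<exists>u\<in>lin_maps A (C k) M. \<forall>x\<in>carrier (C m). f (G m x) = u (D k x) \<oplus>\<^bsub>M\<^esub> f (G' m x)"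
    using u(1) by blast
qed

end

section \<open>Submodules and quotients\<close>

lemma (in left_module) smult_minus_one:
  assumes "x \<in> carrier M"
  shows "\<ominus>\<^bsub>M\<^esub> x = (\<ominus> \<one>) \<odot>\<^bsub>M\<^esub> x"
proof -
  have "(\<ominus> \<one>) \<odot>\<^bsub>M\<^esub> x \<oplus>\<^bsub>M\<^esub> x = \<zero>\<^bsub>M\<^esub>"
    using smult_l_distr[of "\<ominus> \<one>" "\<one>" x] assms by (simp add: smult_one R.l_neg smult_l_zero)
  then show ?thesis
    using assms by (intro M.minus_equality) (auto simp: smult_closed)
qed

lemma (in left_module) submoduleI:
  assumes sub: "H \<subseteq> carrier M" and zero: "\<zero>\<^bsub>M\<^esub> \<in> H"
    and add: "\<And>x y. \<lbrakk>x \<in> H; y \<in> H\<rbrakk> \<Longrightarrow> x \<oplus>\<^bsub>M\<^esub> y \<in> H"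
    and smult: "\<And>a x. \<lbrakk>a \<in> carrier R; x \<in> H\<rbrakk> \<Longrightarrow> a \<odot>\<^bsub>M\<^esub> x \<in> H"
  shows "submodule H R M"
proof -
  have "\<ominus>\<^bsub>M\<^esub> x \<in> H" if "x \<in> H" for x
    using smult_minus_one[of x] smult[OF _ that, of "\<ominus> \<one>"] sub that by auto
  then have "subgroup H (add_monoid M)"
    by (intro subgroup.intro) (use sub zero add in \<open>auto simp: a_inv_def\<close>)
  then show ?thesis by (intro submodule.intro submodule_axioms.intro) (use smult in auto)
qed

lemma submoduleD:
  assumes "submodule H R M"
  shows "H \<subseteq> carrier M" "\<zero>\<^bsub>M\<^esub> \<in> H"
    and "\<lbrakk>x \<in> H; y \<in> H\<rbrakk> \<Longrightarrow> x \<oplus>\<^bsub>M\<^esub> y \<in> H"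
    and "\<lbrakk>a \<in> carrier R; x \<in> H\<rbrakk> \<Longrightarrow> a \<odot>\<^bsub>M\<^esub> x \<in> H"
proof -
  interpret submodule H R M by fact
  show "H \<subseteq> carrier M" "\<zero>\<^bsub>M\<^esub> \<in> H" "\<lbrakk>x \<in> H; y \<in> H\<rbrakk> \<Longrightarrow> x \<oplus>\<^bsub>M\<^esub> y \<in> H"
    "\<lbrakk>a \<in> carrier R; x \<in> H\<rbrakk> \<Longrightarrow> a \<odot>\<^bsub>M\<^esub> x \<in> H"
    using subset one_closed m_closed smult_closed by auto
qed

lemma (in left_module) submodule_left_module:
  assumes "submodule H R M"
  shows "left_module R (M\<lparr>carrier := H\<rparr>)"
proof -
  note H = submoduleD[OF assms]
  have [simp]: "x \<in> H \<Longrightarrow> x \<in> carrier M" for x using H(1) by blast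
  have neg: "(\<ominus> \<one>) \<odot>\<^bsub>M\<^esub> x \<oplus>\<^bsub>M\<^esub> x = \<zero>\<^bsub>M\<^esub>" if "x \<in> carrier M" for x
    using that by (simp add: smult_minus_one[symmetric] M.l_neg)
  have "abelian_group (M\<lparr>carrier := H\<rparr>)"
  proof (rule abelian_groupI)
    fix x assume "x \<in> carrier (M\<lparr>carrier := H\<rparr>)"
    then show "\<exists>y\<in>carrier (M\<lparr>carrier := H\<rparr>). y \<oplus>\<^bsub>M\<lparr>carrier := H\<rparr>\<^esub> x = \<zero>\<^bsub>M\<lparr>carrier := H\<rparr>\<^esub>"
      using H(4)[of "\<ominus> \<one>" x] neg[of x] by auto
  qed (auto simp: H(2,3) M.a_ac)
  then show ?thesis
    by (intro left_module.intro left_module_axioms.intro R.ring_axioms)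
      (auto simp: H(4) smult_l_distr smult_r_distr smult_assoc1 smult_one)
qed

locale module_quotient = left_module R M
  for R :: "('a, 'r) ring_scheme" (structure) and M :: "('a, 'm, 'c) module_scheme" (structure) +
  fixes H :: "'m set"
  assumes sub: "submodule H R M"
begin

abbreviation coset :: "'m \<Rightarrow> 'm set" where "coset x \<equiv> H +>\<^bsub>M\<^esub> x"

lemma abelian_subgroup: "abelian_subgroup H M"
  using sub by (intro abelian_subgroupI3 additive_subgroupI M.abelian_group_axioms) (simp add: submodule_def)

lemma quot_simps:
  "carrier (quot_module M H) = coset ` carrier M" "\<zero>\<^bsub>quot_module M H\<^esub> = H"
  "C \<otimes>\<^bsub>quot_module M H\<^esub> C' = rcoset_mult M H C C'" "\<one>\<^bsub>quot_module M H\<^esub> = coset \<one>\<^bsub>M\<^esub>"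
  "C \<oplus>\<^bsub>quot_module M H\<^esub> C' = C <+>\<^bsub>M\<^esub> C'"
  "a \<odot>\<^bsub>quot_module M H\<^esub> C = (\<Union>x\<in>C. coset (a \<odot>\<^bsub>M\<^esub> x))"
  by (auto simp: quot_module_def ring.defs module.defs FactRing_def A_RCOSETS_def RCOSETS_def a_r_coset_def)

lemma coset_self: "x \<in> carrier M \<Longrightarrow> x \<in> coset x"
  by (rule abelian_subgroup.a_rcos_self[OF abelian_subgroup])

lemma mem_cosetD:
  assumes "x \<in> carrier M" "y \<in> coset x"
  shows "y \<in> carrier M" "coset y = coset x"
  using abelian_subgroup.a_elemrcos_carrier[OF abelian_subgroup assms]
    abelian_subgroup.a_repr_independence'[OF abelian_subgroup assms(2,1)] by simp_all

lemma coset_eq_iff: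
  assumes "x \<in> carrier M" "y \<in> carrier M"
  shows "coset x = coset y \<longleftrightarrow> x \<ominus>\<^bsub>M\<^esub> y \<in> H"
  using assms abelian_subgroup.a_rcos_module[OF abelian_subgroup, of y x] mem_cosetD[of y x] coset_self[of x]
  by (auto simp: M.minus_eq)

lemma coset_zero: "coset \<zero>\<^bsub>M\<^esub> = H"
  using submoduleD[OF sub] by (simp add: M.a_coset_add_zero)

lemma coset_add:
  "\<lbrakk>x \<in> carrier M; y \<in> carrier M\<rbrakk> \<Longrightarrow> coset x \<oplus>\<^bsub>quot_module M H\<^esub> coset y = coset (x \<oplus>\<^bsub>M\<^esub> y)"
  by (simp add: quot_simps abelian_subgroup.a_rcos_sum[OF abelian_subgroup])

lemma coset_smult:
  assumes a: "a \<in> carrier R" and x: "x \<in> carrier M"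
  shows "a \<odot>\<^bsub>quot_module M H\<^esub> coset x = coset (a \<odot>\<^bsub>M\<^esub> x)"
proof -
  \<comment> \<open>All members of the union that defines scalar multiplication in
    \<open>quot_module\<close> are the same coset.\<close>
  have "coset (a \<odot>\<^bsub>M\<^esub> y) = coset (a \<odot>\<^bsub>M\<^esub> x)" if "y \<in> coset x" for y
  proof -
    have y: "y \<in> carrier M" and yx: "y \<ominus>\<^bsub>M\<^esub> x \<in> H"
      using mem_cosetD[OF x that] coset_eq_iff[of y x] x by auto
    have "a \<odot>\<^bsub>M\<^esub> y \<ominus>\<^bsub>M\<^esub> a \<odot>\<^bsub>M\<^esub> x \<in> H"
      using submoduleD(4)[OF sub a yx] unfolding smult_minus_distr[OF a y x] .
    then show ?thesis using coset_eq_iff[of "a \<odot>\<^bsub>M\<^esub> y" "a \<odot>\<^bsub>M\<^esub> x"] a x y by (simp add: smult_closed)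
  qed
  then have "(\<Union>y\<in>coset x. coset (a \<odot>\<^bsub>M\<^esub> y)) = (\<Union>y\<in>coset x. coset (a \<odot>\<^bsub>M\<^esub> x))"
    by (rule SUP_cong[OF refl])
  also have "\<dots> = coset (a \<odot>\<^bsub>M\<^esub> x)" using coset_self[OF x] by blast
  finally show ?thesis by (simp only: quot_simps)
qed

lemma quot_left_module: "left_module R (quot_module M H)"
proof -
  have z: "\<zero>\<^bsub>quot_module M H\<^esub> = coset \<zero>\<^bsub>M\<^esub>" by (simp add: quot_simps coset_zero)
  note s = quot_simps(1) z coset_add coset_smult
  have "abelian_group (quot_module M H)"
  proof (rule abelian_groupI)
    fix C assume "C \<in> carrier (quot_module M H)"
    then obtain x where x: "x \<in> carrier M" "C = coset x" by (auto simp: s)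
    then have "coset (\<ominus>\<^bsub>M\<^esub> x) \<oplus>\<^bsub>quot_module M H\<^esub> C = \<zero>\<^bsub>quot_module M H\<^esub>" by (simp add: s M.l_neg)
    with x show "\<exists>y\<in>carrier (quot_module M H). y \<oplus>\<^bsub>quot_module M H\<^esub> C = \<zero>\<^bsub>quot_module M H\<^esub>"
      by (auto simp: s(1))
  qed (auto simp: s M.a_ac)
  then show ?thesis
    by (intro left_module.intro left_module_axioms.intro R.ring_axioms)
      (auto simp: s smult_closed smult_l_distr smult_r_distr smult_assoc1 smult_one)
qed

end

section \<open>The algebra Ext\<close>

lemma aug_module_simps [simp]:
  "carrier (aug_module K \<epsilon>) = carrier K" "\<zero>\<^bsub>aug_module K \<epsilon>\<^esub> = \<zero>\<^bsub>K\<^esub>"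
  "x \<oplus>\<^bsub>aug_module K \<epsilon>\<^esub> y = x \<oplus>\<^bsub>K\<^esub> y" "a \<odot>\<^bsub>aug_module K \<epsilon>\<^esub> x = \<epsilon> a \<otimes>\<^bsub>K\<^esub> x"
  by (simp_all add: aug_module_def)

lemma aug_module_left_module:
  assumes "field K" "ring A" "\<epsilon> \<in> ring_hom A K"
  shows "left_module A (aug_module K \<epsilon>)"
proof -
  interpret K: field K by fact
  note e = ring_hom_closed[OF assms(3)] ring_hom_add[OF assms(3)] ring_hom_mult[OF assms(3)]
    ring_hom_one[OF assms(3)]
  have "abelian_group (aug_module K \<epsilon>)"
  proof (rule abelian_groupI)
    fix x assume "x \<in> carrier (aug_module K \<epsilon>)"
    then show "\<exists>y\<in>carrier (aug_module K \<epsilon>). y \<oplus>\<^bsub>aug_module K \<epsilon>\<^esub> x = \<zero>\<^bsub>aug_module K \<epsilon>\<^esub>"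
      by (intro bexI[of _ "\<ominus>\<^bsub>K\<^esub> x"]) (simp_all add: K.l_neg)
  qed (simp_all add: K.a_ac)
  then show ?thesis
    by (intro left_module.intro left_module_axioms.intro assms(2))
      (auto simp: e K.l_distr K.r_distr K.m_assoc)
qed

text \<open>Allows \<open>projective_module_selections\<close> to be used with \<open>h\<close> the
  identity.\<close>

lemma selections_restrict_id:
  "selections A (restrict_scalars (\<lambda>x. x) U) V = selections A U V"
  by (simp add: selections_def lin_rel_def lin_maps_def)

text \<open>\<open>A\<close> is a ring with a homomorphism onto \<open>K\<close>; scalars act on
  cochains through their values. Surjectivity of the augmentation is what makes cocycles of degree 0
  constant.\<close>

locale ext_resolution = K?: field K + A?: ring A
  for K :: "('k, 'r) ring_scheme" and A :: "('a, 's) ring_scheme" +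
  fixes \<epsilon> :: "'a \<Rightarrow> 'k" and P :: "('a, 'p, 'k) augmented_complex"
  assumes aug_hom: "\<epsilon> \<in> ring_hom A K"
    and aug_surj: "\<epsilon> ` carrier A = carrier K"
    and resolution: "projective_resolution A (aug_module K \<epsilon>) P"
begin

lemmas exact = projective_resolution_exact[OF resolution]
lemmas P_module = exact_resolutionD(1)[OF exact]
  and bd_linear = exact_resolutionD(2)[OF exact]
  and to_base_linear = exact_resolutionD(3)[OF exact]

lemma base_module: "left_module A (aug_module K \<epsilon>)"
  by (rule aug_module_left_module) (rule K.field_axioms A.ring_axioms aug_hom)+

lemmas base_group = left_module_abelian_group[OF base_module]
  and P_group = left_module_abelian_group[OF P_module]

abbreviation "Z \<equiv> cocycles K A \<epsilon> P"
abbreviation "B \<equiv> coboundaries K A \<epsilon> P"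
abbreviation "Cochains \<equiv> cochains K A \<epsilon> P"
abbreviation "Zmod n \<equiv> (Cochains n)\<lparr>carrier := Z n\<rparr>"
abbreviation "cls n f \<equiv> B n +>\<^bsub>Cochains n\<^esub> f"

lemma cochains_simps [simp]:
  "carrier (Cochains n) = lin_maps A (ob P n) (aug_module K \<epsilon>)"
  "\<zero>\<^bsub>Cochains n\<^esub> = (\<lambda>x\<in>carrier (ob P n). \<zero>\<^bsub>K\<^esub>)"
  "f \<oplus>\<^bsub>Cochains n\<^esub> g = (\<lambda>x\<in>carrier (ob P n). f x \<oplus>\<^bsub>K\<^esub> g x)"
  "c \<odot>\<^bsub>Cochains n\<^esub> f = (\<lambda>x\<in>carrier (ob P n). c \<otimes>\<^bsub>K\<^esub> f x)"
  by (simp_all add: cochains_def)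

abbreviation "L n \<equiv> lin_maps A (ob P n) (aug_module K \<epsilon>)"

lemma L_closed: "\<lbrakk>f \<in> L n; x \<in> carrier (ob P n)\<rbrakk> \<Longrightarrow> f x \<in> carrier K"
  using lin_maps_closed[of f A "ob P n" "aug_module K \<epsilon>" x] by simp

lemma L_smult:
  assumes "c \<in> carrier K" "f \<in> L n"
  shows "(\<lambda>x\<in>carrier (ob P n). c \<otimes>\<^bsub>K\<^esub> f x) \<in> L n"
proof (rule lin_mapsI)
  interpret Pn: left_module A "ob P n" by (rule P_module)
  fix a x assume "a \<in> carrier A" "x \<in> carrier (ob P n)"
  then show "(\<lambda>x\<in>carrier (ob P n). c \<otimes>\<^bsub>K\<^esub> f x) (a \<odot>\<^bsub>ob P n\<^esub> x)
      = a \<odot>\<^bsub>aug_module K \<epsilon>\<^esub> (\<lambda>x\<in>carrier (ob P n). c \<otimes>\<^bsub>K\<^esub> f x) x"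
    using assms by (simp add: Pn.smult_closed lin_maps_smult[OF assms(2)] L_closed ring_hom_closed[OF aug_hom] K.m_lcomm)
next
  interpret Pn: left_module A "ob P n" by (rule P_module)
  fix x y assume "x \<in> carrier (ob P n)" "y \<in> carrier (ob P n)"
  then show "(\<lambda>x\<in>carrier (ob P n). c \<otimes>\<^bsub>K\<^esub> f x) (x \<oplus>\<^bsub>ob P n\<^esub> y)
      = (\<lambda>x\<in>carrier (ob P n). c \<otimes>\<^bsub>K\<^esub> f x) x \<oplus>\<^bsub>aug_module K \<epsilon>\<^esub> (\<lambda>x\<in>carrier (ob P n). c \<otimes>\<^bsub>K\<^esub> f x) y"
    using assms by (simp add: lin_maps_add[OF assms(2)] L_closed K.r_distr)
qed (use assms L_closed in auto)

lemma L_ext: "\<lbrakk>f \<in> L n; g \<in> L n; \<And>x. x \<in> carrier (ob P n) \<Longrightarrow> f x = g x\<rbrakk> \<Longrightarrow> f = g"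
  by (rule lin_maps_eqI)

lemma L_restrict: "f \<in> L n \<Longrightarrow> (\<lambda>x\<in>carrier (ob P n). f x) = f"
  by (auto simp: lin_maps_def PiE_def extensional_restrict)

lemma L_sum:
  assumes "f \<in> L n" "g \<in> L n"
  shows "(\<lambda>x\<in>carrier (ob P n). f x \<oplus>\<^bsub>K\<^esub> g x) \<in> L n"
  using lin_maps_sum[OF P_module base_module assms] by simp

lemma L_zero: "(\<lambda>x\<in>carrier (ob P n). \<zero>\<^bsub>K\<^esub>) \<in> L n"
proof -
  interpret Pn: left_module A "ob P n" by (rule P_module)
  show ?thesis by (rule lin_mapsI) (auto simp: Pn.smult_closed ring_hom_closed[OF aug_hom])
qed

lemma cochains_module: "left_module K (Cochains n)"
proof -
  have "abelian_group (Cochains n)"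
  proof (rule abelian_groupI)
    fix f assume "f \<in> carrier (Cochains n)"
    then have f: "f \<in> L n" by simp
    have "(\<lambda>x\<in>carrier (ob P n). \<ominus>\<^bsub>K\<^esub> \<one>\<^bsub>K\<^esub> \<otimes>\<^bsub>K\<^esub> f x) \<oplus>\<^bsub>Cochains n\<^esub> f = \<zero>\<^bsub>Cochains n\<^esub>"
      using L_closed[OF f] by (auto simp: K.l_minus K.l_neg)
    then show "\<exists>g\<in>carrier (Cochains n). g \<oplus>\<^bsub>Cochains n\<^esub> f = \<zero>\<^bsub>Cochains n\<^esub>"
      using L_smult[OF _ f, of "\<ominus>\<^bsub>K\<^esub> \<one>\<^bsub>K\<^esub>"] by (intro bexI[of _ "(\<lambda>x\<in>carrier (ob P n). \<ominus>\<^bsub>K\<^esub> \<one>\<^bsub>K\<^esub> \<otimes>\<^bsub>K\<^esub> f x)"]) auto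
  next
    fix f assume "f \<in> carrier (Cochains n)"
    then show "\<zero>\<^bsub>Cochains n\<^esub> \<oplus>\<^bsub>Cochains n\<^esub> f = f"
      using L_restrict[of f n] by (auto simp: L_closed cong: restrict_cong)
  qed (auto simp: L_sum L_zero L_closed K.a_ac cong: restrict_cong)
  then show ?thesis
    by (intro left_module.intro left_module_axioms.intro K.ring_axioms)
      (auto simp: L_smult L_closed L_restrict K.l_distr K.r_distr K.m_assoc cong: restrict_cong)
qed

lemma cocycles_iff:
  "f \<in> Z n \<longleftrightarrow> f \<in> L n \<and> (\<forall>x\<in>carrier (ob P (Suc n)). f (bd P n x) = \<zero>\<^bsub>K\<^esub>)"
  by (simp add: cocycles_def)

lemma cocycleD:
  assumes "f \<in> Z n"
  shows "f \<in> L n" "x \<in> carrier (ob P (Suc n)) \<Longrightarrow> f (bd P n x) = \<zero>\<^bsub>K\<^esub>"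
  using assms by (auto simp: cocycles_iff)

lemma bd_closed: "x \<in> carrier (ob P (Suc n)) \<Longrightarrow> bd P n x \<in> carrier (ob P n)"
  by (rule lin_maps_closed[OF bd_linear])

lemma cocycles_submodule: "submodule (Z n) K (Cochains n)"
  by (rule left_module.submoduleI[OF cochains_module])
    (auto simp: cocycles_iff L_zero L_sum L_smult bd_closed)

lemma Zmod_module: "left_module K (Zmod n)"
  by (rule left_module.submodule_left_module[OF cochains_module cocycles_submodule])

lemma coboundary_0_iff: "b \<in> B 0 \<longleftrightarrow> b \<in> L 0 \<and> (\<forall>x\<in>carrier (ob P 0). b x = \<zero>\<^bsub>K\<^esub>)"
  using L_zero[of 0] by (auto intro: L_ext)

lemma coboundary_Suc_iff:
  "b \<in> B (Suc n) \<longleftrightarrow> b \<in> L (Suc n) \<and> (\<exists>u\<in>L n. \<forall>x\<in>carrier (ob P (Suc n)). b x = u (bd P n x))"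
proof
  assume "b \<in> B (Suc n)"
  then show "b \<in> L (Suc n) \<and> (\<exists>u\<in>L n. \<forall>x\<in>carrier (ob P (Suc n)). b x = u (bd P n x))"
    using lin_maps_compose[OF bd_linear _ P_module] by (auto simp: compose_def intro!: bexI)
next
  assume b: "b \<in> L (Suc n) \<and> (\<exists>u\<in>L n. \<forall>x\<in>carrier (ob P (Suc n)). b x = u (bd P n x))"
  then obtain u where u: "u \<in> L n" "\<And>x. x \<in> carrier (ob P (Suc n)) \<Longrightarrow> b x = u (bd P n x)" by blast
  then have "b = compose (carrier (ob P (Suc n))) u (bd P n)"
    using b lin_maps_compose[OF bd_linear u(1) P_module] by (intro L_ext) (auto simp: compose_def)
  then show "b \<in> B (Suc n)" using u(1) by auto
qed

lemma coboundary_L: "b \<in> B n \<Longrightarrow> b \<in> L n"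
  using coboundary_0_iff coboundary_Suc_iff by (cases n) blast+

lemma coboundary_cocycle:
  assumes "b \<in> B n"
  shows "b \<in> Z n"
proof (cases n)
  case 0
  then show ?thesis using assms coboundary_0_iff bd_closed by (auto simp: cocycles_iff)
next
  case (Suc m)
  then obtain u where u: "u \<in> L m" "\<And>x. x \<in> carrier (ob P (Suc m)) \<Longrightarrow> b x = u (bd P m x)"
    using assms coboundary_Suc_iff by blast
  then show ?thesis
    using Suc coboundary_L[OF assms] exact_resolutionD(5)[OF exact] bd_closed
      lin_maps_zero[OF P_group base_group u(1)] by (auto simp: cocycles_iff)
qed

lemma coboundaries_submodule: "submodule (B n) K (Zmod n)"
proof (rule left_module.submoduleI[OF Zmod_module])
  show "B n \<subseteq> carrier (Zmod n)" using coboundary_cocycle by auto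
  show "\<zero>\<^bsub>Zmod n\<^esub> \<in> B n"
  proof (cases n)
    case (Suc m)
    show ?thesis unfolding Suc coboundary_Suc_iff
      by (auto simp: L_zero bd_closed intro!: bexI[OF _ L_zero])
  qed simp
next
  fix b b' assume b: "b \<in> B n" "b' \<in> B n"
  show "b \<oplus>\<^bsub>Zmod n\<^esub> b' \<in> B n"
  proof (cases n)
    case 0
    then show ?thesis using b by (simp cong: restrict_cong)
  next
    case (Suc m)
    obtain u u' where "u \<in> L m" "\<forall>x\<in>carrier (ob P (Suc m)). b x = u (bd P m x)"
      "u' \<in> L m" "\<forall>x\<in>carrier (ob P (Suc m)). b' x = u' (bd P m x)"
      using b coboundary_Suc_iff unfolding Suc by blast
    then show ?thesis
      using b[THEN coboundary_L] unfolding Suc coboundary_Suc_iff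
      by (auto simp: L_sum bd_closed intro!: bexI[OF _ L_sum])
  qed
next
  fix c b assume c: "c \<in> carrier K" and b: "b \<in> B n"
  show "c \<odot>\<^bsub>Zmod n\<^esub> b \<in> B n"
  proof (cases n)
    case 0
    then show ?thesis using b c by (simp cong: restrict_cong)
  next
    case (Suc m)
    obtain u where "u \<in> L m" "\<forall>x\<in>carrier (ob P (Suc m)). b x = u (bd P m x)"
      using b coboundary_Suc_iff unfolding Suc by blast
    then show ?thesis
      using b[THEN coboundary_L] c unfolding Suc coboundary_Suc_iff
      by (auto simp: L_smult bd_closed intro!: bexI[OF _ L_smult])
  qed
qed

lemma quotient: "module_quotient K (Zmod n) (B n)"
  by (intro module_quotient.intro module_quotient_axioms.intro Zmod_module coboundaries_submodule)

lemma Zmod_coset: "B n +>\<^bsub>Zmod n\<^esub> f = cls n f"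
  by (simp add: a_r_coset_def r_coset_def)

abbreviation "ExtP \<equiv> Ext K A \<epsilon> P"

lemma Ext_carrier: "carrier (ExtP n) = cls n ` Z n"
  using module_quotient.quot_simps(1)[OF quotient[of n]] by (simp add: Zmod_coset Ext_def)

lemma Ext_add: "\<lbrakk>f \<in> Z n; g \<in> Z n\<rbrakk> \<Longrightarrow> cls n f \<oplus>\<^bsub>ExtP n\<^esub> cls n g = cls n (f \<oplus>\<^bsub>Cochains n\<^esub> g)"
  and Ext_smult: "\<lbrakk>c \<in> carrier K; f \<in> Z n\<rbrakk> \<Longrightarrow> c \<odot>\<^bsub>ExtP n\<^esub> cls n f = cls n (c \<odot>\<^bsub>Cochains n\<^esub> f)"
  using module_quotient.coset_add[OF quotient[of n], of f g] module_quotient.coset_smult[OF quotient[of n], of c f]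
  by (simp_all add: Zmod_coset Ext_def)

lemma Ext_module: "left_module K (ExtP n)"
  using module_quotient.quot_left_module[OF quotient[of n]] by (simp add: Ext_def)

lemma cls_self: "f \<in> Z n \<Longrightarrow> f \<in> cls n f"
  using module_quotient.coset_self[OF quotient[of n], of f] by (simp add: Zmod_coset)

lemma cls_mem: "\<lbrakk>f \<in> Z n; g \<in> cls n f\<rbrakk> \<Longrightarrow> g \<in> Z n" "\<lbrakk>f \<in> Z n; g \<in> cls n f\<rbrakk> \<Longrightarrow> cls n g = cls n f"
  using module_quotient.mem_cosetD[OF quotient[of n], of f g] by (simp_all add: Zmod_coset)

lemma cls_eqI:
  assumes f: "f \<in> Z n" and g: "g \<in> Z n" and b: "b \<in> B n"
    and eq: "\<And>x. x \<in> carrier (ob P n) \<Longrightarrow> f x = b x \<oplus>\<^bsub>K\<^esub> g x"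
  shows "cls n f = cls n g"
proof -
  have "f = b \<oplus>\<^bsub>Cochains n\<^esub> g"
    using eq f g b by (intro L_ext[OF cocycleD(1)[OF f]]) (auto simp: L_sum coboundary_L cocycleD)
  then have "f \<in> cls n g"
    using b by (auto simp: a_r_coset_def r_coset_def)
  then show ?thesis using cls_mem(2)[OF g] by simp
qed

lemma cls_eqE:
  assumes f: "f \<in> Z n" and eq: "cls n f = cls n g"
  obtains b where "b \<in> B n" "\<And>x. x \<in> carrier (ob P n) \<Longrightarrow> f x = b x \<oplus>\<^bsub>K\<^esub> g x"
proof -
  have "f \<in> cls n g" using cls_self[OF f] unfolding eq .
  then obtain b where "b \<in> B n" "f = b \<oplus>\<^bsub>Cochains n\<^esub> g" by (auto simp: a_r_coset_def r_coset_def)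
  then show thesis by (intro that[of b]) auto
qed

end

section \<open>The Yoneda product and Ext in degree 0\<close>

context ext_resolution
begin

lemma P_projective: "projective_module A (ob P n)"
  using resolution by (simp add: projective_resolution_def)

lemma P_selections:
  assumes "left_module A V"
  shows "selections A (ob P n) V"
proof -
  have "selections A (restrict_scalars (\<lambda>x. x) (ob P n)) V"
    by (rule projective_module_selections[OF P_projective A.ring_axioms _ assms])
      (auto simp: selections_restrict_id regular_module_selections[OF assms] ring_hom_def)
  then show ?thesis by (simp add: selections_restrict_id)
qed

text \<open>A cocycle of degree \<open>n\<close> is a map on the degree 0 term of the shifted
  complex that kills boundaries, so lifting it is an instance of
  \<open>chain_map_exists\<close>.\<close>

lemma shifted_comparison:
  assumes "abelian_group N" "exact_resolution A N Q"
  shows "comparison A (\<lambda>i. ob P (n + i)) (\<lambda>i. bd P (n + i)) N Q"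
  by (rule comparison.intro)
    (simp_all add: assms P_module bd_linear exact_resolutionD(5)[OF exact] P_selections exact_resolutionD(1)[OF assms(2)])

lemma cocycle_lifts_iff:
  "G \<in> cocycle_lifts A P n g \<longleftrightarrow>
    comparison.chain_map A (\<lambda>i. ob P (n + i)) (\<lambda>i. bd P (n + i)) P G \<and>
    (\<forall>x\<in>carrier (ob P n). to_base P (G 0 x) = g x)"
  unfolding comparison.chain_map_def[OF shifted_comparison[OF base_group exact]] cocycle_lifts_def
  by auto

lemma cocycle_liftsD:
  assumes "G \<in> cocycle_lifts A P n g"
  shows "G i \<in> lin_maps A (ob P (n + i)) (ob P i)"
    and "x \<in> carrier (ob P n) \<Longrightarrow> to_base P (G 0 x) = g x"
    and "x \<in> carrier (ob P (Suc (n + i))) \<Longrightarrow> bd P i (G (Suc i) x) = G i (bd P (n + i) x)"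
  using assms by (auto simp: cocycle_lifts_def)

lemma cocycle_lift_exists:
  assumes "g \<in> Z n"
  obtains G where "G \<in> cocycle_lifts A P n g"
proof -
  interpret c: comparison A "\<lambda>i. ob P (n + i)" "\<lambda>i. bd P (n + i)" "aug_module K \<epsilon>" P
    by (rule shifted_comparison[OF base_group exact])
  obtain G where "c.chain_map G" "\<And>x. x \<in> carrier (ob P (n + 0)) \<Longrightarrow> to_base P (G 0 x) = g x"
    by (rule c.chain_map_exists[of g]) (use cocycleD[OF assms] in auto)
  then show thesis by (intro that[of G]) (simp add: cocycle_lifts_iff)
qed

abbreviation yoneda_comp :: "nat \<Rightarrow> nat \<Rightarrow> ('p \<Rightarrow> 'k) \<Rightarrow> (nat \<Rightarrow> 'p \<Rightarrow> 'p) \<Rightarrow> 'p \<Rightarrow> 'k"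
  where "yoneda_comp m n f G \<equiv> compose (carrier (ob P (n + m))) f (G m)"

lemma yoneda_comp_cocycle:
  assumes f: "f \<in> Z m" and G: "G \<in> cocycle_lifts A P n g"
  shows "yoneda_comp m n f G \<in> Z (n + m)"
proof -
  have "f (G m (bd P (n + m) x)) = \<zero>\<^bsub>K\<^esub>" if x: "x \<in> carrier (ob P (Suc (n + m)))" for x
    using cocycleD(2)[OF f] cocycle_liftsD(3)[OF G x, symmetric]
      lin_maps_closed[OF cocycle_liftsD(1)[OF G, of "Suc m"]] x by simp
  then show ?thesis
    using lin_maps_compose[OF cocycle_liftsD(1)[OF G] cocycleD(1)[OF f] P_module]
    by (auto simp: cocycles_iff compose_def bd_closed)
qed

lemma zero_coboundary: "\<lbrakk>b \<in> L n; \<And>x. x \<in> carrier (ob P n) \<Longrightarrow> b x = \<zero>\<^bsub>K\<^esub>\<rbrakk> \<Longrightarrow> b \<in> B n"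
proof -
  assume b: "b \<in> L n" "\<And>x. x \<in> carrier (ob P n) \<Longrightarrow> b x = \<zero>\<^bsub>K\<^esub>"
  have "b = \<zero>\<^bsub>Zmod n\<^esub>" using b by (intro L_ext[OF b(1)]) (auto simp: L_zero)
  then show "b \<in> B n" using submoduleD(2)[OF coboundaries_submodule] by simp
qed

lemma cls_eq_SucI:
  assumes "f \<in> Z (Suc n)" "g \<in> Z (Suc n)" "u \<in> L n"
    and "\<And>x. x \<in> carrier (ob P (Suc n)) \<Longrightarrow> f x = u (bd P n x) \<oplus>\<^bsub>K\<^esub> g x"
  shows "cls (Suc n) f = cls (Suc n) g"
proof (rule cls_eqI[OF assms(1,2)])
  show "compose (carrier (ob P (Suc n))) u (bd P n) \<in> B (Suc n)" using assms(3) by auto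
qed (use assms(4) in \<open>simp add: compose_def\<close>)

text \<open>Two lifts of \<open>g\<close> are homotopic. For \<open>m = 0\<close> they differ by
  boundaries, which \<open>f\<close> kills, so the products agree already as cochains.\<close>

lemma yoneda_unique_lift:
  assumes f: "f \<in> Z m" and G: "G \<in> cocycle_lifts A P n g" and G': "G' \<in> cocycle_lifts A P n g"
  shows "cls (n + m) (yoneda_comp m n f G) = cls (n + m) (yoneda_comp m n f G')"
proof -
  interpret c: comparison A "\<lambda>i. ob P (n + i)" "\<lambda>i. bd P (n + i)" "aug_module K \<epsilon>" P
    by (rule shifted_comparison[OF base_group exact])
  have eq: "to_base P (G 0 x) = to_base P (G' 0 x)" if "x \<in> carrier (ob P (n + 0))" for x
    using that cocycle_liftsD(2)[OF G] cocycle_liftsD(2)[OF G'] by simp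
  have chain: "c.chain_map G" "c.chain_map G'" using G G' by (auto simp: cocycle_lifts_iff)
  have fd: "f (bd P m x) = \<zero>\<^bsub>aug_module K \<epsilon>\<^esub>" if "x \<in> carrier (ob P (Suc m))" for x
    using cocycleD(2)[OF f that] by simp
  note coh = c.chain_maps_cohomologous[OF chain eq base_group cocycleD(1)[OF f] fd]
  note Z = yoneda_comp_cocycle[OF f G] yoneda_comp_cocycle[OF f G']
  show ?thesis
  proof (cases m)
    case 0
    have "yoneda_comp m n f G = yoneda_comp m n f G'"
      using coh(1)[OF _ _ 0] 0 by (auto simp: compose_def)
    then show ?thesis by simp
  next
    case (Suc k)
    obtain u where u: "u \<in> L (n + k)"
      "\<forall>x\<in>carrier (ob P (n + m)). f (G m x) = u (bd P (n + k) x) \<oplus>\<^bsub>aug_module K \<epsilon>\<^esub> f (G' m x)"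
      using coh(2)[OF _ _ Suc] by blast
    then show ?thesis using cls_eq_SucI[of _ "n + k" _ u] Z unfolding Suc by (simp add: compose_def)
  qed
qed

text \<open>With \<open>f - f' = u bd\<close>, the products differ by
  \<open>u bd G = (u G) bd\<close>.\<close>

lemma yoneda_unique_left:
  assumes f: "f \<in> Z m" and f': "f' \<in> Z m" and eq: "cls m f = cls m f'" and G: "G \<in> cocycle_lifts A P n g"
  shows "cls (n + m) (yoneda_comp m n f G) = cls (n + m) (yoneda_comp m n f' G)"
proof -
  obtain b where b: "b \<in> B m" "\<And>x. x \<in> carrier (ob P m) \<Longrightarrow> f x = b x \<oplus>\<^bsub>K\<^esub> f' x"
    by (rule cls_eqE[OF f eq]) (rule that)
  note GL = cocycle_liftsD(1)[OF G]
  have bG: "yoneda_comp m n b G \<in> L (n + m)"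
    using lin_maps_compose[OF GL coboundary_L[OF b(1)] P_module] .
  have "yoneda_comp m n b G \<in> B (n + m)"
  proof (cases m)
    case 0
    then have "b y = \<zero>\<^bsub>K\<^esub>" if "y \<in> carrier (ob P m)" for y
      using that b(1) coboundary_0_iff by blast
    then show ?thesis
      using lin_maps_closed[OF GL] by (intro zero_coboundary[OF bG]) (simp add: compose_def)
  next
    case (Suc k)
    obtain u where u: "u \<in> L k" "\<And>x. x \<in> carrier (ob P (Suc k)) \<Longrightarrow> b x = u (bd P k x)"
      using b(1) coboundary_Suc_iff unfolding Suc by blast
    have "compose (carrier (ob P (n + k))) u (G k) \<in> L (n + k)"
      by (rule lin_maps_compose[OF GL u(1) P_module])
    moreover have "b (G (Suc k) x) = u (G k (bd P (n + k) x))" if "x \<in> carrier (ob P (Suc (n + k)))" for x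
      using that u(2) lin_maps_closed[OF GL, of x "Suc k"] cocycle_liftsD(3)[OF G] by simp
    ultimately have "\<exists>v\<in>L (n + k). \<forall>x\<in>carrier (ob P (Suc (n + k))). yoneda_comp m n b G x = v (bd P (n + k) x)"
      unfolding Suc by (intro bexI[of _ "compose (carrier (ob P (n + k))) u (G k)"]) (simp_all add: compose_def bd_closed)
    then show ?thesis using bG unfolding Suc add_Suc_right coboundary_Suc_iff by blast
  qed
  then show ?thesis
    by (rule cls_eqI[OF yoneda_comp_cocycle[OF f G] yoneda_comp_cocycle[OF f' G]])
      (use b(2) lin_maps_closed[OF GL] in \<open>simp add: compose_def\<close>)
qed

text \<open>If \<open>g - g' = w bd\<close>, lift \<open>w\<close> through \<open>to_base\<close> to
  \<open>W\<close>. Subtracting \<open>W bd\<close> from the degree 0 component of \<open>G\<close>,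
  and changing nothing else, gives a lift \<open>H\<close> of \<open>g'\<close>, because
  \<open>bd bd = 0\<close>. The products with \<open>G\<close> and \<open>H\<close> agree as
  cochains for \<open>m > 0\<close> and differ by the coboundary \<open>(f W) bd\<close> for
  \<open>m = 0\<close>.\<close>

lemma yoneda_unique_right:
  assumes f: "f \<in> Z m" and g: "g \<in> Z n" and g': "g' \<in> Z n" and eq: "cls n g = cls n g'"
    and G: "G \<in> cocycle_lifts A P n g" and G': "G' \<in> cocycle_lifts A P n g'"
  shows "cls (n + m) (yoneda_comp m n f G) = cls (n + m) (yoneda_comp m n f G')"
proof -
  obtain b where b: "b \<in> B n" "\<And>x. x \<in> carrier (ob P n) \<Longrightarrow> g x = b x \<oplus>\<^bsub>K\<^esub> g' x"
    by (rule cls_eqE[OF g eq]) (rule that)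
  note GL = cocycle_liftsD(1)[OF G]
  show ?thesis
  proof (cases n)
    case 0
    have "g x = g' x" if "x \<in> carrier (ob P n)" for x
      using that b L_closed[OF cocycleD(1)[OF g']] coboundary_0_iff unfolding 0 by simp
    then have "G \<in> cocycle_lifts A P n g'" using G by (simp add: cocycle_lifts_def)
    then show ?thesis using G' by (rule yoneda_unique_lift[OF f])
  next
    case (Suc l)
    obtain w where w: "w \<in> L l" "\<And>x. x \<in> carrier (ob P (Suc l)) \<Longrightarrow> b x = w (bd P l x)"
      using b(1) coboundary_Suc_iff unfolding Suc by blast
    obtain W where W: "W \<in> lin_maps A (ob P l) (ob P 0)"
      "\<And>x. x \<in> carrier (ob P l) \<Longrightarrow> to_base P (W x) = w x"
      using selections_lift[OF P_selections[OF P_module] P_module P_module base_group to_base_linear w(1)]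
        lin_maps_closed[OF w(1)] exact_resolutionD(8)[OF exact] by metis
    have Wd: "compose (carrier (ob P n)) W (bd P l) \<in> lin_maps A (ob P n) (ob P 0)"
      unfolding Suc by (rule lin_maps_compose[OF bd_linear W(1) P_module])
    define H where "H i = (if i = 0
      then \<lambda>x\<in>carrier (ob P n). G 0 x \<ominus>\<^bsub>ob P 0\<^esub> compose (carrier (ob P n)) W (bd P l) x else G i)" for i
    have H_0: "H 0 x = G 0 x \<ominus>\<^bsub>ob P 0\<^esub> W (bd P l x)" if "x \<in> carrier (ob P n)" for x
      using that by (simp add: H_def compose_def)
    have H_Suc: "H (Suc i) = G (Suc i)" for i by (simp add: H_def)
    have "H i \<in> lin_maps A (ob P (n + i)) (ob P i)" for i
      using lin_maps_diff[OF P_module P_module GL[of 0, simplified] Wd] GL[of i] by (auto simp: H_def)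
    moreover have "to_base P (H 0 x) = g' x" if x: "x \<in> carrier (ob P n)" for x
    proof -
      have c: "bd P l x \<in> carrier (ob P l)" "G 0 x \<in> carrier (ob P 0)" "W (bd P l x) \<in> carrier (ob P 0)"
        using x lin_maps_closed[OF GL[of 0]] lin_maps_closed[OF W(1)] bd_closed unfolding Suc by auto
      have "to_base P (H 0 x) = g x \<ominus>\<^bsub>aug_module K \<epsilon>\<^esub> w (bd P l x)"
        using x c by (simp add: H_0 lin_maps_minus[OF P_group base_group to_base_linear] cocycle_liftsD(2)[OF G] W(2))
      moreover have "g x = g' x \<oplus>\<^bsub>aug_module K \<epsilon>\<^esub> w (bd P l x)"
        using b(2)[OF x] w(2) x c L_closed[OF w(1) c(1)] L_closed[OF cocycleD(1)[OF g'] x]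
        unfolding Suc by (simp add: K.a_comm)
      moreover have "g x \<in> carrier K" "g' x \<in> carrier K" "w (bd P l x) \<in> carrier K"
        using x c w(1) g g' by (auto intro: L_closed cocycleD(1))
      ultimately show ?thesis
        using abelian_group.minus_eq_iff[OF base_group, of "g x" "w (bd P l x)" "g' x"] by simp
    qed
    moreover have "bd P i (H (Suc i) x) = H i (bd P (n + i) x)" if x: "x \<in> carrier (ob P (Suc (n + i)))" for i x
    proof (cases i)
      case 0
      have d: "bd P n x \<in> carrier (ob P n)" "G 0 (bd P n x) \<in> carrier (ob P 0)"
        using x 0 bd_closed lin_maps_closed[OF GL[of 0]] by auto
      have "bd P l (bd P n x) = \<zero>\<^bsub>ob P l\<^esub>"
        using exact_resolutionD(5)[OF exact] x 0 unfolding Suc by simp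
      then have "H 0 (bd P n x) = G 0 (bd P n x) \<ominus>\<^bsub>ob P 0\<^esub> \<zero>\<^bsub>ob P 0\<^esub>"
        using d by (simp add: H_0 lin_maps_zero[OF P_group P_group W(1)])
      also have "\<dots> = G 0 (bd P n x)"
        using d abelian_group.minus_eq_iff[OF P_group, of "G 0 (bd P n x)" 0 "\<zero>\<^bsub>ob P 0\<^esub>" "G 0 (bd P n x)"]
          abelian_groupE[OF P_group] by (metis abelian_monoid.r_zero abelian_group.axioms(1) P_group)
      finally show ?thesis using cocycle_liftsD(3)[OF G x] 0 by (simp add: H_Suc)
    next
      case (Suc j)
      then show ?thesis using cocycle_liftsD(3)[OF G x] by (simp add: H_Suc)
    qed
    ultimately have H: "H \<in> cocycle_lifts A P n g'" by (simp add: cocycle_lifts_def)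
    have "cls (n + m) (yoneda_comp m n f G) = cls (n + m) (yoneda_comp m n f H)"
    proof (cases m)
      case 0
      have fW: "compose (carrier (ob P l)) f W \<in> L l"
        using lin_maps_compose[OF W(1) cocycleD(1)[OF f[unfolded 0]] P_module] .
      have "f (G 0 x) = f (W (bd P l x)) \<oplus>\<^bsub>K\<^esub> f (H 0 x)" if x: "x \<in> carrier (ob P n)" for x
      proof -
        have c: "bd P l x \<in> carrier (ob P l)" "G 0 x \<in> carrier (ob P 0)" "W (bd P l x) \<in> carrier (ob P 0)"
          using x lin_maps_closed[OF GL[of 0]] lin_maps_closed[OF W(1)] bd_closed unfolding Suc by auto
        note f0 = cocycleD(1)[OF f[unfolded 0]]
        have "f (H 0 x) = f (G 0 x) \<ominus>\<^bsub>aug_module K \<epsilon>\<^esub> f (W (bd P l x))"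
          using x c by (simp add: H_0 lin_maps_minus[OF P_group base_group f0])
        moreover have "f (G 0 x) \<in> carrier K" "f (W (bd P l x)) \<in> carrier K"
          using c L_closed[OF f0] by auto
        ultimately have "f (G 0 x) = f (H 0 x) \<oplus>\<^bsub>K\<^esub> f (W (bd P l x))" "f (H 0 x) \<in> carrier K"
          using abelian_group.minus_add_cancel[OF base_group, of "f (G 0 x)" "f (W (bd P l x))"]
            abelian_group.minus_closed[OF base_group, of "f (G 0 x)" "f (W (bd P l x))"] by simp_all
        then show ?thesis using \<open>f (W (bd P l x)) \<in> carrier K\<close> by (metis K.a_comm)
      qed
      then show ?thesis
        using cls_eq_SucI[of "yoneda_comp m n f G" l "yoneda_comp m n f H", OF _ _ fW]
          yoneda_comp_cocycle[OF f G] yoneda_comp_cocycle[OF f H]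
        unfolding 0 Suc by (simp add: compose_def bd_closed)
    next
      case (Suc j)
      then show ?thesis by (simp add: H_Suc)
    qed
    also have "\<dots> = cls (n + m) (yoneda_comp m n f G')" by (rule yoneda_unique_lift[OF f H G'])
    finally show ?thesis .
  qed
qed

text \<open>Makes the union in \<open>yoneda_mult\<close> a single class, computed from any
  representatives and any lift.\<close>

lemma yoneda_mult_cls:
  assumes f: "f \<in> Z m" and g: "g \<in> Z n" and G: "G \<in> cocycle_lifts A P n g"
  shows "yoneda_mult K A \<epsilon> P m n (cls m f) (cls n g) = cls (n + m) (yoneda_comp m n f G)"
proof -
  have *: "cls (n + m) (yoneda_comp m n f' G') = cls (n + m) (yoneda_comp m n f G)"
    if "f' \<in> cls m f" "g' \<in> cls n g" "G' \<in> cocycle_lifts A P n g'" for f' g' G'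
  proof -
    note f' = cls_mem[OF f that(1)] and g' = cls_mem[OF g that(2)]
    have "cls (n + m) (yoneda_comp m n f' G') = cls (n + m) (yoneda_comp m n f G')"
      by (rule yoneda_unique_left[OF f'(1) f f'(2) that(3)])
    also have "\<dots> = cls (n + m) (yoneda_comp m n f G)"
      by (rule yoneda_unique_right[OF f g'(1) g g'(2) that(3) G])
    finally show ?thesis .
  qed
  show ?thesis
    unfolding yoneda_mult_def
    by (intro equalityI UN_least) (use * in blast, use cls_self[OF f] cls_self[OF g] G in blast)
qed

lemma yoneda_mult_closed:
  assumes "F \<in> carrier (ExtP m)" "H \<in> carrier (ExtP n)"
  shows "yoneda_mult K A \<epsilon> P m n F H \<in> carrier (ExtP (n + m))"
proof -
  obtain f g where fg: "f \<in> Z m" "g \<in> Z n" "F = cls m f" "H = cls n g"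
    using assms by (auto simp: Ext_carrier)
  obtain G where G: "G \<in> cocycle_lifts A P n g" using cocycle_lift_exists[OF fg(2)] .
  show ?thesis
    using yoneda_mult_cls[OF fg(1,2) G] yoneda_comp_cocycle[OF fg(1) G] fg by (auto simp: Ext_carrier)
qed

abbreviation "const c \<equiv> (\<lambda>x\<in>carrier (ob P 0). c \<otimes>\<^bsub>K\<^esub> to_base P x)"

lemma to_base_cocycle: "to_base P \<in> Z 0"
  using to_base_linear exact_resolutionD(7)[OF exact] by (simp add: cocycles_iff)

lemma const_cocycle: "c \<in> carrier K \<Longrightarrow> const c \<in> Z 0"
  using submoduleD(4)[OF cocycles_submodule _ to_base_cocycle, of c] by simp

text \<open>If \<open>to_base P y\<close> is one and \<open>a\<close> has augmentation
  \<open>to_base P x\<close>, then \<open>x - a y\<close> is a boundary, so a cocycle takes the same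
  value at \<open>x\<close> and at \<open>a y\<close>. Surjectivity of the augmentation provides
  \<open>a\<close>.\<close>

lemma cocycle_0_const:
  assumes f: "f \<in> Z 0"
  obtains c where "c \<in> carrier K" "f = const c"
proof -
  interpret P0: left_module A "ob P 0" by (rule P_module)
  have "\<one>\<^bsub>K\<^esub> \<in> to_base P ` carrier (ob P 0)" using exact_resolutionD(8)[OF exact] by simp
  then obtain y where y: "y \<in> carrier (ob P 0)" "to_base P y = \<one>\<^bsub>K\<^esub>" by auto
  have fL: "f \<in> L 0" by (rule cocycleD(1)[OF f])
  have "f x = f y \<otimes>\<^bsub>K\<^esub> to_base P x" if x: "x \<in> carrier (ob P 0)" for x
  proof -
    have tx: "to_base P x \<in> carrier K" using lin_maps_closed[OF to_base_linear x] by simp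
    then obtain a where a: "a \<in> carrier A" "\<epsilon> a = to_base P x" using aug_surj by (metis imageE)
    have c: "a \<odot>\<^bsub>ob P 0\<^esub> y \<in> carrier (ob P 0)" using a y by (simp add: P0.smult_closed)
    have "to_base P (x \<ominus>\<^bsub>ob P 0\<^esub> a \<odot>\<^bsub>ob P 0\<^esub> y) = to_base P x \<ominus>\<^bsub>aug_module K \<epsilon>\<^esub> to_base P x"
      using lin_maps_smult[OF to_base_linear a(1) y(1)] y(2) a(2) tx
      by (simp add: lin_maps_minus[OF P_group base_group to_base_linear x c])
    also have "\<dots> = \<zero>\<^bsub>aug_module K \<epsilon>\<^esub>"
      using abelian_group.minus_eq_zero_iff[OF base_group, of "to_base P x" "to_base P x"] tx by simp
    finally obtain z where z: "z \<in> carrier (ob P (Suc 0))" "x \<ominus>\<^bsub>ob P 0\<^esub> a \<odot>\<^bsub>ob P 0\<^esub> y = bd P 0 z"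
      using exact_resolutionD(6)[OF exact, of "x \<ominus>\<^bsub>ob P 0\<^esub> a \<odot>\<^bsub>ob P 0\<^esub> y"] x c by auto
    have "f x \<ominus>\<^bsub>aug_module K \<epsilon>\<^esub> f (a \<odot>\<^bsub>ob P 0\<^esub> y) = \<zero>\<^bsub>K\<^esub>"
      using lin_maps_minus[OF P_group base_group fL x c] z cocycleD(2)[OF f] by simp
    then have "f x = f (a \<odot>\<^bsub>ob P 0\<^esub> y)"
      using abelian_group.minus_eq_zero_iff[OF base_group, of "f x" "f (a \<odot>\<^bsub>ob P 0\<^esub> y)"]
        L_closed[OF fL x] L_closed[OF fL c] by simp
    then show ?thesis
      using lin_maps_smult[OF fL a(1) y(1)] a(2) tx L_closed[OF fL y(1)] by (simp add: K.m_comm)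
  qed
  then have "f = const (f y)"
    by (intro L_ext[OF fL cocycleD(1)[OF const_cocycle]]) (auto simp: L_closed[OF fL y(1)])
  then show thesis using that[of "f y"] L_closed[OF fL y(1)] by simp
qed

lemma cls_0: "f \<in> Z 0 \<Longrightarrow> cls 0 f = {f}"
proof -
  assume f: "f \<in> Z 0"
  have "(\<lambda>x\<in>carrier (ob P 0). \<zero>\<^bsub>K\<^esub>) \<oplus>\<^bsub>Cochains 0\<^esub> f = f"
    using abelian_monoid.l_zero[OF abelian_group.axioms(1)[OF left_module_abelian_group[OF cochains_module]], of f 0]
      cocycleD(1)[OF f] by simp
  then show "cls 0 f = {f}" by (simp add: a_r_coset_def r_coset_def)
qed

lemma Ext_aug_const:
  assumes c: "c \<in> carrier K" and \<xi>: "\<xi> 0 = cls 0 (const c)"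
  shows "Ext_aug K P \<xi> = c"
proof -
  have "\<one>\<^bsub>K\<^esub> \<in> to_base P ` carrier (ob P 0)" using exact_resolutionD(8)[OF exact] by simp
  then obtain y where y: "y \<in> carrier (ob P 0)" "to_base P y = \<one>\<^bsub>K\<^esub>" by auto
  show ?thesis unfolding Ext_aug_def \<xi> cls_0[OF const_cocycle[OF c]]
  proof (rule the_equality)
    fix d assume d: "d \<in> carrier K \<and> const d \<in> {const c}"
    then have "const d y = const c y" by simp
    then show "d = c" using y d c by simp
  qed (use c in simp)
qed

lemma Ext_0_const:
  assumes "F \<in> carrier (ExtP 0)"
  obtains c where "c \<in> carrier K" "F = cls 0 (const c)"
  using assms cocycle_0_const by (auto simp: Ext_carrier)

end

section \<open>Restriction along a morphism of augmented rings\<close>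

definition restrict_complex ::
    "('b \<Rightarrow> 'a) \<Rightarrow> ('a, 'p, 'm) augmented_complex \<Rightarrow> ('b, 'p, 'm) augmented_complex"
  where "restrict_complex h S =
    \<lparr>ob = (\<lambda>n. restrict_scalars h (ob S n)), bd = bd S, to_base = to_base S\<rparr>"

lemma restrict_complex_simps [simp]:
  "ob (restrict_complex h S) n = restrict_scalars h (ob S n)"
  "bd (restrict_complex h S) = bd S" "to_base (restrict_complex h S) = to_base S"
  by (simp_all add: restrict_complex_def)

lemma lin_maps_restrict_base:
  assumes "f \<in> lin_maps R U (aug_module K \<delta>)" "h \<in> ring_hom A R"
    and "\<And>a. a \<in> carrier A \<Longrightarrow> \<delta> (h a) = \<epsilon> a"
  shows "f \<in> lin_maps A (restrict_scalars h U) (aug_module K \<epsilon>)"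
  using assms by (auto simp: lin_maps_def ring_hom_closed)

lemma restrict_exact_resolution:
  assumes S: "exact_resolution R (aug_module K \<delta>) S" and A: "ring A" and h: "h \<in> ring_hom A R"
    and aug: "\<And>a. a \<in> carrier A \<Longrightarrow> \<delta> (h a) = \<epsilon> a"
  shows "exact_resolution A (aug_module K \<epsilon>) (restrict_complex h S)"
proof -
  have "to_base S \<in> lin_maps A (restrict_scalars h (ob S 0)) (aug_module K \<epsilon>)"
    using S h aug by (intro lin_maps_restrict_base) (auto simp: exact_resolution_def)
  moreover have "left_module A (restrict_scalars h (ob S n))"
    "bd S n \<in> lin_maps A (restrict_scalars h (ob S (Suc n))) (restrict_scalars h (ob S n))" for n
    using restrict_scalars_left_module[OF exact_resolutionD(1)[OF S] A h]
      lin_maps_restrict_scalars[OF exact_resolutionD(2)[OF S] h] by auto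
  ultimately show ?thesis using S unfolding exact_resolution_def by simp
qed

text \<open>The chain map runs from \<open>P\<close> to the restricted \<open>S\<close>: the terms
  of \<open>P\<close> are projective over \<open>A\<close> and the restriction of \<open>S\<close>
  is exact, so it exists for any \<open>S\<close>. Pulling cochains back along it gives the
  restriction map on Ext.\<close>

locale ext_restriction = T: ext_resolution K R \<delta> S + ext_resolution K A \<epsilon> P
  for K :: "('k, 'r) ring_scheme" and R :: "('b, 't) ring_scheme" and \<delta> :: "'b \<Rightarrow> 'k"
    and S :: "('b, 'q, 'k) augmented_complex" and A :: "('a, 's) ring_scheme" and \<epsilon> :: "'a \<Rightarrow> 'k"
    and P :: "('a, 'p, 'k) augmented_complex" +
  fixes \<iota> :: "'a \<Rightarrow> 'b" and \<phi> :: "nat \<Rightarrow> 'p \<Rightarrow> 'q"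
  assumes \<iota>_hom: "\<iota> \<in> ring_hom A R"
    and \<iota>_aug: "a \<in> carrier A \<Longrightarrow> \<delta> (\<iota> a) = \<epsilon> a"
    and \<phi>_linear: "\<phi> i \<in> lin_maps A (ob P i) (restrict_scalars \<iota> (ob S i))"
    and \<phi>_base: "x \<in> carrier (ob P 0) \<Longrightarrow> to_base S (\<phi> 0 x) = to_base P x"
    and \<phi>_bd: "x \<in> carrier (ob P (Suc i)) \<Longrightarrow> bd S i (\<phi> (Suc i) x) = \<phi> i (bd P i x)"
begin

abbreviation "S' \<equiv> restrict_complex \<iota> S"

lemma S'_exact: "exact_resolution A (aug_module K \<epsilon>) S'"
  by (rule restrict_exact_resolution[OF T.exact A.ring_axioms \<iota>_hom \<iota>_aug])

lemma \<phi>_closed: "x \<in> carrier (ob P i) \<Longrightarrow> \<phi> i x \<in> carrier (ob S i)"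
  using lin_maps_closed[OF \<phi>_linear] by simp

lemma L_restrict_scalars: "f \<in> T.L n \<Longrightarrow> f \<in> lin_maps A (ob S' n) (aug_module K \<epsilon>)"
  using lin_maps_restrict_base[of f R "ob S n" K \<delta> \<iota> A \<epsilon>] \<iota>_hom \<iota>_aug by simp

definition pull :: "nat \<Rightarrow> ('q \<Rightarrow> 'k) \<Rightarrow> 'p \<Rightarrow> 'k"
  where "pull n f = compose (carrier (ob P n)) f (\<phi> n)"

lemma pull_apply: "x \<in> carrier (ob P n) \<Longrightarrow> pull n f x = f (\<phi> n x)"
  by (simp add: pull_def compose_def)

lemma pull_L: "f \<in> lin_maps A (ob S' n) (aug_module K \<epsilon>) \<Longrightarrow> pull n f \<in> L n"
  unfolding pull_def by (rule lin_maps_compose[OF \<phi>_linear _ P_module]) simp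

text \<open>Stated for maps on \<open>S\<close> that are linear over \<open>A\<close> only, since
  cocycles of this kind are what gets glued to cocycles over the coproduct.\<close>

lemma pull_Z:
  assumes "f \<in> lin_maps A (ob S' n) (aug_module K \<epsilon>)"
    and "\<And>x. x \<in> carrier (ob S (Suc n)) \<Longrightarrow> f (bd S n x) = \<zero>\<^bsub>K\<^esub>"
  shows "pull n f \<in> Z n"
  using assms pull_L[OF assms(1)]
  by (auto simp: cocycles_iff pull_apply bd_closed \<phi>_bd[symmetric] \<phi>_closed)

lemma pull_cocycle: "f \<in> T.Z n \<Longrightarrow> pull n f \<in> Z n"
  using T.cocycleD by (intro pull_Z L_restrict_scalars) auto

lemma pull_coboundary:
  assumes b: "b \<in> T.B n"
  shows "pull n b \<in> B n"
proof (cases n)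
  case 0
  then have "b y = \<zero>\<^bsub>K\<^esub>" if "y \<in> carrier (ob S n)" for y using that b T.coboundary_0_iff by blast
  then show ?thesis
    using b by (intro zero_coboundary cocycleD(1) pull_cocycle T.coboundary_cocycle) (auto simp: pull_apply \<phi>_closed)
next
  case (Suc k)
  obtain u where u: "u \<in> T.L k" "\<And>x. x \<in> carrier (ob S (Suc k)) \<Longrightarrow> b x = u (bd S k x)"
    using b T.coboundary_Suc_iff unfolding Suc by blast
  have "pull k u \<in> L k" using u(1) by (intro pull_L L_restrict_scalars)
  then have "\<exists>v\<in>L k. \<forall>x\<in>carrier (ob P (Suc k)). pull n b x = v (bd P k x)"
    unfolding Suc by (intro bexI[of _ "pull k u"]) (auto simp: pull_apply bd_closed u(2) \<phi>_bd \<phi>_closed)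
  moreover have "pull n b \<in> L n" using b by (intro cocycleD(1) pull_cocycle T.coboundary_cocycle)
  ultimately show ?thesis unfolding Suc coboundary_Suc_iff by simp
qed

lemma pull_add:
  "\<lbrakk>f \<in> T.L n; g \<in> T.L n\<rbrakk> \<Longrightarrow> pull n (f \<oplus>\<^bsub>T.Cochains n\<^esub> g) = pull n f \<oplus>\<^bsub>Cochains n\<^esub> pull n g"
  by (auto simp: pull_def compose_def \<phi>_closed)

lemma pull_smult: "pull n (c \<odot>\<^bsub>T.Cochains n\<^esub> f) = c \<odot>\<^bsub>Cochains n\<^esub> pull n f"
  by (auto simp: pull_def compose_def \<phi>_closed)

text \<open>The union over all representatives spares a choice; by \<open>res_cls\<close> it is a
  single class.\<close>

definition res :: "nat \<Rightarrow> ('q \<Rightarrow> 'k) set \<Rightarrow> ('p \<Rightarrow> 'k) set"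
  where "res n F = (\<Union>f\<in>F. cls n (pull n f))"

lemma res_cls:
  assumes f: "f \<in> T.Z n"
  shows "res n (T.cls n f) = cls n (pull n f)"
proof -
  have "cls n (pull n g) = cls n (pull n f)" if g: "g \<in> T.cls n f" for g
  proof -
    note gZ = T.cls_mem[OF f g]
    obtain b where b: "b \<in> T.B n" "\<And>x. x \<in> carrier (ob S n) \<Longrightarrow> g x = b x \<oplus>\<^bsub>K\<^esub> f x"
      by (rule T.cls_eqE[OF gZ]) (rule that)
    show ?thesis
      by (rule cls_eqI[OF pull_cocycle[OF gZ(1)] pull_cocycle[OF f] pull_coboundary[OF b(1)]])
        (simp add: pull_apply b(2) \<phi>_closed)
  qed
  then show ?thesis unfolding res_def using T.cls_self[OF f] by blast
qed

lemma res_closed: "F \<in> carrier (T.ExtP n) \<Longrightarrow> res n F \<in> carrier (ExtP n)"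
  by (auto simp: Ext_carrier T.Ext_carrier res_cls pull_cocycle)

lemma res_add:
  assumes "F \<in> carrier (T.ExtP n)" "H \<in> carrier (T.ExtP n)"
  shows "res n (F \<oplus>\<^bsub>T.ExtP n\<^esub> H) = res n F \<oplus>\<^bsub>ExtP n\<^esub> res n H"
proof -
  obtain f g where fg: "f \<in> T.Z n" "g \<in> T.Z n" "F = T.cls n f" "H = T.cls n g"
    using assms by (auto simp: T.Ext_carrier)
  have s: "f \<oplus>\<^bsub>T.Cochains n\<^esub> g \<in> T.Z n" by (rule submoduleD(3)[OF T.cocycles_submodule fg(1,2)])
  show ?thesis
    unfolding fg(3,4) T.Ext_add[OF fg(1,2)] res_cls[OF s] res_cls[OF fg(1)] res_cls[OF fg(2)]
      Ext_add[OF pull_cocycle[OF fg(1)] pull_cocycle[OF fg(2)]]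
      pull_add[OF T.cocycleD(1)[OF fg(1)] T.cocycleD(1)[OF fg(2)]] ..
qed

lemma res_smult:
  assumes c: "c \<in> carrier K" and "F \<in> carrier (T.ExtP n)"
  shows "res n (c \<odot>\<^bsub>T.ExtP n\<^esub> F) = c \<odot>\<^bsub>ExtP n\<^esub> res n F"
proof -
  obtain f where f: "f \<in> T.Z n" "F = T.cls n f" using assms by (auto simp: T.Ext_carrier)
  have s: "c \<odot>\<^bsub>T.Cochains n\<^esub> f \<in> T.Z n" by (rule submoduleD(4)[OF T.cocycles_submodule c f(1)])
  show ?thesis
    unfolding f(2) T.Ext_smult[OF c f(1)] res_cls[OF s] res_cls[OF f(1)]
      Ext_smult[OF c pull_cocycle[OF f(1)]] pull_smult ..
qed

lemma res_zero: "res n \<zero>\<^bsub>T.ExtP n\<^esub> = \<zero>\<^bsub>ExtP n\<^esub>"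
proof (rule additive_zero)
  show "abelian_group (T.ExtP n)" "abelian_group (ExtP n)"
    by (rule left_module_abelian_group, rule T.Ext_module) (rule left_module_abelian_group, rule Ext_module)
  then have "\<zero>\<^bsub>T.ExtP n\<^esub> \<in> carrier (T.ExtP n)" by (simp add: abelian_groupE)
  then show "res n \<zero>\<^bsub>T.ExtP n\<^esub> \<in> carrier (ExtP n)" "res n (\<zero>\<^bsub>T.ExtP n\<^esub> \<oplus>\<^bsub>T.ExtP n\<^esub> \<zero>\<^bsub>T.ExtP n\<^esub>) = res n \<zero>\<^bsub>T.ExtP n\<^esub> \<oplus>\<^bsub>ExtP n\<^esub> res n \<zero>\<^bsub>T.ExtP n\<^esub>"
    by (simp_all only: res_closed res_add)
qed

lemma res_finsum:
  assumes "finite I" "\<And>i. i \<in> I \<Longrightarrow> F i \<in> carrier (T.ExtP n)"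
  shows "res n (\<Oplus>\<^bsub>T.ExtP n\<^esub>i\<in>I. F i) = (\<Oplus>\<^bsub>ExtP n\<^esub>i\<in>I. res n (F i))"
  using assms
proof (induction I rule: finite_induct)
  interpret ET: abelian_group "T.ExtP n" by (rule left_module_abelian_group, rule T.Ext_module)
  interpret E: abelian_group "ExtP n" by (rule left_module_abelian_group, rule Ext_module)
  { case empty show ?case by (simp add: res_zero) }
  { case (insert i I)
    have "(\<Oplus>\<^bsub>T.ExtP n\<^esub>j\<in>I. F j) \<in> carrier (T.ExtP n)" using insert.prems by (intro ET.finsum_closed) auto
    with insert show ?case
      by (simp add: Pi_def res_add res_closed) }
qed

text \<open>Both sides are represented by cocycles \<open>f \<circ> \<psi>\<close> for chain maps \<open>\<psi>\<close> that lift the same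
  cocycle \<open>g \<circ> \<phi>\<^sub>n\<close>.\<close>

lemma res_yoneda_mult:
  assumes "F \<in> carrier (T.ExtP m)" "H \<in> carrier (T.ExtP n)"
  shows "res (n + m) (yoneda_mult K R \<delta> S m n F H) = yoneda_mult K A \<epsilon> P m n (res m F) (res n H)"
proof -
  obtain f g where f: "f \<in> T.Z m" "F = T.cls m f" and g: "g \<in> T.Z n" "H = T.cls n g"
    using assms by (auto simp: T.Ext_carrier)
  obtain G where G: "G \<in> cocycle_lifts R S n g" using T.cocycle_lift_exists[OF g(1)] .
  obtain J where J: "J \<in> cocycle_lifts A P n (pull n g)"
    using cocycle_lift_exists[OF pull_cocycle[OF g(1)]] .
  interpret c: comparison A "\<lambda>i. ob P (n + i)" "\<lambda>i. bd P (n + i)" "aug_module K \<epsilon>" S'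
    by (rule shifted_comparison[OF base_group S'_exact])
  note GL = T.cocycle_liftsD(1)[OF G] and JL = cocycle_liftsD(1)[OF J]
  have Gc: "G i x \<in> carrier (ob S i)" if "x \<in> carrier (ob S (n + i))" for i x
    using lin_maps_closed[OF GL that] .
  have Jc: "J i x \<in> carrier (ob P i)" if "x \<in> carrier (ob P (n + i))" for i x
    using lin_maps_closed[OF JL that] .
  define U where "U i = compose (carrier (ob P (n + i))) (G i) (\<phi> (n + i))" for i
  define V where "V i = compose (carrier (ob P (n + i))) (\<phi> i) (J i)" for i
  have U: "c.chain_map U"
    unfolding c.chain_map_def
  proof (intro conjI allI ballI)
    show "U i \<in> lin_maps A (ob P (n + i)) (ob S' i)" for i
      unfolding U_def using lin_maps_restrict_scalars[OF GL \<iota>_hom]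
      by (intro lin_maps_compose[OF \<phi>_linear _ P_module]) simp
    show "bd S' i (U (Suc i) x) = U i (bd P (n + i) x)" if "x \<in> carrier (ob P (n + Suc i))" for i x
      using that T.cocycle_liftsD(3)[OF G, of "\<phi> (Suc (n + i)) x" i]
      by (simp add: U_def compose_def bd_closed \<phi>_closed \<phi>_bd)
  qed
  have V: "c.chain_map V"
    unfolding c.chain_map_def
  proof (intro conjI allI ballI)
    show "V i \<in> lin_maps A (ob P (n + i)) (ob S' i)" for i
      unfolding V_def restrict_complex_simps by (rule lin_maps_compose[OF JL \<phi>_linear P_module])
    show "bd S' i (V (Suc i) x) = V i (bd P (n + i) x)" if "x \<in> carrier (ob P (n + Suc i))" for i x
      using that cocycle_liftsD(3)[OF J, of x i] Jc[of x "Suc i"]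
      by (simp add: V_def compose_def bd_closed \<phi>_bd)
  qed
  have eq: "to_base S' (U 0 x) = to_base S' (V 0 x)" if "x \<in> carrier (ob P (n + 0))" for x
    using that T.cocycle_liftsD(2)[OF G] cocycle_liftsD(2)[OF J] Jc[of x 0]
    by (simp add: U_def V_def compose_def \<phi>_base \<phi>_closed pull_apply)
  have fd: "f (bd S' m x) = \<zero>\<^bsub>aug_module K \<epsilon>\<^esub>" if "x \<in> carrier (ob S' (Suc m))" for x
    using that T.cocycleD(2)[OF f(1)] by simp
  note coh = c.chain_maps_cohomologous[OF U V eq base_group L_restrict_scalars[OF T.cocycleD(1)[OF f(1)]] fd]
  have left: "pull (n + m) (T.yoneda_comp m n f G) x = f (U m x)" if "x \<in> carrier (ob P (n + m))" for x
    using that by (simp add: U_def pull_apply compose_def \<phi>_closed)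
  have right: "yoneda_comp m n (pull m f) J x = f (V m x)" if "x \<in> carrier (ob P (n + m))" for x
    using that by (simp add: V_def pull_apply compose_def Jc)
  have Zl: "pull (n + m) (T.yoneda_comp m n f G) \<in> Z (n + m)"
    by (rule pull_cocycle[OF T.yoneda_comp_cocycle[OF f(1) G]])
  have Zr: "yoneda_comp m n (pull m f) J \<in> Z (n + m)"
    by (rule yoneda_comp_cocycle[OF pull_cocycle[OF f(1)] J])
  have "cls (n + m) (pull (n + m) (T.yoneda_comp m n f G)) = cls (n + m) (yoneda_comp m n (pull m f) J)"
  proof (cases m)
    case 0
    have "pull (n + m) (T.yoneda_comp m n f G) = yoneda_comp m n (pull m f) J"
      by (rule L_ext[OF cocycleD(1)[OF Zl] cocycleD(1)[OF Zr]])
        (use left right coh(1)[OF _ _ 0] 0 in auto)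
    then show ?thesis by simp
  next
    case (Suc k)
    obtain u where "u \<in> L (n + k)"
      "\<forall>x\<in>carrier (ob P (n + m)). f (U m x) = u (bd P (n + k) x) \<oplus>\<^bsub>aug_module K \<epsilon>\<^esub> f (V m x)"
      using coh(2)[OF _ _ Suc] by blast
    then show ?thesis
      using cls_eq_SucI[of _ "n + k" _ u] Zl Zr left right unfolding Suc by simp
  qed
  then show ?thesis
    unfolding f(2) g(2) T.yoneda_mult_cls[OF f(1) g(1) G] res_cls[OF T.yoneda_comp_cocycle[OF f(1) G]]
      res_cls[OF f(1)] res_cls[OF g(1)]
      yoneda_mult_cls[OF pull_cocycle[OF f(1)] pull_cocycle[OF g(1)] J] .
qed

lemma pull_const: "c \<in> carrier K \<Longrightarrow> pull 0 (T.const c) = const c"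
  by (auto simp: pull_def compose_def \<phi>_closed \<phi>_base)

lemma pull_to_base: "pull 0 (to_base S) = to_base P"
  by (rule L_ext[OF cocycleD(1)[OF pull_cocycle[OF T.to_base_cocycle]] cocycleD(1)[OF to_base_cocycle]])
    (simp add: pull_apply \<phi>_base)

definition Res :: "(nat \<Rightarrow> ('q \<Rightarrow> 'k) set) \<Rightarrow> nat \<Rightarrow> ('p \<Rightarrow> 'k) set"
  where "Res \<xi> = (\<lambda>n. res n (\<xi> n))"

lemma Ext_algebra_carrier:
  "\<xi> \<in> carrier (Ext_algebra K A \<epsilon> P) \<longleftrightarrow> (\<forall>n. \<xi> n \<in> carrier (ExtP n)) \<and> finite {n. \<xi> n \<noteq> \<zero>\<^bsub>ExtP n\<^esub>}"
  "\<upsilon> \<in> carrier (Ext_algebra K R \<delta> S) \<longleftrightarrow> (\<forall>n. \<upsilon> n \<in> carrier (T.ExtP n)) \<and> finite {n. \<upsilon> n \<noteq> \<zero>\<^bsub>T.ExtP n\<^esub>}"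
  by (simp_all add: Ext_algebra_def)

lemma Res_closed:
  assumes "\<xi> \<in> carrier (Ext_algebra K R \<delta> S)"
  shows "Res \<xi> \<in> carrier (Ext_algebra K A \<epsilon> P)"
proof -
  have "{n. Res \<xi> n \<noteq> \<zero>\<^bsub>ExtP n\<^esub>} \<subseteq> {n. \<xi> n \<noteq> \<zero>\<^bsub>T.ExtP n\<^esub>}" by (auto simp: Res_def res_zero)
  then show ?thesis
    using assms by (auto simp: Ext_algebra_carrier Res_def res_closed intro: finite_subset)
qed

lemma Res_hom: "Res \<in> ring_hom (Ext_algebra K R \<delta> S) (Ext_algebra K A \<epsilon> P)"
proof (rule ring_hom_memI)
  fix \<xi> \<upsilon> assume *: "\<xi> \<in> carrier (Ext_algebra K R \<delta> S)" "\<upsilon> \<in> carrier (Ext_algebra K R \<delta> S)"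
  then have c: "\<xi> n \<in> carrier (T.ExtP n)" "\<upsilon> n \<in> carrier (T.ExtP n)" for n
    by (auto simp: Ext_algebra_carrier)
  show "Res (\<xi> \<oplus>\<^bsub>Ext_algebra K R \<delta> S\<^esub> \<upsilon>) = Res \<xi> \<oplus>\<^bsub>Ext_algebra K A \<epsilon> P\<^esub> Res \<upsilon>"
    by (auto simp: Res_def Ext_algebra_def res_add c)
  have "res n (\<Oplus>\<^bsub>T.ExtP n\<^esub>i\<in>{..n}. yoneda_mult K R \<delta> S i (n - i) (\<xi> i) (\<upsilon> (n - i)))
      = (\<Oplus>\<^bsub>ExtP n\<^esub>i\<in>{..n}. yoneda_mult K A \<epsilon> P i (n - i) (res i (\<xi> i)) (res (n - i) (\<upsilon> (n - i))))" for n
  proof -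
    interpret E: abelian_group "ExtP n" by (rule left_module_abelian_group, rule Ext_module)
    have yc: "yoneda_mult K R \<delta> S i (n - i) (\<xi> i) (\<upsilon> (n - i)) \<in> carrier (T.ExtP n)" if "i \<le> n" for i
      using T.yoneda_mult_closed[of "\<xi> i" i "\<upsilon> (n - i)" "n - i"] c that by simp
    have yc': "yoneda_mult K A \<epsilon> P i (n - i) (res i (\<xi> i)) (res (n - i) (\<upsilon> (n - i))) \<in> carrier (ExtP n)" if "i \<le> n" for i
      using yoneda_mult_closed[of "res i (\<xi> i)" i "res (n - i) (\<upsilon> (n - i))" "n - i"] c res_closed that by simp
    have eq: "res n (yoneda_mult K R \<delta> S i (n - i) (\<xi> i) (\<upsilon> (n - i)))
      = yoneda_mult K A \<epsilon> P i (n - i) (res i (\<xi> i)) (res (n - i) (\<upsilon> (n - i)))" if "i \<le> n" for i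
      using res_yoneda_mult[of "\<xi> i" i "\<upsilon> (n - i)" "n - i"] c that by simp
    have "res n (\<Oplus>\<^bsub>T.ExtP n\<^esub>i\<in>{..n}. yoneda_mult K R \<delta> S i (n - i) (\<xi> i) (\<upsilon> (n - i)))
      = (\<Oplus>\<^bsub>ExtP n\<^esub>i\<in>{..n}. res n (yoneda_mult K R \<delta> S i (n - i) (\<xi> i) (\<upsilon> (n - i))))"
      by (rule res_finsum) (auto intro: yc)
    also have "\<dots> = (\<Oplus>\<^bsub>ExtP n\<^esub>i\<in>{..n}. yoneda_mult K A \<epsilon> P i (n - i) (res i (\<xi> i)) (res (n - i) (\<upsilon> (n - i))))"
      by (rule E.finsum_cong') (auto simp: eq yc')
    finally show ?thesis .
  qed
  then show "Res (\<xi> \<otimes>\<^bsub>Ext_algebra K R \<delta> S\<^esub> \<upsilon>) = Res \<xi> \<otimes>\<^bsub>Ext_algebra K A \<epsilon> P\<^esub> Res \<upsilon>"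
    by (auto simp: Res_def Ext_algebra_def)
next
  have "res 0 (T.cls 0 (to_base S)) = cls 0 (to_base P)"
    unfolding res_cls[OF T.to_base_cocycle] pull_to_base ..
  then show "Res \<one>\<^bsub>Ext_algebra K R \<delta> S\<^esub> = \<one>\<^bsub>Ext_algebra K A \<epsilon> P\<^esub>"
    by (simp add: Res_def Ext_algebra_def res_zero fun_eq_iff del: coboundaries.simps)
qed (rule Res_closed)

lemma Res_smult:
  "\<lbrakk>c \<in> carrier K; \<xi> \<in> carrier (Ext_algebra K R \<delta> S)\<rbrakk> \<Longrightarrow>
    Res (c \<odot>\<^bsub>Ext_algebra K R \<delta> S\<^esub> \<xi>) = c \<odot>\<^bsub>Ext_algebra K A \<epsilon> P\<^esub> Res \<xi>"
  by (auto simp: Res_def Ext_algebra_def res_smult)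

lemma Res_aug:
  assumes "\<xi> \<in> carrier (Ext_algebra K R \<delta> S)"
  shows "Ext_aug K P (Res \<xi>) = Ext_aug K S \<xi>"
proof -
  have "\<xi> 0 \<in> carrier (T.ExtP 0)" using assms by (simp add: Ext_algebra_carrier)
  then obtain c where c: "c \<in> carrier K" "\<xi> 0 = T.cls 0 (T.const c)" by (rule T.Ext_0_const)
  have "Res \<xi> 0 = cls 0 (const c)"
    unfolding Res_def c(2) res_cls[OF T.const_cocycle[OF c(1)]] pull_const[OF c(1)] ..
  then show ?thesis using T.Ext_aug_const[of c \<xi>] Ext_aug_const[of c "Res \<xi>"] c by simp
qed

lemma S'_module: "left_module A (ob S' n)"
  by (rule exact_resolutionD(1)[OF S'_exact])

text \<open>The lifting property occurs twice because the type of the target is fixed within the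
  context: the target is a term of \<open>P\<close> once and a term of the restricted
  \<open>S\<close> once.\<close>

context
  assumes S_selections: "\<And>V i. left_module A (V :: ('a, 'p) module) \<Longrightarrow> selections A (restrict_scalars \<iota> (ob S i)) V"
    "\<And>V i. left_module A (V :: ('a, 'q) module) \<Longrightarrow> selections A (restrict_scalars \<iota> (ob S i)) V"
begin

text \<open>The comparison with \<open>P\<close> gives the map back, the comparison of the
  restricted \<open>S\<close> with itself gives the homotopy from \<open>\<phi> \<psi>\<close> to
  the identity.\<close>

lemma S'_comparison:
  shows "comparison A (ob S') (bd S) (aug_module K \<epsilon>) P"
    and "comparison A (ob S') (bd S) (aug_module K \<epsilon>) S'"
  using S'_module exact_resolutionD(2)[OF S'_exact] exact_resolutionD(5)[OF S'_exact] base_group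
    S_selections P_module exact S'_exact
  by (simp_all add: comparison_def)

text \<open>Runs against \<open>\<phi>\<close>, by the lifting property of the terms of
  \<open>S\<close> over \<open>A\<close>. It inverts \<open>\<phi>\<close> up to homotopy:
  \<open>\<psi> \<phi>\<close> is compared with the identity in \<open>pull_surj\<close>,
  \<open>\<phi> \<psi>\<close> in \<open>pull_inj\<close>.\<close>

lemma inverse_chain_map:
  obtains \<psi> where "comparison.chain_map A (ob S') (bd S) P \<psi>"
    and "\<And>x. x \<in> carrier (ob S 0) \<Longrightarrow> to_base P (\<psi> 0 x) = to_base S x"
proof -
  interpret c: comparison A "ob S'" "bd S" "aug_module K \<epsilon>" P by (rule S'_comparison)
  obtain \<psi> where "c.chain_map \<psi>" "\<And>x. x \<in> carrier (ob S' 0) \<Longrightarrow> to_base P (\<psi> 0 x) = to_base S x"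
    by (rule c.chain_map_exists[of "to_base S"])
      (use exact_resolutionD(3)[OF S'_exact] exact_resolutionD(7)[OF S'_exact] in auto)
  then show thesis by (intro that[of \<psi>]) auto
qed

text \<open>Take \<open>f = u \<psi>\<close>. Its pullback is \<open>u \<psi> \<phi>\<close>, and
  \<open>\<psi> \<phi>\<close> lifts the augmentation of \<open>P\<close> just as the identity
  does.\<close>

lemma pull_surj:
  assumes u: "u \<in> Z n"
  obtains f where "f \<in> lin_maps A (ob S' n) (aug_module K \<epsilon>)"
    "\<And>x. x \<in> carrier (ob S (Suc n)) \<Longrightarrow> f (bd S n x) = \<zero>\<^bsub>K\<^esub>"
    "cls n (pull n f) = cls n u"
proof -
  obtain \<psi> where \<psi>: "comparison.chain_map A (ob S') (bd S) P \<psi>"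
    and \<psi>0: "\<And>x. x \<in> carrier (ob S 0) \<Longrightarrow> to_base P (\<psi> 0 x) = to_base S x"
    by (rule inverse_chain_map) (rule that)
  note \<psi>L = comparison.chain_mapD(1)[OF S'_comparison(1) \<psi>]
    and \<psi>d = comparison.chain_mapD(2)[OF S'_comparison(1) \<psi>]
  have \<psi>c: "\<psi> i x \<in> carrier (ob P i)" if "x \<in> carrier (ob S i)" for i x
    using lin_maps_closed[OF \<psi>L] that by simp
  define f where "f = compose (carrier (ob S n)) u (\<psi> n)"
  have f: "f \<in> lin_maps A (ob S' n) (aug_module K \<epsilon>)"
    using lin_maps_compose[OF \<psi>L cocycleD(1)[OF u] S'_module] by (simp add: f_def)
  have fd: "f (bd S n x) = \<zero>\<^bsub>K\<^esub>" if "x \<in> carrier (ob S (Suc n))" for x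
    using that cocycleD(2)[OF u] by (simp add: f_def compose_def T.bd_closed \<psi>d[symmetric] \<psi>c)
  interpret c: comparison A "ob P" "bd P" "aug_module K \<epsilon>" P
    using shifted_comparison[OF base_group exact, of 0] by simp
  have 1: "c.chain_map (\<lambda>i. compose (carrier (ob P i)) (\<psi> i) (\<phi> i))"
    unfolding c.chain_map_def
  proof (intro conjI allI ballI)
    show "compose (carrier (ob P i)) (\<psi> i) (\<phi> i) \<in> lin_maps A (ob P i) (ob P i)" for i
      using \<psi>L[of i] by (intro lin_maps_compose[OF \<phi>_linear _ P_module]) simp
  qed (use \<psi>d in \<open>simp add: compose_def bd_closed \<phi>_closed \<phi>_bd\<close>)
  have 2: "c.chain_map (\<lambda>i. \<lambda>x\<in>carrier (ob P i). x)"
    unfolding c.chain_map_def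
  proof (intro conjI allI ballI)
    show "(\<lambda>x\<in>carrier (ob P i). x) \<in> lin_maps A (ob P i) (ob P i)" for i
    proof -
      interpret Pi: left_module A "ob P i" by (rule P_module)
      show ?thesis by (rule lin_mapsI) (auto simp: Pi.smult_closed)
    qed
  qed (simp add: bd_closed)
  have eq: "to_base P (compose (carrier (ob P 0)) (\<psi> 0) (\<phi> 0) x) = to_base P ((\<lambda>x\<in>carrier (ob P 0). x) x)"
    if "x \<in> carrier (ob P 0)" for x using that by (simp add: compose_def \<psi>0 \<phi>_closed \<phi>_base)
  have ud: "u (bd P n x) = \<zero>\<^bsub>aug_module K \<epsilon>\<^esub>" if "x \<in> carrier (ob P (Suc n))" for x
    using cocycleD(2)[OF u that] by simp
  note coh = c.chain_maps_cohomologous[OF 1 2 eq base_group cocycleD(1)[OF u] ud]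
  have pf: "pull n f x = u (compose (carrier (ob P n)) (\<psi> n) (\<phi> n) x)" if "x \<in> carrier (ob P n)" for x
    using that by (simp add: pull_apply f_def compose_def \<phi>_closed)
  have Zf: "pull n f \<in> Z n" by (rule pull_Z[OF f fd])
  have "cls n (pull n f) = cls n u"
  proof (cases n)
    case 0
    have "pull n f = u"
      by (rule L_ext[OF cocycleD(1)[OF Zf] cocycleD(1)[OF u]]) (use pf coh(1)[OF _ _ 0] 0 in auto)
    then show ?thesis by simp
  next
    case (Suc k)
    obtain w where "w \<in> L k" "\<forall>x\<in>carrier (ob P n). u (compose (carrier (ob P n)) (\<psi> n) (\<phi> n) x)
      = w (bd P k x) \<oplus>\<^bsub>aug_module K \<epsilon>\<^esub> u ((\<lambda>x\<in>carrier (ob P n). x) x)"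
      using coh(2)[OF _ _ Suc] by blast
    then show ?thesis using cls_eq_SucI[of _ k _ w] Zf u pf unfolding Suc by simp
  qed
  with f fd show thesis by (rule that)
qed

text \<open>\<open>f\<close> is cohomologous to \<open>f \<phi> \<psi>\<close>, and
  \<open>f \<phi> = w bd\<close> turns the latter into \<open>(w \<psi>) bd\<close>.\<close>

lemma pull_inj:
  assumes f: "f \<in> lin_maps A (ob S' (Suc k)) (aug_module K \<epsilon>)"
    and fd: "\<And>x. x \<in> carrier (ob S (Suc (Suc k))) \<Longrightarrow> f (bd S (Suc k) x) = \<zero>\<^bsub>K\<^esub>"
    and b: "pull (Suc k) f \<in> B (Suc k)"
  obtains a where "a \<in> lin_maps A (ob S' k) (aug_module K \<epsilon>)"
    "\<And>x. x \<in> carrier (ob S (Suc k)) \<Longrightarrow> f x = a (bd S k x)"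
proof -
  obtain \<psi> where \<psi>: "comparison.chain_map A (ob S') (bd S) P \<psi>"
    and \<psi>0: "\<And>x. x \<in> carrier (ob S 0) \<Longrightarrow> to_base P (\<psi> 0 x) = to_base S x"
    by (rule inverse_chain_map) (rule that)
  note \<psi>L = comparison.chain_mapD(1)[OF S'_comparison(1) \<psi>]
    and \<psi>d = comparison.chain_mapD(2)[OF S'_comparison(1) \<psi>]
  have \<psi>c: "\<psi> i x \<in> carrier (ob P i)" if "x \<in> carrier (ob S i)" for i x
    using lin_maps_closed[OF \<psi>L] that by simp
  interpret c: comparison A "ob S'" "bd S" "aug_module K \<epsilon>" S' by (rule S'_comparison)
  have 1: "c.chain_map (\<lambda>i. compose (carrier (ob S i)) (\<phi> i) (\<psi> i))"
    unfolding c.chain_map_def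
  proof (intro conjI allI ballI)
    show "compose (carrier (ob S i)) (\<phi> i) (\<psi> i) \<in> lin_maps A (ob S' i) (ob S' i)" for i
      using lin_maps_compose[OF \<psi>L _ S'_module, of "\<phi> i" i "ob S' i"] \<phi>_linear by simp
  qed (use \<psi>d in \<open>simp add: compose_def T.bd_closed \<psi>c \<phi>_bd\<close>)
  have 2: "c.chain_map (\<lambda>i. \<lambda>x\<in>carrier (ob S i). x)"
    unfolding c.chain_map_def
  proof (intro conjI allI ballI)
    show "(\<lambda>x\<in>carrier (ob S i). x) \<in> lin_maps A (ob S' i) (ob S' i)" for i
    proof -
      interpret Si: left_module A "ob S' i" by (rule S'_module)
      show ?thesis by (rule lin_mapsI) (use Si.smult_closed Si.M.a_closed in auto)
    qed
  qed (simp add: T.bd_closed)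
  have eq: "to_base S' ((\<lambda>x\<in>carrier (ob S 0). x) x) = to_base S' (compose (carrier (ob S 0)) (\<phi> 0) (\<psi> 0) x)"
    if "x \<in> carrier (ob S' 0)" for x using that by (simp add: compose_def \<psi>0 \<psi>c \<phi>_base)
  have fd': "f (bd S' (Suc k) x) = \<zero>\<^bsub>aug_module K \<epsilon>\<^esub>" if "x \<in> carrier (ob S' (Suc (Suc k)))" for x
    using fd that by simp
  obtain u where u: "u \<in> lin_maps A (ob S' k) (aug_module K \<epsilon>)"
    "\<forall>x\<in>carrier (ob S' (Suc k)). f ((\<lambda>x\<in>carrier (ob S (Suc k)). x) x)
      = u (bd S k x) \<oplus>\<^bsub>aug_module K \<epsilon>\<^esub> f (compose (carrier (ob S (Suc k))) (\<phi> (Suc k)) (\<psi> (Suc k)) x)"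
    using c.chain_maps_cohomologous(2)[OF 2 1 eq base_group f fd' refl] by blast
  obtain w where w: "w \<in> L k" "\<And>x. x \<in> carrier (ob P (Suc k)) \<Longrightarrow> pull (Suc k) f x = w (bd P k x)"
    using b unfolding coboundary_Suc_iff by blast
  have w': "compose (carrier (ob S' k)) w (\<psi> k) \<in> lin_maps A (ob S' k) (aug_module K \<epsilon>)"
    by (rule lin_maps_compose[OF \<psi>L w(1) S'_module])
  show thesis
  proof (rule that)
    show "(\<lambda>x\<in>carrier (ob S' k). u x \<oplus>\<^bsub>aug_module K \<epsilon>\<^esub> compose (carrier (ob S' k)) w (\<psi> k) x)
        \<in> lin_maps A (ob S' k) (aug_module K \<epsilon>)"
      by (rule lin_maps_sum[OF S'_module base_module u(1) w'])
    fix x assume x: "x \<in> carrier (ob S (Suc k))"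
    then have "f (\<phi> (Suc k) (\<psi> (Suc k) x)) = w (\<psi> k (bd S k x))"
      using w(2)[of "\<psi> (Suc k) x"] \<psi>c \<psi>d by (simp add: pull_apply)
    then show "f x = (\<lambda>x\<in>carrier (ob S' k). u x \<oplus>\<^bsub>aug_module K \<epsilon>\<^esub> compose (carrier (ob S' k)) w (\<psi> k) x) (bd S k x)"
      using u(2) x by (simp add: compose_def T.bd_closed)
  qed
qed

end

end

section \<open>The coproduct\<close>

text \<open>Used to pass from \<open>FW\<close> to \<open>WA\<close>, which differ in the
  multiplicative fields only.\<close>

lemma left_module_cong:
  assumes M: "left_module R M" and eq: "carrier N = carrier M" "\<zero>\<^bsub>N\<^esub> = \<zero>\<^bsub>M\<^esub>" "add N = add M" "smult N = smult M"
  shows "left_module R N"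
proof -
  interpret left_module R M by fact
  have "abelian_group N"
  proof (rule abelian_groupI)
    fix x assume "x \<in> carrier N"
    then show "\<exists>y\<in>carrier N. y \<oplus>\<^bsub>N\<^esub> x = \<zero>\<^bsub>N\<^esub>"
      by (intro bexI[of _ "\<ominus>\<^bsub>M\<^esub> x"]) (simp_all add: eq M.l_neg)
  qed (simp_all add: eq M.a_ac)
  then show ?thesis
    by (intro left_module.intro left_module_axioms.intro R.ring_axioms)
      (simp_all add: eq smult_closed smult_l_distr smult_r_distr smult_assoc1 smult_one)
qed

text \<open>The ring axioms are an assumption at this point. The theorem discharges it from the
  given resolution \<open>S\<close>, whose terms are left modules and as such come with a ring of
  scalars.\<close>

locale coprod = K?: field K + A: augmented_algebra K \<Lambda> \<epsilon> + G: augmented_algebra K \<Gamma> \<eta>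
  for K :: "('k, 'r) ring_scheme" and \<Lambda> :: "('k, 'a, 'c) module_scheme" and \<epsilon> :: "'a \<Rightarrow> 'k"
    and \<Gamma> :: "('k, 'b, 'd) module_scheme" and \<eta> :: "'b \<Rightarrow> 'k" +
  assumes coprod_ring: "ring (aug_coprod K \<Lambda> \<epsilon> \<Gamma> \<eta>)"
begin

abbreviation "I\<Lambda> \<equiv> a_kernel \<Lambda> K \<epsilon>"
abbreviation "I\<Gamma> \<equiv> a_kernel \<Gamma> K \<eta>"
abbreviation "words \<equiv> alt_words K \<Lambda> \<epsilon> \<Gamma> \<eta>"
abbreviation "FW \<equiv> free_module K words"
abbreviation "WA \<equiv> word_algebra K \<Lambda> \<epsilon> \<Gamma> \<eta>"
abbreviation "R \<equiv> aug_coprod K \<Lambda> \<epsilon> \<Gamma> \<eta>"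
definition "rel_span = submodule_gen K WA (tensor_relations K \<Lambda> \<epsilon> \<Gamma> \<eta>)"
abbreviation "cl f \<equiv> rel_span +>\<^bsub>WA\<^esub> f"
abbreviation "letters \<equiv> Inl ` I\<Lambda> \<union> Inr ` I\<Gamma>"
definition "word_class w = cl (basis_vec K w)"

text \<open>Operations on letters treat both factors alike, which reduces the four kinds of tensor
  relations to two. Letters of different factors are never combined, so the value there is
  arbitrary.\<close>

definition letter_add :: "'a + 'b \<Rightarrow> 'a + 'b \<Rightarrow> 'a + 'b"
  where "letter_add l l' = (case (l, l') of (Inl x, Inl y) \<Rightarrow> Inl (x \<oplus>\<^bsub>\<Lambda>\<^esub> y)
    | (Inr x, Inr y) \<Rightarrow> Inr (x \<oplus>\<^bsub>\<Gamma>\<^esub> y) | _ \<Rightarrow> undefined)"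

definition letter_mult :: "'a + 'b \<Rightarrow> 'a + 'b \<Rightarrow> 'a + 'b"
  where "letter_mult l l' = (case (l, l') of (Inl x, Inl y) \<Rightarrow> Inl (x \<otimes>\<^bsub>\<Lambda>\<^esub> y)
    | (Inr x, Inr y) \<Rightarrow> Inr (x \<otimes>\<^bsub>\<Gamma>\<^esub> y) | _ \<Rightarrow> undefined)"

definition letter_smult :: "'k \<Rightarrow> 'a + 'b \<Rightarrow> 'a + 'b"
  where "letter_smult c l = (case l of Inl x \<Rightarrow> Inl (c \<odot>\<^bsub>\<Lambda>\<^esub> x) | Inr x \<Rightarrow> Inr (c \<odot>\<^bsub>\<Gamma>\<^esub> x))"

lemmas letter_simps [simp] = letter_add_def letter_mult_def letter_smult_def

lemma I\<Lambda>_iff: "x \<in> I\<Lambda> \<longleftrightarrow> x \<in> carrier \<Lambda> \<and> \<epsilon> x = \<zero>\<^bsub>K\<^esub>"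
  and I\<Gamma>_iff: "y \<in> I\<Gamma> \<longleftrightarrow> y \<in> carrier \<Gamma> \<and> \<eta> y = \<zero>\<^bsub>K\<^esub>"
  by (auto simp: a_kernel_def')

lemma letters_closed:
  "\<lbrakk>l \<in> letters; l' \<in> letters; isl l = isl l'\<rbrakk> \<Longrightarrow> letter_add l l' \<in> letters"
  "\<lbrakk>l \<in> letters; l' \<in> letters; isl l = isl l'\<rbrakk> \<Longrightarrow> letter_mult l l' \<in> letters"
  "\<lbrakk>c \<in> carrier K; l \<in> letters\<rbrakk> \<Longrightarrow> letter_smult c l \<in> letters"
  using ring_hom_add[OF A.aug_ring_hom] ring_hom_mult[OF A.aug_ring_hom]
    ring_hom_add[OF G.aug_ring_hom] ring_hom_mult[OF G.aug_ring_hom]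
  by (auto simp: I\<Lambda>_iff I\<Gamma>_iff A.aug_smult G.aug_smult)

lemma isl_letter:
  "isl l = isl l' \<Longrightarrow> isl (letter_add l l') = isl l" "isl l = isl l' \<Longrightarrow> isl (letter_mult l l') = isl l"
  "isl (letter_smult c l) = isl l"
  by (cases l; cases l'; simp)+

lemma words_iff: "w \<in> words \<longleftrightarrow> set w \<subseteq> letters \<and> successively (\<lambda>s t. isl s \<noteq> isl t) w"
  by (simp add: alt_words_def)

lemma words_Nil: "[] \<in> words"
  by (simp add: words_iff)

lemma words_Cons: "l # w \<in> words \<longleftrightarrow> l \<in> letters \<and> w \<in> words \<and> (w \<noteq> [] \<longrightarrow> isl l \<noteq> isl (hd w))"
  by (auto simp: words_iff successively_Cons)

lemma words_replace:
  "\<lbrakk>u @ l # v \<in> words; l' \<in> letters; isl l' = isl l\<rbrakk> \<Longrightarrow> u @ l' # v \<in> words"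
  by (auto simp: words_iff successively_append_iff successively_Cons)

lemma words_letter: "u @ l # v \<in> words \<Longrightarrow> l \<in> letters"
  by (auto simp: words_iff)

lemma WA_simps [simp]:
  "carrier WA = carrier FW" "\<zero>\<^bsub>WA\<^esub> = \<zero>\<^bsub>FW\<^esub>" "add WA = add FW" "smult WA = smult FW"
  "\<one>\<^bsub>WA\<^esub> = basis_vec K []"
  by (simp_all add: word_algebra_def)

lemma FW_module: "left_module K FW"
  by (rule free_module_left_module) (rule K.ring_axioms)

lemma WA_module: "left_module K WA"
  by (rule left_module_cong[OF FW_module]) simp_all

sublocale F: left_module K FW
  by (rule FW_module)

lemma basis_vec_closed: "w \<in> words \<Longrightarrow> basis_vec K w \<in> carrier FW"
  by (rule basis_vec_carrier) (rule K.ring_axioms)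

lemma WA_minus: "f \<ominus>\<^bsub>WA\<^esub> g = f \<ominus>\<^bsub>FW\<^esub> g"
  by (simp add: a_minus_def a_inv_def)

lemma tensor_relations_cases:
  assumes "r \<in> tensor_relations K \<Lambda> \<epsilon> \<Gamma> \<eta>"
  obtains (add) u l l' v where "u @ l # v \<in> words" "u @ l' # v \<in> words" "isl l = isl l'"
      "r = basis_vec K (u @ letter_add l l' # v) \<ominus>\<^bsub>FW\<^esub> (basis_vec K (u @ l # v) \<oplus>\<^bsub>FW\<^esub> basis_vec K (u @ l' # v))"
    | (smult) c u l v where "c \<in> carrier K" "u @ l # v \<in> words"
      "r = basis_vec K (u @ letter_smult c l # v) \<ominus>\<^bsub>FW\<^esub> c \<odot>\<^bsub>FW\<^esub> basis_vec K (u @ l # v)"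
  using assms
proof cases
  case (add_l u x v y)
  then show thesis using add[of u "Inl x" v "Inl y"] by simp
next
  case (add_r u x v y)
  then show thesis using add[of u "Inr x" v "Inr y"] by simp
next
  case (smult_l c u x v)
  then show thesis using smult[of c u "Inl x" v] by simp
next
  case (smult_r c u x v)
  then show thesis using smult[of c u "Inr x" v] by simp
qed

lemma add_relation:
  assumes "u @ l # v \<in> words" "u @ l' # v \<in> words" "isl l = isl l'"
  shows "basis_vec K (u @ letter_add l l' # v) \<ominus>\<^bsub>FW\<^esub> (basis_vec K (u @ l # v) \<oplus>\<^bsub>FW\<^esub> basis_vec K (u @ l' # v))
    \<in> tensor_relations K \<Lambda> \<epsilon> \<Gamma> \<eta>"
proof (cases l)
  case (Inl x)
  then obtain y where "l' = Inl y" using assms(3) by (cases l') auto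
  then show ?thesis using assms Inl tensor_relations.add_l[of u x v K \<Lambda> \<epsilon> \<Gamma> \<eta> y] by (simp del: free_module_simps)
next
  case (Inr x)
  then obtain y where "l' = Inr y" using assms(3) by (cases l') auto
  then show ?thesis using assms Inr tensor_relations.add_r[of u x v K \<Lambda> \<epsilon> \<Gamma> \<eta> y] by (simp del: free_module_simps)
qed

lemma smult_relation:
  assumes "c \<in> carrier K" "u @ l # v \<in> words"
  shows "basis_vec K (u @ letter_smult c l # v) \<ominus>\<^bsub>FW\<^esub> c \<odot>\<^bsub>FW\<^esub> basis_vec K (u @ l # v)
    \<in> tensor_relations K \<Lambda> \<epsilon> \<Gamma> \<eta>"
  using assms tensor_relations.smult_l[of c K u _ v \<Lambda> \<epsilon> \<Gamma> \<eta>] tensor_relations.smult_r[of c K u _ v \<Lambda> \<epsilon> \<Gamma> \<eta>]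
  by (cases l) (simp_all del: free_module_simps)

lemma words_letter_add:
  "\<lbrakk>u @ l # v \<in> words; u @ l' # v \<in> words; isl l = isl l'\<rbrakk> \<Longrightarrow> u @ letter_add l l' # v \<in> words"
  using words_replace[of u l v "letter_add l l'"] words_letter letters_closed(1) isl_letter(1) by metis

lemma words_letter_smult:
  "\<lbrakk>c \<in> carrier K; u @ l # v \<in> words\<rbrakk> \<Longrightarrow> u @ letter_smult c l # v \<in> words"
  using words_replace[of u l v "letter_smult c l"] words_letter letters_closed(3) isl_letter(3) by metis

lemma tensor_relations_closed: "tensor_relations K \<Lambda> \<epsilon> \<Gamma> \<eta> \<subseteq> carrier FW"
proof
  fix r assume "r \<in> tensor_relations K \<Lambda> \<epsilon> \<Gamma> \<eta>"
  then show "r \<in> carrier FW"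
  proof (cases rule: tensor_relations_cases)
    case (add u l l' v)
    then show ?thesis using words_letter_add[OF add(1,2,3)]
      by (auto intro!: F.M.minus_closed F.M.a_closed basis_vec_closed simp del: free_module_simps letter_simps)
  next
    case (smult c u l v)
    then show ?thesis using words_letter_smult[OF smult(1,2)]
      by (auto intro!: F.M.minus_closed F.smult_closed basis_vec_closed simp del: free_module_simps letter_simps)
  qed
qed

lemma rel_span_least:
  assumes "submodule H K WA" "tensor_relations K \<Lambda> \<epsilon> \<Gamma> \<eta> \<subseteq> H"
  shows "rel_span \<subseteq> H"
  using assms by (auto simp: rel_span_def submodule_gen_def)

lemma rel_span_submodule: "submodule rel_span K WA"
proof (rule left_module.submoduleI[OF WA_module])
  have "submodule (carrier WA) K WA"
    by (rule left_module.submoduleI[OF WA_module]) (auto simp: F.smult_closed simp del: free_module_simps)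
  then show "rel_span \<subseteq> carrier WA" by (rule rel_span_least) (use tensor_relations_closed in simp)
qed (auto simp: rel_span_def submodule_gen_def simp del: WA_simps intro: submoduleD(2,3,4))

lemma tensor_relations_Rel: "tensor_relations K \<Lambda> \<epsilon> \<Gamma> \<eta> \<subseteq> rel_span"
  by (auto simp: rel_span_def submodule_gen_def)

sublocale Q: module_quotient K WA rel_span
  by (intro module_quotient.intro module_quotient_axioms.intro WA_module rel_span_submodule)

sublocale R: ring R
  by (rule coprod_ring)

lemma R_quot: "R = quot_module WA rel_span"
  by (simp add: aug_coprod_def rel_span_def)

lemma R_module: "left_module K R"
  using Q.quot_left_module by (simp add: R_quot)

sublocale RK: left_module K R
  by (rule R_module)

lemma R_carrier: "carrier R = cl ` carrier FW"
  using Q.quot_simps(1) by (simp add: R_quot)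

lemma cl_closed: "f \<in> carrier FW \<Longrightarrow> cl f \<in> carrier R"
  by (simp add: R_carrier)

lemma word_class_closed: "w \<in> words \<Longrightarrow> word_class w \<in> carrier R"
  unfolding word_class_def by (intro cl_closed basis_vec_closed)

lemma cl_add: "\<lbrakk>f \<in> carrier FW; g \<in> carrier FW\<rbrakk> \<Longrightarrow> cl f \<oplus>\<^bsub>R\<^esub> cl g = cl (f \<oplus>\<^bsub>FW\<^esub> g)"
  using Q.coset_add[of f g] by (simp add: R_quot del: free_module_simps)

lemma cl_smult: "\<lbrakk>c \<in> carrier K; f \<in> carrier FW\<rbrakk> \<Longrightarrow> c \<odot>\<^bsub>R\<^esub> cl f = cl (c \<odot>\<^bsub>FW\<^esub> f)"
  using Q.coset_smult[of c f] by (simp add: R_quot del: free_module_simps)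

lemma R_one: "\<one>\<^bsub>R\<^esub> = word_class []"
  using Q.quot_simps(4) by (simp add: R_quot word_class_def)

lemma cl_eqI: "\<lbrakk>f \<in> carrier FW; g \<in> carrier FW; f \<ominus>\<^bsub>FW\<^esub> g \<in> rel_span\<rbrakk> \<Longrightarrow> cl f = cl g"
  using Q.coset_eq_iff[of f g] by (simp add: WA_minus)

lemma word_class_add:
  assumes "u @ l # v \<in> words" "u @ l' # v \<in> words" "isl l = isl l'"
  shows "word_class (u @ letter_add l l' # v) = word_class (u @ l # v) \<oplus>\<^bsub>R\<^esub> word_class (u @ l' # v)"
proof -
  have "cl (basis_vec K (u @ letter_add l l' # v)) = cl (basis_vec K (u @ l # v) \<oplus>\<^bsub>FW\<^esub> basis_vec K (u @ l' # v))"
    by (rule cl_eqI)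
      (use assms words_letter_add[OF assms] add_relation[OF assms] tensor_relations_Rel in
        \<open>auto intro!: basis_vec_closed F.M.a_closed simp del: free_module_simps letter_simps\<close>)
  then show ?thesis using assms by (simp add: word_class_def cl_add basis_vec_closed del: free_module_simps letter_simps)
qed

lemma word_class_smult:
  assumes "c \<in> carrier K" "u @ l # v \<in> words"
  shows "word_class (u @ letter_smult c l # v) = c \<odot>\<^bsub>R\<^esub> word_class (u @ l # v)"
proof -
  have "cl (basis_vec K (u @ letter_smult c l # v)) = cl (c \<odot>\<^bsub>FW\<^esub> basis_vec K (u @ l # v))"
    by (rule cl_eqI)
      (use assms words_letter_smult[OF assms] smult_relation[OF assms] tensor_relations_Rel in
        \<open>auto intro!: basis_vec_closed F.smult_closed simp del: free_module_simps letter_simps\<close>)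
  then show ?thesis using assms by (simp add: word_class_def cl_smult basis_vec_closed del: free_module_simps letter_simps)
qed

text \<open>Induction on the support of a representative: deleting one word from it splits off a
  multiple of one word class.\<close>

lemma R_induct [consumes 1, case_names zero add word]:
  assumes r: "r \<in> carrier R" and zero: "\<Phi> \<zero>\<^bsub>R\<^esub>"
    and add: "\<And>r s. \<lbrakk>r \<in> carrier R; s \<in> carrier R; \<Phi> r; \<Phi> s\<rbrakk> \<Longrightarrow> \<Phi> (r \<oplus>\<^bsub>R\<^esub> s)"
    and word: "\<And>c w. \<lbrakk>c \<in> carrier K; w \<in> words\<rbrakk> \<Longrightarrow> \<Phi> (c \<odot>\<^bsub>R\<^esub> word_class w)"
  shows "\<Phi> r"
proof -
  obtain f where f: "f \<in> carrier FW" "r = cl f" using r by (auto simp: R_carrier)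
  have "finite T \<Longrightarrow> f \<in> carrier FW \<Longrightarrow> {w. f w \<noteq> \<zero>\<^bsub>K\<^esub>} = T \<Longrightarrow> \<Phi> (cl f)" for T f
  proof (induction T arbitrary: f rule: finite_induct)
    case empty
    then have "f = \<zero>\<^bsub>FW\<^esub>" by auto
    moreover have "cl \<zero>\<^bsub>FW\<^esub> = \<zero>\<^bsub>R\<^esub>" using Q.coset_zero Q.quot_simps(2) by (simp add: R_quot)
    ultimately show ?case using zero by simp
  next
    case (insert w T)
    have w: "w \<in> words" "f w \<in> carrier K" using insert by (auto simp: free_module_carrier_iff)
    define g where "g = f(w := \<zero>\<^bsub>K\<^esub>)"
    have gT: "{v. g v \<noteq> \<zero>\<^bsub>K\<^esub>} = T" using insert by (auto simp: g_def)
    have g: "g \<in> carrier FW" using insert gT by (auto simp: free_module_carrier_iff g_def)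
    have fg: "f = f w \<odot>\<^bsub>FW\<^esub> basis_vec K w \<oplus>\<^bsub>FW\<^esub> g"
      using insert.prems(1) w by (auto simp: g_def basis_vec_def free_module_carrier_iff)
    have "\<Phi> (f w \<odot>\<^bsub>R\<^esub> word_class w \<oplus>\<^bsub>R\<^esub> cl g)"
      using w g by (intro add word insert.IH RK.smult_closed word_class_closed cl_closed gT)
    also have "f w \<odot>\<^bsub>R\<^esub> word_class w \<oplus>\<^bsub>R\<^esub> cl g = cl (f w \<odot>\<^bsub>FW\<^esub> basis_vec K w \<oplus>\<^bsub>FW\<^esub> g)"
      using w g by (simp add: word_class_def cl_smult cl_add basis_vec_closed F.smult_closed del: free_module_simps)
    also have "\<dots> = cl f" using fg by simp
    finally show ?case .
  qed
  then show ?thesis using f by (auto simp: free_module_carrier_iff)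
qed

subsection \<open>Maps out of the coproduct\<close>

definition multilinear :: "('k, 'm, 'e) module_scheme \<Rightarrow> (('a + 'b) list \<Rightarrow> 'm) \<Rightarrow> bool"
  where "multilinear M T \<longleftrightarrow> (\<forall>w\<in>words. T w \<in> carrier M) \<and>
    (\<forall>u l l' v. u @ l # v \<in> words \<longrightarrow> u @ l' # v \<in> words \<longrightarrow> isl l = isl l' \<longrightarrow>
      T (u @ letter_add l l' # v) = T (u @ l # v) \<oplus>\<^bsub>M\<^esub> T (u @ l' # v)) \<and>
    (\<forall>c u l v. c \<in> carrier K \<longrightarrow> u @ l # v \<in> words \<longrightarrow>
      T (u @ letter_smult c l # v) = c \<odot>\<^bsub>M\<^esub> T (u @ l # v))"

text \<open>The linear extension of \<open>T\<close> to the free module kills the tensor relations,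
  hence their span, and so takes one value on each class. This makes the choice of a representative
  in \<open>h\<close> harmless.\<close>

lemma multilinear_extension:
  assumes M: "left_module K M" and T: "multilinear M T"
  obtains h where "h \<in> lin_maps K R M" "\<And>w. w \<in> words \<Longrightarrow> h (word_class w) = T w"
proof -
  interpret M: left_module K M by fact
  have Tc: "T w \<in> carrier M" if "w \<in> words" for w using T that by (simp add: multilinear_def)
  define g where "g = (\<lambda>f\<in>carrier FW. supp_sum K M (\<lambda>w c. c \<odot>\<^bsub>M\<^esub> T w) f)"
  interpret S: supp_sum_setup K M words "\<lambda>w c. c \<odot>\<^bsub>M\<^esub> T w"
    by unfold_locales (auto simp: Tc M.smult_closed M.smult_l_distr)
  have g: "g \<in> lin_maps K FW M"
  proof (rule lin_mapsI)
    fix c f assume "c \<in> carrier K" "f \<in> carrier FW"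
    moreover from this have "supp_sum K M (\<lambda>w c. c \<odot>\<^bsub>M\<^esub> T w) (c \<odot>\<^bsub>FW\<^esub> f)
      = c \<odot>\<^bsub>M\<^esub> supp_sum K M (\<lambda>w c. c \<odot>\<^bsub>M\<^esub> T w) f"
      by (intro S.supp_sum_smult) (auto simp: M.smult_closed M.smult_r_distr M.smult_assoc1 Tc)
    ultimately show "g (c \<odot>\<^bsub>FW\<^esub> f) = c \<odot>\<^bsub>M\<^esub> g f"
      by (simp add: g_def F.smult_closed del: free_module_simps)
  qed (auto simp: g_def S.supp_sum_closed S.supp_sum_add simp del: free_module_simps)
  have gb: "g (basis_vec K w) = T w" if w: "w \<in> words" for w
  proof -
    have "\<one>\<^bsub>K\<^esub> \<odot>\<^bsub>FW\<^esub> basis_vec K w = basis_vec K w" using basis_vec_closed[OF w] by (rule F.smult_one)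
    then show ?thesis
      using S.supp_sum_basis_vec[OF w _ K.one_closed] Tc[OF w] basis_vec_closed[OF w]
      by (simp add: g_def M.smult_one del: free_module_simps)
  qed
  let ?H = "{f \<in> carrier FW. g f = \<zero>\<^bsub>M\<^esub>}"
  have "submodule ?H K WA"
    by (rule left_module.submoduleI[OF WA_module])
      (auto simp: lin_maps_add[OF g] lin_maps_smult[OF g] lin_maps_zero[OF F.M.abelian_group_axioms M.M.abelian_group_axioms g]
        F.smult_closed M.smult_r_zero simp del: free_module_simps)
  moreover have "tensor_relations K \<Lambda> \<epsilon> \<Gamma> \<eta> \<subseteq> ?H"
  proof
    fix r assume r: "r \<in> tensor_relations K \<Lambda> \<epsilon> \<Gamma> \<eta>"
    note gm = lin_maps_minus[OF F.M.abelian_group_axioms M.M.abelian_group_axioms g]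
    have "g r = \<zero>\<^bsub>M\<^esub>" using r
    proof (cases rule: tensor_relations_cases)
      case (add u l l' v)
      note w = add(1,2) words_letter_add[OF add(1,2,3)]
      have "T (u @ letter_add l l' # v) = T (u @ l # v) \<oplus>\<^bsub>M\<^esub> T (u @ l' # v)"
        using T add unfolding multilinear_def by blast
      then show ?thesis
        unfolding add(4) using w
        by (simp add: gm basis_vec_closed lin_maps_add[OF g] gb Tc M.M.minus_eq M.M.r_neg del: free_module_simps letter_simps)
    next
      case (smult c u l v)
      note w = smult(2) words_letter_smult[OF smult(1,2)]
      have "T (u @ letter_smult c l # v) = c \<odot>\<^bsub>M\<^esub> T (u @ l # v)"
        using T smult unfolding multilinear_def by blast
      then show ?thesis
        unfolding smult(3) using w smult(1)
        by (simp add: gm basis_vec_closed lin_maps_smult[OF g] gb Tc F.smult_closed M.smult_closed M.M.minus_eq M.M.r_neg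
          del: free_module_simps letter_simps)
    qed
    then show "r \<in> ?H" using r tensor_relations_closed by auto
  qed
  ultimately have Rel0: "rel_span \<subseteq> ?H" by (rule rel_span_least)
  define h where "h = (\<lambda>C\<in>carrier R. g (SOME f. f \<in> C))"
  have hcl: "h (cl f) = g f" if f: "f \<in> carrier FW" for f
  proof -
    have "f \<in> cl f" using Q.coset_self[of f] f by simp
    then have e: "(SOME f'. f' \<in> cl f) \<in> cl f" by (rule someI[of "\<lambda>f'. f' \<in> cl f"])
    define e where "e = (SOME f'. f' \<in> cl f)"
    have ec: "e \<in> carrier FW" "cl e = cl f" using Q.mem_cosetD[of f e] f e by (simp_all add: e_def)
    then have "e \<ominus>\<^bsub>FW\<^esub> f \<in> rel_span" using Q.coset_eq_iff[of e f] f by (simp add: WA_minus)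
    then have "g e \<ominus>\<^bsub>M\<^esub> g f = \<zero>\<^bsub>M\<^esub>"
      using Rel0 lin_maps_minus[OF F.M.abelian_group_axioms M.M.abelian_group_axioms g ec(1) f] by auto
    then have "g e = g f" using lin_maps_closed[OF g] ec(1) f M.M.minus_eq_zero_iff by metis
    then show ?thesis using cl_closed[OF f] by (simp add: h_def e_def)
  qed
  have "h \<in> lin_maps K R M"
  proof (rule lin_mapsI)
    show "h \<in> carrier R \<rightarrow>\<^sub>E carrier M"
      using hcl lin_maps_closed[OF g] by (auto simp: R_carrier h_def)
  next
    fix x y assume "x \<in> carrier R" "y \<in> carrier R"
    then obtain f f' where "f \<in> carrier FW" "f' \<in> carrier FW" "x = cl f" "y = cl f'" by (auto simp: R_carrier)
    then show "h (x \<oplus>\<^bsub>R\<^esub> y) = h x \<oplus>\<^bsub>M\<^esub> h y"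
      by (simp add: cl_add hcl lin_maps_add[OF g] del: free_module_simps)
  next
    fix c x assume "c \<in> carrier K" "x \<in> carrier R"
    then obtain f where "f \<in> carrier FW" "x = cl f" "c \<in> carrier K" by (auto simp: R_carrier)
    then show "h (c \<odot>\<^bsub>R\<^esub> x) = c \<odot>\<^bsub>M\<^esub> h x"
      by (simp add: cl_smult hcl lin_maps_smult[OF g] F.smult_closed del: free_module_simps)
  qed
  moreover have "h (word_class w) = T w" if "w \<in> words" for w
    using hcl[OF basis_vec_closed[OF that]] gb[OF that] by (simp add: word_class_def)
  ultimately show thesis by (rule that)
qed

end

context coprod
begin

subsection \<open>Multiplication and augmentation\<close>

text \<open>That \<open>R\<close> is a ring makes the set product of two classes a single class, so
  representatives may be multiplied without a check of independence.\<close>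

lemma cl_mult:
  assumes "f \<in> carrier FW" "g \<in> carrier FW" "f \<otimes>\<^bsub>WA\<^esub> g \<in> carrier FW"
  shows "cl f \<otimes>\<^bsub>R\<^esub> cl g = cl (f \<otimes>\<^bsub>WA\<^esub> g)"
proof -
  have "cl f \<otimes>\<^bsub>R\<^esub> cl g \<in> carrier R" using assms by (intro R.m_closed cl_closed)
  then obtain z where z: "z \<in> carrier FW" "cl f \<otimes>\<^bsub>R\<^esub> cl g = cl z" by (auto simp: R_carrier)
  have "f \<otimes>\<^bsub>WA\<^esub> g \<in> cl (f \<otimes>\<^bsub>WA\<^esub> g)" using Q.coset_self assms(3) by simp
  moreover have "f \<in> cl f" "g \<in> cl g" using Q.coset_self assms by simp_all
  ultimately have "f \<otimes>\<^bsub>WA\<^esub> g \<in> cl f \<otimes>\<^bsub>R\<^esub> cl g"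
    by (auto simp: R_quot Q.quot_simps rcoset_mult_def)
  then show ?thesis using Q.mem_cosetD(2)[of z "f \<otimes>\<^bsub>WA\<^esub> g"] z by simp
qed

lemma WA_mult:
  "(f \<otimes>\<^bsub>WA\<^esub> g) w = (\<Oplus>\<^bsub>K\<^esub>p\<in>{(u, v). f u \<noteq> \<zero>\<^bsub>K\<^esub> \<and> g v \<noteq> \<zero>\<^bsub>K\<^esub> \<and> word_mult \<Lambda> \<Gamma> u v = w}. f (fst p) \<otimes>\<^bsub>K\<^esub> g (snd p))"
  by (simp add: word_algebra_def)

lemma basis_vec_mult: "basis_vec K u \<otimes>\<^bsub>WA\<^esub> basis_vec K v = basis_vec K (word_mult \<Lambda> \<Gamma> u v)"
proof
  fix w
  have "{(u', v'). basis_vec K u u' \<noteq> \<zero>\<^bsub>K\<^esub> \<and> basis_vec K v v' \<noteq> \<zero>\<^bsub>K\<^esub> \<and> word_mult \<Lambda> \<Gamma> u' v' = w}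
      = (if word_mult \<Lambda> \<Gamma> u v = w then {(u, v)} else {})"
    by (auto simp: basis_vec_def split: if_splits)
  then show "(basis_vec K u \<otimes>\<^bsub>WA\<^esub> basis_vec K v) w = basis_vec K (word_mult \<Lambda> \<Gamma> u v) w"
    unfolding WA_mult by (auto simp: basis_vec_def)
qed

lemma scalar_mult_left:
  assumes c: "c \<in> carrier K" and f: "f \<in> carrier FW"
  shows "(c \<odot>\<^bsub>FW\<^esub> basis_vec K []) \<otimes>\<^bsub>WA\<^esub> f = c \<odot>\<^bsub>FW\<^esub> f"
proof
  fix w
  have fw: "f w \<in> carrier K" using f by (simp add: free_module_carrier_iff)
  have "{(u, v). (c \<odot>\<^bsub>FW\<^esub> basis_vec K []) u \<noteq> \<zero>\<^bsub>K\<^esub> \<and> f v \<noteq> \<zero>\<^bsub>K\<^esub> \<and> word_mult \<Lambda> \<Gamma> u v = w}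
      = (if c \<noteq> \<zero>\<^bsub>K\<^esub> \<and> f w \<noteq> \<zero>\<^bsub>K\<^esub> then {([], w)} else {})"
    using c by (auto simp: basis_vec_def word_mult_def split: if_splits)
  then show "((c \<odot>\<^bsub>FW\<^esub> basis_vec K []) \<otimes>\<^bsub>WA\<^esub> f) w = (c \<odot>\<^bsub>FW\<^esub> f) w"
    unfolding WA_mult using c fw by (auto simp: basis_vec_def)
qed

lemma scalar_mult_right:
  assumes c: "c \<in> carrier K" and f: "f \<in> carrier FW"
  shows "f \<otimes>\<^bsub>WA\<^esub> (c \<odot>\<^bsub>FW\<^esub> basis_vec K []) = c \<odot>\<^bsub>FW\<^esub> f"
proof
  fix w
  have fw: "f w \<in> carrier K" using f by (simp add: free_module_carrier_iff)
  have "{(u, v). f u \<noteq> \<zero>\<^bsub>K\<^esub> \<and> (c \<odot>\<^bsub>FW\<^esub> basis_vec K []) v \<noteq> \<zero>\<^bsub>K\<^esub> \<and> word_mult \<Lambda> \<Gamma> u v = w}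
      = (if c \<noteq> \<zero>\<^bsub>K\<^esub> \<and> f w \<noteq> \<zero>\<^bsub>K\<^esub> then {(w, [])} else {})"
    using c by (auto simp: basis_vec_def word_mult_def split: if_splits)
  then show "(f \<otimes>\<^bsub>WA\<^esub> (c \<odot>\<^bsub>FW\<^esub> basis_vec K [])) w = (c \<odot>\<^bsub>FW\<^esub> f) w"
    unfolding WA_mult using c fw by (auto simp: basis_vec_def K.m_comm)
qed

definition scalar :: "'k \<Rightarrow> (('a + 'b) list \<Rightarrow> 'k) set"
  where "scalar c = c \<odot>\<^bsub>R\<^esub> \<one>\<^bsub>R\<^esub>"

lemma scalar_cl: "c \<in> carrier K \<Longrightarrow> scalar c = cl (c \<odot>\<^bsub>FW\<^esub> basis_vec K [])"
  unfolding scalar_def R_one word_class_def by (rule cl_smult) (auto intro: basis_vec_closed words_Nil)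

lemma scalar_closed: "c \<in> carrier K \<Longrightarrow> scalar c \<in> carrier R"
  by (simp add: scalar_def RK.smult_closed)

lemma scalar_mult:
  assumes "c \<in> carrier K" "r \<in> carrier R"
  shows "scalar c \<otimes>\<^bsub>R\<^esub> r = c \<odot>\<^bsub>R\<^esub> r" "r \<otimes>\<^bsub>R\<^esub> scalar c = c \<odot>\<^bsub>R\<^esub> r"
proof -
  obtain f where f: "f \<in> carrier FW" "r = cl f" using assms(2) by (auto simp: R_carrier)
  have b: "c \<odot>\<^bsub>FW\<^esub> basis_vec K [] \<in> carrier FW" "c \<odot>\<^bsub>FW\<^esub> f \<in> carrier FW"
    using assms(1) f by (auto intro!: F.smult_closed basis_vec_closed words_Nil simp del: free_module_simps)
  show "scalar c \<otimes>\<^bsub>R\<^esub> r = c \<odot>\<^bsub>R\<^esub> r" "r \<otimes>\<^bsub>R\<^esub> scalar c = c \<odot>\<^bsub>R\<^esub> r"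
    using cl_mult[OF b(1) f(1)] cl_mult[OF f(1) b(1)] scalar_mult_left[OF assms(1) f(1)]
      scalar_mult_right[OF assms(1) f(1)] b(2)
    by (simp_all add: f(2) scalar_cl[OF assms(1)] cl_smult[OF assms(1) f(1)] del: free_module_simps)
qed

lemma scalar_hom: "scalar \<in> ring_hom K R"
proof (rule ring_hom_memI)
  fix c d assume cd: "c \<in> carrier K" "d \<in> carrier K"
  show "scalar (c \<otimes>\<^bsub>K\<^esub> d) = scalar c \<otimes>\<^bsub>R\<^esub> scalar d"
    using cd scalar_mult(1)[OF cd(1) scalar_closed[OF cd(2)]] by (simp add: scalar_def RK.smult_assoc1)
  show "scalar (c \<oplus>\<^bsub>K\<^esub> d) = scalar c \<oplus>\<^bsub>R\<^esub> scalar d"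
    using cd by (simp add: scalar_def RK.smult_l_distr)
next
  show "scalar \<one>\<^bsub>K\<^esub> = \<one>\<^bsub>R\<^esub>" by (simp add: scalar_def RK.smult_one R.one_closed)
qed (rule scalar_closed)

text \<open>Scaling by \<open>c\<close> is multiplication by the central element
  \<open>scalar c\<close>, so both laws reduce to associativity of \<open>R\<close>.\<close>

lemma smult_mult:
  assumes "c \<in> carrier K" "r \<in> carrier R" "s \<in> carrier R"
  shows "(c \<odot>\<^bsub>R\<^esub> r) \<otimes>\<^bsub>R\<^esub> s = c \<odot>\<^bsub>R\<^esub> (r \<otimes>\<^bsub>R\<^esub> s)" "r \<otimes>\<^bsub>R\<^esub> (c \<odot>\<^bsub>R\<^esub> s) = c \<odot>\<^bsub>R\<^esub> (r \<otimes>\<^bsub>R\<^esub> s)"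
  using assms scalar_mult[symmetric] scalar_closed by (metis R.m_assoc R.m_closed)+

lemma word_class_mult: "\<lbrakk>u \<in> words; v \<in> words; word_mult \<Lambda> \<Gamma> u v \<in> words\<rbrakk> \<Longrightarrow> word_class u \<otimes>\<^bsub>R\<^esub> word_class v = word_class (word_mult \<Lambda> \<Gamma> u v)"
  using cl_mult[of "basis_vec K u" "basis_vec K v"] by (simp add: word_class_def basis_vec_mult basis_vec_closed)

text \<open>In an alternating word \<open>l\<close> and the head of \<open>w\<close> belong to
  different factors, so nothing is merged. Every nonempty word class is thus a product of
  letters.\<close>

lemma word_class_Cons:
  assumes "l # w \<in> words"
  shows "word_class (l # w) = word_class [l] \<otimes>\<^bsub>R\<^esub> word_class w"
proof -
  have "word_mult \<Lambda> \<Gamma> [l] w = l # w"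
    using assms by (cases w; cases l; cases "hd w") (auto simp: word_mult_def words_Cons)
  then show ?thesis using word_class_mult[of "[l]" w] assms by (simp add: words_Cons words_Nil)
qed

lemma word_class_merge:
  assumes "l \<in> letters" "l' # v \<in> words" "isl l = isl l'"
  shows "word_class [l] \<otimes>\<^bsub>R\<^esub> word_class (l' # v) = word_class (letter_mult l l' # v)" "letter_mult l l' # v \<in> words"
proof -
  show w: "letter_mult l l' # v \<in> words"
    using assms letters_closed(2)[of l l'] isl_letter(2)[of l l'] by (auto simp: words_Cons simp del: letter_simps)
  have "word_mult \<Lambda> \<Gamma> [l] (l' # v) = letter_mult l l' # v"
    using assms(3) by (cases l; cases l') (auto simp: word_mult_def)
  then show "word_class [l] \<otimes>\<^bsub>R\<^esub> word_class (l' # v) = word_class (letter_mult l l' # v)"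
    using word_class_mult[of "[l]" "l' # v"] assms w by (simp add: words_Cons words_Nil)
qed

text \<open>What makes the projection by first letters work: merging \<open>l\<close> with the head
  and putting it in front both leave the first letter in the factor of \<open>l\<close>.\<close>

lemma word_class_letter_mult:
  assumes "l \<in> letters" "w \<in> words"
  obtains w' where "w' \<in> words" "w' \<noteq> []" "isl (hd w') = isl l" "word_class [l] \<otimes>\<^bsub>R\<^esub> word_class w = word_class w'"
proof (cases "w \<noteq> [] \<and> isl l = isl (hd w)")
  case True
  then obtain l' v where w: "w = l' # v" "isl l = isl l'" by (cases w) auto
  show thesis
    using word_class_merge[OF assms(1) assms(2)[unfolded w(1)] w(2)] w isl_letter(2)[OF w(2)]
    by (intro that[of "letter_mult l l' # v"]) (simp_all del: letter_simps)
next
  case False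
  then have "l # w \<in> words" using assms by (auto simp: words_Cons)
  then show thesis using word_class_Cons[of l w] by (intro that[of "l # w"]) auto
qed

lemma aug_cl:
  assumes f: "f \<in> carrier FW"
  shows "aug_coprod_aug (cl f) = f []"
proof -
  let ?H = "{f \<in> carrier FW. f [] = \<zero>\<^bsub>K\<^esub>}"
  have "submodule ?H K WA"
  proof (rule left_module.submoduleI[OF WA_module])
    show "\<zero>\<^bsub>WA\<^esub> \<in> ?H" using F.M.zero_closed by simp
    show "x \<oplus>\<^bsub>WA\<^esub> y \<in> ?H" if "x \<in> ?H" "y \<in> ?H" for x y
      using that F.M.a_closed[of x y] by simp
    show "c \<odot>\<^bsub>WA\<^esub> x \<in> ?H" if "c \<in> carrier K" "x \<in> ?H" for c x
      using that F.smult_closed[of c x] by simp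
  qed auto
  moreover have "tensor_relations K \<Lambda> \<epsilon> \<Gamma> \<eta> \<subseteq> ?H"
  proof
    fix r assume r: "r \<in> tensor_relations K \<Lambda> \<epsilon> \<Gamma> \<eta>"
    have sub: "(x \<ominus>\<^bsub>FW\<^esub> y) [] = \<zero>\<^bsub>K\<^esub>" if "x \<in> ?H" "y \<in> ?H" for x y
    proof -
      have "x \<ominus>\<^bsub>FW\<^esub> y = x \<oplus>\<^bsub>FW\<^esub> (\<ominus>\<^bsub>K\<^esub> \<one>\<^bsub>K\<^esub>) \<odot>\<^bsub>FW\<^esub> y"
        using that by (simp add: F.M.minus_eq F.smult_minus_one del: free_module_simps)
      then show ?thesis using that by simp
    qed
    have b: "basis_vec K w \<in> ?H" if "w \<in> words" "w \<noteq> []" for w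
      using that basis_vec_closed[OF that(1)] by (simp add: basis_vec_def)
    have ad: "x \<oplus>\<^bsub>FW\<^esub> y \<in> ?H" if "x \<in> ?H" "y \<in> ?H" for x y
      using that F.M.a_closed[of x y] by simp
    have sm: "c \<odot>\<^bsub>FW\<^esub> x \<in> ?H" if "c \<in> carrier K" "x \<in> ?H" for c x
      using that F.smult_closed[of c x] by simp
    have "r [] = \<zero>\<^bsub>K\<^esub>" using r
    proof (cases rule: tensor_relations_cases)
      case (add u l l' v)
      show ?thesis unfolding add(4)
        by (intro sub b ad add(1,2) words_letter_add[OF add(1,2,3)]) auto
    next
      case (smult c u l v)
      show ?thesis unfolding smult(3)
        by (intro sub b sm smult(1,2) words_letter_smult[OF smult(1,2)]) auto
    qed
    then show "r \<in> ?H" using r tensor_relations_closed by auto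
  qed
  ultimately have Rel0: "rel_span \<subseteq> ?H" by (rule rel_span_least)
  have "g [] = f []" if "g \<in> cl f" for g
  proof -
    obtain n where "n \<in> rel_span" "g = n \<oplus>\<^bsub>WA\<^esub> f" using \<open>g \<in> cl f\<close> by (auto simp: a_r_coset_def r_coset_def)
    then show ?thesis using Rel0 f by (auto simp: free_module_carrier_iff)
  qed
  moreover have "f \<in> cl f" using Q.coset_self f by simp
  ultimately have "(\<lambda>g. g []) ` cl f = {f []}" by blast
  then show ?thesis by (simp add: aug_coprod_aug_def)
qed

lemma aug_closed: "r \<in> carrier R \<Longrightarrow> aug_coprod_aug r \<in> carrier K"
  by (auto simp: R_carrier aug_cl free_module_carrier_iff)

lemma aug_add: "\<lbrakk>r \<in> carrier R; s \<in> carrier R\<rbrakk> \<Longrightarrow> aug_coprod_aug (r \<oplus>\<^bsub>R\<^esub> s) = aug_coprod_aug r \<oplus>\<^bsub>K\<^esub> aug_coprod_aug s"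
  using F.M.a_closed by (auto simp: R_carrier aug_cl cl_add)

lemma aug_smult: "\<lbrakk>c \<in> carrier K; r \<in> carrier R\<rbrakk> \<Longrightarrow> aug_coprod_aug (c \<odot>\<^bsub>R\<^esub> r) = c \<otimes>\<^bsub>K\<^esub> aug_coprod_aug r"
  using F.smult_closed by (auto simp: R_carrier aug_cl cl_smult)

lemma aug_cw: "w \<in> words \<Longrightarrow> aug_coprod_aug (word_class w) = (if w = [] then \<one>\<^bsub>K\<^esub> else \<zero>\<^bsub>K\<^esub>)"
  by (simp add: word_class_def aug_cl basis_vec_closed) (simp add: basis_vec_def)

lemma aug_scalar: "c \<in> carrier K \<Longrightarrow> aug_coprod_aug (scalar c) = c"
  by (simp add: scalar_def aug_smult R_one word_class_closed words_Nil aug_cw)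

text \<open>The projection of \<open>R\<close> onto the span of the words that start in \<open>\<Lambda>\<close>.\<close>

lemma left_projection:
  obtains h where "h \<in> lin_maps K R R"
    and "\<And>l r. \<lbrakk>l \<in> letters; r \<in> carrier R\<rbrakk> \<Longrightarrow> h (word_class [l] \<otimes>\<^bsub>R\<^esub> r) = (if isl l then word_class [l] \<otimes>\<^bsub>R\<^esub> r else \<zero>\<^bsub>R\<^esub>)"
proof -
  define T where "T w = (if w \<noteq> [] \<and> isl (hd w) then word_class w else \<zero>\<^bsub>R\<^esub>)" for w
  have hd: "isl (hd (u @ l # v)) = isl (hd (u @ l' # v))" if "isl l = isl l'" for u v and l l' :: "'a + 'b"
    using that by (cases u) auto
  have "multilinear R T"
    unfolding multilinear_def
  proof (intro conjI allI impI ballI)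
    show "T w \<in> carrier R" if "w \<in> words" for w using that by (simp add: T_def word_class_closed)
    show "T (u @ letter_add l l' # v) = T (u @ l # v) \<oplus>\<^bsub>R\<^esub> T (u @ l' # v)"
      if "u @ l # v \<in> words" "u @ l' # v \<in> words" "isl l = isl l'" for u l l' v
      using that word_class_add[OF that] hd[of l l' u v] hd[OF isl_letter(1)[OF that(3)], of u v]
      by (simp add: T_def del: letter_simps)
    show "T (u @ letter_smult c l # v) = c \<odot>\<^bsub>R\<^esub> T (u @ l # v)"
      if "c \<in> carrier K" "u @ l # v \<in> words" for c u l v
      using that word_class_smult[OF that] hd[OF isl_letter(3), of u c l v]
      by (simp add: T_def RK.smult_r_zero del: letter_simps)
  qed
  then obtain h where h: "h \<in> lin_maps K R R" "\<And>w. w \<in> words \<Longrightarrow> h (word_class w) = T w"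
    by (rule multilinear_extension[OF R_module]) (rule that)
  have "h (word_class [l] \<otimes>\<^bsub>R\<^esub> r) = (if isl l then word_class [l] \<otimes>\<^bsub>R\<^esub> r else \<zero>\<^bsub>R\<^esub>)" if l: "l \<in> letters" and r: "r \<in> carrier R" for l r
    using r
  proof (induction r rule: R_induct)
    have lw: "word_class [l] \<in> carrier R" using l by (intro word_class_closed) (simp add: words_Cons words_Nil)
    {
      case zero
      show ?case using lw lin_maps_zero[OF R.abelian_group_axioms R.abelian_group_axioms h(1)] by simp
    next
      case (add r s)
      then show ?case using lw by (simp add: R.r_distr lin_maps_add[OF h(1)])
    next
      case (word c w)
      obtain w' where w': "w' \<in> words" "w' \<noteq> []" "isl (hd w') = isl l" "word_class [l] \<otimes>\<^bsub>R\<^esub> word_class w = word_class w'"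
        using word_class_letter_mult[OF l word(2)] .
      then have "word_class [l] \<otimes>\<^bsub>R\<^esub> (c \<odot>\<^bsub>R\<^esub> word_class w) = c \<odot>\<^bsub>R\<^esub> word_class w'"
        using smult_mult(2)[OF word(1) lw word_class_closed[OF word(2)]] by simp
      then show ?case using word w'
        by (simp add: lin_maps_smult[OF h(1)] word_class_closed h(2) T_def RK.smult_r_zero)
    }
  qed
  with h(1) show thesis by (rule that)
qed

end

subsection \<open>The two factors\<close>

text \<open>Instantiated with both factors of the coproduct; \<open>j\<close> is the injection of a factor into the
  alphabet.\<close>

locale coprod_factor = coprod K \<Lambda> \<epsilon> \<Gamma> \<eta> + C: augmented_algebra K A \<alpha>
  for K :: "('k, 'r) ring_scheme" and \<Lambda> :: "('k, 'a, 'c) module_scheme" and \<epsilon> :: "'a \<Rightarrow> 'k"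
    and \<Gamma> :: "('k, 'b, 'd) module_scheme" and \<eta> :: "'b \<Rightarrow> 'k"
    and A :: "('k, 'x, 'e) module_scheme" and \<alpha> :: "'x \<Rightarrow> 'k" +
  fixes j :: "'x \<Rightarrow> 'a + 'b" and side :: bool
  assumes j_inj: "inj j" and j_side: "isl (j x) = side"
    and j_letters: "{l \<in> letters. isl l = side} = j ` a_kernel A K \<alpha>"
    and j_add: "letter_add (j x) (j y) = j (x \<oplus>\<^bsub>A\<^esub> y)"
    and j_mult: "letter_mult (j x) (j y) = j (x \<otimes>\<^bsub>A\<^esub> y)"
    and j_smult: "letter_smult c (j x) = j (c \<odot>\<^bsub>A\<^esub> x)"
begin

abbreviation "IA \<equiv> a_kernel A K \<alpha>"

lemma IA_iff: "x \<in> IA \<longleftrightarrow> x \<in> carrier A \<and> \<alpha> x = \<zero>\<^bsub>K\<^esub>"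
  by (auto simp: a_kernel_def')

lemmas \<alpha>_hom = ring_hom_closed[OF C.aug_ring_hom] ring_hom_add[OF C.aug_ring_hom]
  ring_hom_mult[OF C.aug_ring_hom] ring_hom_one[OF C.aug_ring_hom] C.aug_smult

lemma j_letter: "x \<in> IA \<Longrightarrow> j x \<in> letters"
  using j_letters by blast

lemma j_word: "x \<in> IA \<Longrightarrow> [j x] \<in> words"
  using j_letter by (simp add: words_Cons words_Nil)

definition letter_class :: "'x \<Rightarrow> (('a + 'b) list \<Rightarrow> 'k) set" where "letter_class x = word_class [j x]"

lemma letter_class_closed: "x \<in> IA \<Longrightarrow> letter_class x \<in> carrier R"
  unfolding letter_class_def by (intro word_class_closed j_word)

lemma letter_class_add: "\<lbrakk>x \<in> IA; y \<in> IA\<rbrakk> \<Longrightarrow> letter_class (x \<oplus>\<^bsub>A\<^esub> y) = letter_class x \<oplus>\<^bsub>R\<^esub> letter_class y"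
  using word_class_add[of "[]" "j x" "[]" "j y"] by (simp add: letter_class_def j_word j_add j_side del: letter_simps)

lemma letter_class_smult: "\<lbrakk>c \<in> carrier K; x \<in> IA\<rbrakk> \<Longrightarrow> letter_class (c \<odot>\<^bsub>A\<^esub> x) = c \<odot>\<^bsub>R\<^esub> letter_class x"
  using word_class_smult[of c "[]" "j x" "[]"] by (simp add: letter_class_def j_word j_smult del: letter_simps)

lemma letter_class_mult: "\<lbrakk>x \<in> IA; y \<in> IA\<rbrakk> \<Longrightarrow> letter_class (x \<otimes>\<^bsub>A\<^esub> y) = letter_class x \<otimes>\<^bsub>R\<^esub> letter_class y"
  using word_class_merge(1)[OF j_letter j_word, of x y] by (simp add: letter_class_def j_mult j_side del: letter_simps)

text \<open>The component of \<open>a\<close> in the augmentation ideal, for the decomposition of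
  \<open>A\<close> into \<open>IA\<close> and the scalars.\<close>

definition aug_part :: "'x \<Rightarrow> 'x" where "aug_part a = a \<ominus>\<^bsub>A\<^esub> \<alpha> a \<odot>\<^bsub>A\<^esub> \<one>\<^bsub>A\<^esub>"

text \<open>The structure map of the coproduct, given separately on the two summands of
  \<open>A\<close> because only elements of \<open>IA\<close> are letters.\<close>

definition incl :: "'x \<Rightarrow> (('a + 'b) list \<Rightarrow> 'k) set"
  where "incl a = letter_class (aug_part a) \<oplus>\<^bsub>R\<^esub> scalar (\<alpha> a)"

lemma A_module: "left_module K A"
  by (intro left_module.intro left_module_axioms.intro K.ring_axioms C.abelian_group_axioms)
    (auto simp: C.smult_l_distr C.smult_r_distr C.smult_assoc1)

lemma aug_part_split: "a \<in> carrier A \<Longrightarrow> a = aug_part a \<oplus>\<^bsub>A\<^esub> \<alpha> a \<odot>\<^bsub>A\<^esub> \<one>\<^bsub>A\<^esub>"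
  unfolding aug_part_def by (rule C.minus_add_cancel[symmetric]) (auto simp: \<alpha>_hom)

lemma aug_part_IA: "a \<in> carrier A \<Longrightarrow> aug_part a \<in> IA"
proof -
  assume a: "a \<in> carrier A"
  have c: "aug_part a \<in> carrier A" using a by (simp add: aug_part_def \<alpha>_hom)
  have "\<alpha> a = \<alpha> (aug_part a \<oplus>\<^bsub>A\<^esub> \<alpha> a \<odot>\<^bsub>A\<^esub> \<one>\<^bsub>A\<^esub>)" using aug_part_split[OF a] by simp
  also have "\<dots> = \<alpha> (aug_part a) \<oplus>\<^bsub>K\<^esub> \<alpha> a" using a c by (simp add: \<alpha>_hom)
  finally have "\<alpha> (aug_part a) = \<zero>\<^bsub>K\<^esub>" using a c by (metis K.add.r_cancel_one \<alpha>_hom(1))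
  then show ?thesis using c by (simp add: IA_iff)
qed

lemma aug_part_unique:
  assumes "a \<in> carrier A" "x \<in> IA" "c \<in> carrier K" "a = x \<oplus>\<^bsub>A\<^esub> c \<odot>\<^bsub>A\<^esub> \<one>\<^bsub>A\<^esub>"
  shows "aug_part a = x" "\<alpha> a = c"
proof -
  show c: "\<alpha> a = c" using assms by (simp add: IA_iff \<alpha>_hom)
  show "aug_part a = x"
    unfolding aug_part_def c using assms C.minus_eq_iff[of a "c \<odot>\<^bsub>A\<^esub> \<one>\<^bsub>A\<^esub>" x] by (simp add: IA_iff)
qed

lemma incl_split:
  "\<lbrakk>x \<in> IA; c \<in> carrier K\<rbrakk> \<Longrightarrow> incl (x \<oplus>\<^bsub>A\<^esub> c \<odot>\<^bsub>A\<^esub> \<one>\<^bsub>A\<^esub>) = letter_class x \<oplus>\<^bsub>R\<^esub> scalar c"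
  using aug_part_unique[of "x \<oplus>\<^bsub>A\<^esub> c \<odot>\<^bsub>A\<^esub> \<one>\<^bsub>A\<^esub>" x c] by (simp add: incl_def IA_iff)

lemma IA_ideal:
  "\<zero>\<^bsub>A\<^esub> \<in> IA" "\<lbrakk>x \<in> IA; y \<in> IA\<rbrakk> \<Longrightarrow> x \<oplus>\<^bsub>A\<^esub> y \<in> IA" "\<lbrakk>x \<in> IA; a \<in> carrier A\<rbrakk> \<Longrightarrow> x \<otimes>\<^bsub>A\<^esub> a \<in> IA"
  "\<lbrakk>c \<in> carrier K; x \<in> IA\<rbrakk> \<Longrightarrow> c \<odot>\<^bsub>A\<^esub> x \<in> IA"
proof -
  have "\<alpha> \<zero>\<^bsub>A\<^esub> = \<zero>\<^bsub>K\<^esub>"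
    by (rule additive_zero[OF C.abelian_group_axioms K.abelian_group_axioms])
      (rule \<alpha>_hom C.zero_closed)+
  then show "\<zero>\<^bsub>A\<^esub> \<in> IA" by (simp add: IA_iff)
qed (auto simp: IA_iff \<alpha>_hom)

lemma letter_class_zero: "letter_class \<zero>\<^bsub>A\<^esub> = \<zero>\<^bsub>R\<^esub>"
  using letter_class_add[OF IA_ideal(1,1)] letter_class_closed[OF IA_ideal(1)] by simp

lemma incl_IA: "x \<in> IA \<Longrightarrow> incl x = letter_class x"
  using incl_split[of x "\<zero>\<^bsub>K\<^esub>"] letter_class_closed[of x]
  by (simp add: scalar_def RK.smult_l_zero left_module.smult_l_zero[OF A_module] IA_iff)

lemma incl_scalar: "c \<in> carrier K \<Longrightarrow> incl (c \<odot>\<^bsub>A\<^esub> \<one>\<^bsub>A\<^esub>) = scalar c"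
  using incl_split[OF IA_ideal(1), of c] by (simp add: letter_class_zero scalar_closed)

lemma incl_closed: "a \<in> carrier A \<Longrightarrow> incl a \<in> carrier R"
  by (simp add: incl_def letter_class_closed aug_part_IA scalar_closed \<alpha>_hom)

text \<open>With \<open>a = x + c\<close> and \<open>b = y + d\<close> the product is
  \<open>(xy + dx + cy) + cd\<close>, whose bracket lies in \<open>IA\<close>. On \<open>IA\<close>
  multiplicativity is the merging of letters.\<close>

lemma incl_hom: "incl \<in> ring_hom A R"
proof (rule ring_hom_memI)
  fix a b assume a: "a \<in> carrier A" and b: "b \<in> carrier A"
  define x y c d where "x = aug_part a" "y = aug_part b" "c = \<alpha> a" "d = \<alpha> b"
  note defs = x_y_c_d_def
  have xy: "x \<in> IA" "y \<in> IA" "c \<in> carrier K" "d \<in> carrier K" using a b by (auto simp: defs aug_part_IA \<alpha>_hom)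
  then have xyc: "x \<in> carrier A" "y \<in> carrier A" by (auto simp: IA_iff)
  have ab: "a = x \<oplus>\<^bsub>A\<^esub> c \<odot>\<^bsub>A\<^esub> \<one>\<^bsub>A\<^esub>" "b = y \<oplus>\<^bsub>A\<^esub> d \<odot>\<^bsub>A\<^esub> \<one>\<^bsub>A\<^esub>"
    using a b aug_part_split by (auto simp: defs)
  note l = letter_class_closed[OF xy(1)] letter_class_closed[OF xy(2)] scalar_closed[OF xy(3)] scalar_closed[OF xy(4)]
  have ia: "incl a = letter_class x \<oplus>\<^bsub>R\<^esub> scalar c" "incl b = letter_class y \<oplus>\<^bsub>R\<^esub> scalar d"
    by (simp_all add: incl_def defs)
  have "a \<oplus>\<^bsub>A\<^esub> b = (x \<oplus>\<^bsub>A\<^esub> y) \<oplus>\<^bsub>A\<^esub> (c \<oplus>\<^bsub>K\<^esub> d) \<odot>\<^bsub>A\<^esub> \<one>\<^bsub>A\<^esub>"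
    using xy xyc by (simp add: ab C.smult_l_distr C.a_ac)
  then have "incl (a \<oplus>\<^bsub>A\<^esub> b) = letter_class (x \<oplus>\<^bsub>A\<^esub> y) \<oplus>\<^bsub>R\<^esub> scalar (c \<oplus>\<^bsub>K\<^esub> d)"
    using incl_split[OF IA_ideal(2)[OF xy(1,2)], of "c \<oplus>\<^bsub>K\<^esub> d"] xy by simp
  then show "incl (a \<oplus>\<^bsub>A\<^esub> b) = incl a \<oplus>\<^bsub>R\<^esub> incl b"
    using xy l by (simp add: ia letter_class_add ring_hom_add[OF scalar_hom] R.a_ac)
  have z: "x \<otimes>\<^bsub>A\<^esub> y \<oplus>\<^bsub>A\<^esub> d \<odot>\<^bsub>A\<^esub> x \<oplus>\<^bsub>A\<^esub> c \<odot>\<^bsub>A\<^esub> y \<in> IA"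
    using xy xyc by (intro IA_ideal) auto
  have "a \<otimes>\<^bsub>A\<^esub> b = (x \<otimes>\<^bsub>A\<^esub> y \<oplus>\<^bsub>A\<^esub> d \<odot>\<^bsub>A\<^esub> x \<oplus>\<^bsub>A\<^esub> c \<odot>\<^bsub>A\<^esub> y) \<oplus>\<^bsub>A\<^esub> (c \<otimes>\<^bsub>K\<^esub> d) \<odot>\<^bsub>A\<^esub> \<one>\<^bsub>A\<^esub>"
    using xy xyc by (simp add: ab C.l_distr C.r_distr C.smult_mult_left C.smult_mult_right C.smult_r_distr
      C.smult_assoc1[symmetric] K.m_comm C.a_ac)
  then have "incl (a \<otimes>\<^bsub>A\<^esub> b) = letter_class (x \<otimes>\<^bsub>A\<^esub> y \<oplus>\<^bsub>A\<^esub> d \<odot>\<^bsub>A\<^esub> x \<oplus>\<^bsub>A\<^esub> c \<odot>\<^bsub>A\<^esub> y) \<oplus>\<^bsub>R\<^esub> scalar (c \<otimes>\<^bsub>K\<^esub> d)"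
    using incl_split[OF z, of "c \<otimes>\<^bsub>K\<^esub> d"] xy by simp
  also have "\<dots> = (letter_class x \<otimes>\<^bsub>R\<^esub> letter_class y \<oplus>\<^bsub>R\<^esub> d \<odot>\<^bsub>R\<^esub> letter_class x \<oplus>\<^bsub>R\<^esub> c \<odot>\<^bsub>R\<^esub> letter_class y) \<oplus>\<^bsub>R\<^esub> scalar (c \<otimes>\<^bsub>K\<^esub> d)"
    using xy xyc by (simp add: letter_class_add letter_class_mult letter_class_smult IA_ideal)
  also have "\<dots> = (letter_class x \<oplus>\<^bsub>R\<^esub> scalar c) \<otimes>\<^bsub>R\<^esub> (letter_class y \<oplus>\<^bsub>R\<^esub> scalar d)"
    using xy l by (simp add: R.l_distr R.r_distr scalar_mult ring_hom_mult[OF scalar_hom] R.a_ac RK.smult_closed RK.smult_r_distr)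
  finally show "incl (a \<otimes>\<^bsub>A\<^esub> b) = incl a \<otimes>\<^bsub>R\<^esub> incl b" by (simp add: ia)
next
  show "incl \<one>\<^bsub>A\<^esub> = \<one>\<^bsub>R\<^esub>"
    using incl_scalar[of "\<one>\<^bsub>K\<^esub>"] by (simp add: scalar_def RK.smult_one)
qed (rule incl_closed)

lemma aug_incl: "a \<in> carrier A \<Longrightarrow> aug_coprod_aug (incl a) = \<alpha> a"
  using aug_part_IA[of a]
  by (simp add: incl_def aug_add letter_class_closed scalar_closed \<alpha>_hom aug_scalar) (simp add: letter_class_def aug_cw j_word \<alpha>_hom)

text \<open>\<open>R\<close> is free over \<open>A\<close> on a basis of the span of the words that do not start in \<open>A\<close>; the lift
  is a \<open>K\<close>-linear one on that span, extended \<open>A\<close>-linearly.\<close>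

lemma factor_selections:
  assumes V: "left_module A V"
  shows "selections A (restrict_scalars incl (regular_module R)) V"
proof (rule selectionsI)
  interpret V: left_module A V by fact
  let ?s = "\<lambda>c. c \<odot>\<^bsub>A\<^esub> \<one>\<^bsub>A\<^esub>"
  have s_hom: "?s \<in> ring_hom K A"
    by (rule ring_hom_memI) (simp_all add: C.smult_assoc1 C.smult_l_distr C.smult_mult_left)
  \<comment> \<open>\<open>K\<close> acts on \<open>V\<close> through the scalar multiples of one in
    \<open>A\<close>.\<close>
  let ?V = "restrict_scalars ?s V"
  have VK: "left_module K ?V" by (rule restrict_scalars_left_module[OF V K.ring_axioms s_hom])
  have s_mult: "?s c \<otimes>\<^bsub>A\<^esub> a = c \<odot>\<^bsub>A\<^esub> a" "a \<otimes>\<^bsub>A\<^esub> ?s c = c \<odot>\<^bsub>A\<^esub> a" if "c \<in> carrier K" "a \<in> carrier A" for c a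
    using that by (simp_all add: C.smult_mult_left C.smult_mult_right)
  fix \<rho> assume \<rho>: "lin_rel A (restrict_scalars incl (regular_module R)) V \<rho>"
    and total: "\<And>x. x \<in> carrier (restrict_scalars incl (regular_module R)) \<Longrightarrow> \<exists>y. (x, y) \<in> \<rho>"
  note \<rho>D = lin_relD[OF \<rho>, simplified]
  have \<rho>K: "lin_rel K R ?V \<rho>"
  proof (rule lin_relI)
    show "(c \<odot>\<^bsub>R\<^esub> r, c \<odot>\<^bsub>?V\<^esub> v) \<in> \<rho>" if "c \<in> carrier K" "(r, v) \<in> \<rho>" for c r v
      using \<rho>D(5)[OF _ that(2), of "?s c"] that(1) \<rho>D(1)[OF that(2)] by (simp add: incl_scalar scalar_mult)
  qed (use \<rho>D in auto)
  \<comment> \<open>Over the field a linear choice from \<open>\<rho>\<close> exists on all of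
    \<open>R\<close>. It is kept on the words that do not start in \<open>A\<close> and overwritten
    on the others.\<close>
  obtain \<sigma> where \<sigma>: "\<sigma> \<in> lin_maps K R ?V" "\<And>r. r \<in> carrier R \<Longrightarrow> (r, \<sigma> r) \<in> \<rho>"
    using selectionsD[OF vector_space_selections[OF K.field_axioms R_module VK] \<rho>K] total by auto
  define m where "m w = \<sigma> (word_class w)" for w
  have m_closed: "m w \<in> carrier V" if "w \<in> words" for w
    using lin_maps_closed[OF \<sigma>(1) word_class_closed[OF that]] by (simp add: m_def)
  have m_add: "m (u @ letter_add l l' # v) = m (u @ l # v) \<oplus>\<^bsub>V\<^esub> m (u @ l' # v)"
    if "u @ l # v \<in> words" "u @ l' # v \<in> words" "isl l = isl l'" for u l l' v
    using lin_maps_add[OF \<sigma>(1) word_class_closed[OF that(1)] word_class_closed[OF that(2)]] word_class_add[OF that] by (simp add: m_def del: letter_simps)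
  have m_smult: "m (u @ letter_smult c l # v) = ?s c \<odot>\<^bsub>V\<^esub> m (u @ l # v)"
    if "c \<in> carrier K" "u @ l # v \<in> words" for c u l v
    using lin_maps_smult[OF \<sigma>(1) that(1) word_class_closed[OF that(2)]] word_class_smult[OF that] by (simp add: m_def del: letter_simps)
  \<comment> \<open>The class of \<open>j x # v\<close> is \<open>x\<close> times the class of
    \<open>v\<close>, and \<open>v\<close> does not start in \<open>A\<close>. So these values are
    forced on an \<open>A\<close>-linear map that agrees with \<open>m\<close> on the words not
    starting in \<open>A\<close>.\<close>
  define T where "T w = (if w \<noteq> [] \<and> isl (hd w) = side then inv_into UNIV j (hd w) \<odot>\<^bsub>V\<^esub> m (tl w) else m w)" for w
  have T_j: "T (j x # w) = x \<odot>\<^bsub>V\<^esub> m w" for x w by (simp add: T_def j_side inv_f_f[OF j_inj])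
  have T_other: "T w = m w" if "w = [] \<or> isl (hd w) \<noteq> side" for w using that by (auto simp: T_def)
  have side_j: "\<exists>x\<in>IA. l = j x" if "l \<in> letters" "isl l = side" for l using that j_letters by blast
  have mult: "multilinear ?V T"
    unfolding multilinear_def
  proof (intro conjI allI impI ballI)
    show "T w \<in> carrier ?V" if w: "w \<in> words" for w
    proof (cases "w \<noteq> [] \<and> isl (hd w) = side")
      case True
      then obtain l v where lv: "w = l # v" "isl l = side" by (cases w) auto
      then obtain x where "x \<in> IA" "l = j x" using side_j[of l] w by (auto simp: words_Cons)
      then show ?thesis using w lv m_closed by (simp add: T_j V.smult_closed IA_iff words_Cons)
    qed (use m_closed[OF w] T_other[of w] in auto)
  next
    fix u l l' v assume w: "u @ l # v \<in> words" "u @ l' # v \<in> words" "isl l = isl l'"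
    show "T (u @ letter_add l l' # v) = T (u @ l # v) \<oplus>\<^bsub>?V\<^esub> T (u @ l' # v)"
    proof (cases u)
      case Nil
      show ?thesis
      proof (cases "isl l = side")
        case True
        then obtain x y where "x \<in> IA" "y \<in> IA" "l = j x" "l' = j y"
          using side_j[of l] side_j[of l'] w words_letter by metis
        then show ?thesis
          using w Nil m_closed[of v] by (simp add: j_add T_j V.smult_l_distr IA_iff words_Cons del: letter_simps)
      next
        case False
        then show ?thesis
          using Nil w isl_letter(1)[OF w(3)] m_add[OF w] by (simp add: T_other del: letter_simps)
      qed
    next
      case (Cons k u')
      have ul: "u' @ l # v \<in> words" "u' @ l' # v \<in> words" using w Cons by (auto simp: words_Cons)
      show ?thesis
      proof (cases "isl k = side")
        case True
        then obtain x where "x \<in> IA" "k = j x" using side_j[of k] w Cons by (auto simp: words_Cons)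
        then show ?thesis
          using Cons ul m_add[OF ul w(3)] m_closed by (simp add: T_j V.smult_r_distr IA_iff del: letter_simps)
      next
        case False
        then show ?thesis using Cons m_add[OF w] by (simp add: T_other del: letter_simps)
      qed
    qed
  next
    fix c u l v assume c: "c \<in> carrier K" and w: "u @ l # v \<in> words"
    show "T (u @ letter_smult c l # v) = c \<odot>\<^bsub>?V\<^esub> T (u @ l # v)"
    proof (cases u)
      case Nil
      show ?thesis
      proof (cases "isl l = side")
        case True
        then obtain x where "x \<in> IA" "l = j x"
          using side_j[of l] w words_letter by metis
        then show ?thesis
          using w Nil c m_closed[of v] s_mult(1)[OF c, of x]
          by (simp add: j_smult T_j V.smult_assoc1[symmetric] IA_iff words_Cons del: letter_simps)
      next
        case False
        then show ?thesis
          using Nil m_smult[OF c w] isl_letter(3)[of c l] by (simp add: T_other del: letter_simps)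
      qed
    next
      case (Cons k u')
      have ul: "u' @ l # v \<in> words" using w Cons by (auto simp: words_Cons)
      show ?thesis
      proof (cases "isl k = side")
        case True
        then obtain x where "x \<in> IA" "k = j x" using side_j[of k] w Cons by (auto simp: words_Cons)
        then show ?thesis
          using Cons ul c m_smult[OF c ul] m_closed[OF ul] s_mult[OF c, of x]
          by (simp add: T_j V.smult_assoc1[symmetric] IA_iff del: letter_simps)
      next
        case False
        then show ?thesis using Cons m_smult[OF c w] by (simp add: T_other del: letter_simps)
      qed
    qed
  qed
  obtain h where h: "h \<in> lin_maps K R ?V" and hT: "\<And>w. w \<in> words \<Longrightarrow> h (word_class w) = T w"
    by (rule multilinear_extension[OF VK mult]) (rule that)
  have h_closed: "h r \<in> carrier V" if "r \<in> carrier R" for r using lin_maps_closed[OF h that] by simp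
  have h_zero: "h \<zero>\<^bsub>R\<^esub> = \<zero>\<^bsub>V\<^esub>"
    using lin_maps_zero[OF R.abelian_group_axioms left_module_abelian_group[OF VK] h] by simp
  \<comment> \<open>If the word starts in \<open>A\<close>, then \<open>x\<close> merges with its
    first letter and the claim is associativity of the action on \<open>V\<close>; otherwise
    \<open>x\<close> becomes the first letter and the claim is the definition of
    \<open>T\<close>.\<close>
  have h_letter_class: "h (letter_class x \<otimes>\<^bsub>R\<^esub> r) = x \<odot>\<^bsub>V\<^esub> h r" if x: "x \<in> IA" and r: "r \<in> carrier R" for x r
    using r
  proof (induction r rule: R_induct)
    note lx = letter_class_closed[OF x] and xc = x[unfolded IA_iff, THEN conjunct1]
    {
      case zero
      show ?case using lx xc by (simp add: h_zero V.smult_r_zero)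
    next
      case (add r s)
      then show ?case using lx xc by (simp add: R.r_distr lin_maps_add[OF h] h_closed V.smult_r_distr)
    next
      case (word c w)
      have base: "h (letter_class x \<otimes>\<^bsub>R\<^esub> word_class w) = x \<odot>\<^bsub>V\<^esub> h (word_class w)"
      proof (cases "w \<noteq> [] \<and> isl (hd w) = side")
        case True
        then obtain l v where lv: "w = l # v" "isl l = side" by (cases w) auto
        then obtain y where y: "y \<in> IA" "l = j y" using side_j[of l] word(2) by (auto simp: words_Cons)
        have yv: "j y # v \<in> words" "v \<in> words" using word(2) lv y by (auto simp: words_Cons)
        note mg = word_class_merge[OF j_letter[OF x] yv(1)]
        show ?thesis
          using mg xc y yv m_closed[of v] by (simp add: letter_class_def lv(1) j_side j_mult hT T_j IA_iff V.smult_assoc1 del: letter_simps)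
      next
        case False
        then have xw: "j x # w \<in> words" using word(2) j_letter[OF x] by (auto simp: words_Cons j_side)
        have "h (word_class (j x # w)) = x \<odot>\<^bsub>V\<^esub> m w" by (simp add: hT[OF xw] T_j)
        moreover have "h (word_class w) = m w" using hT[OF word(2)] False by (auto simp: T_other)
        ultimately show ?thesis using word_class_Cons[OF xw] by (simp add: letter_class_def)
      qed
      have cwc: "word_class w \<in> carrier R" using word by (simp add: word_class_closed)
      show ?case
        using word cwc lx xc base s_mult[OF word(1) xc] h_closed[OF cwc]
        by (simp add: smult_mult lin_maps_smult[OF h] V.smult_assoc1[symmetric])
    }
  qed
  have "h \<in> lin_maps A (restrict_scalars incl (regular_module R)) V"
  proof (rule lin_mapsI)
    show "h \<in> carrier (restrict_scalars incl (regular_module R)) \<rightarrow>\<^sub>E carrier V"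
      using h by (auto simp: lin_maps_def)
  next
    fix a r assume a: "a \<in> carrier A" and "r \<in> carrier (restrict_scalars incl (regular_module R))"
    then have r: "r \<in> carrier R" by simp
    have ac: "\<alpha> a \<in> carrier K" using a by (simp add: \<alpha>_hom)
    have pc: "aug_part a \<in> carrier A" using aug_part_IA[OF a] by (simp add: IA_iff)
    have "h (incl a \<otimes>\<^bsub>R\<^esub> r) = h (letter_class (aug_part a) \<otimes>\<^bsub>R\<^esub> r \<oplus>\<^bsub>R\<^esub> \<alpha> a \<odot>\<^bsub>R\<^esub> r)"
      using r ac letter_class_closed[OF aug_part_IA[OF a]]
      by (simp add: incl_def R.l_distr scalar_closed scalar_mult)
    also have "\<dots> = aug_part a \<odot>\<^bsub>V\<^esub> h r \<oplus>\<^bsub>V\<^esub> ?s (\<alpha> a) \<odot>\<^bsub>V\<^esub> h r"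
      using r ac letter_class_closed[OF aug_part_IA[OF a]]
      by (simp add: lin_maps_add[OF h] lin_maps_smult[OF h] RK.smult_closed h_letter_class[OF aug_part_IA[OF a]])
    also have "\<dots> = (aug_part a \<oplus>\<^bsub>A\<^esub> ?s (\<alpha> a)) \<odot>\<^bsub>V\<^esub> h r"
      using ac pc h_closed[OF r] by (simp add: V.smult_l_distr)
    also have "\<dots> = a \<odot>\<^bsub>V\<^esub> h r" using aug_part_split[OF a] by simp
    finally show "h (a \<odot>\<^bsub>restrict_scalars incl (regular_module R)\<^esub> r) = a \<odot>\<^bsub>V\<^esub> h r" by simp
  qed (use lin_maps_add[OF h] in auto)
  moreover have "(r, h r) \<in> \<rho>" if "r \<in> carrier R" for r
    using that
  proof (induction r rule: R_induct)
    case zero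
    show ?case using \<rho>D(3) by (simp add: h_zero)
  next
    case (add r s)
    then show ?case using \<rho>D(4)[of r "h r" s "h s"] by (simp add: lin_maps_add[OF h])
  next
    case (word c w)
    \<comment> \<open>For a word that starts in \<open>A\<close>, the pair is the first letter times
      the pair of the remaining word, and \<open>\<rho>\<close> is linear over
      \<open>A\<close>.\<close>
    have "(word_class w, T w) \<in> \<rho>"
    proof (cases "w \<noteq> [] \<and> isl (hd w) = side")
      case True
      then obtain l v where lv: "w = l # v" "isl l = side" by (cases w) auto
      then obtain y where y: "y \<in> IA" "l = j y" using side_j[of l] word(2) by (auto simp: words_Cons)
      have yv: "j y # v \<in> words" "v \<in> words" using word(2) lv y by (auto simp: words_Cons)
      have "(word_class v, m v) \<in> \<rho>" using \<sigma>(2)[OF word_class_closed[OF yv(2)]] by (simp add: m_def)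
      then have "(incl y \<otimes>\<^bsub>R\<^esub> word_class v, y \<odot>\<^bsub>V\<^esub> m v) \<in> \<rho>" using \<rho>D(5) y(1) IA_iff by blast
      then show ?thesis using word_class_Cons[OF yv(1)] by (simp add: lv y T_j incl_IA[OF y(1)] letter_class_def)
    next
      case False
      then show ?thesis using \<sigma>(2)[OF word_class_closed[OF word(2)]] by (auto simp: T_other m_def)
    qed
    then have "(c \<odot>\<^bsub>R\<^esub> word_class w, c \<odot>\<^bsub>?V\<^esub> T w) \<in> \<rho>" by (rule lin_relD(5)[OF \<rho>K word(1)])
    then show ?case using word by (simp add: lin_maps_smult[OF h] word_class_closed hT)
  qed
  ultimately show "\<exists>f\<in>lin_maps A (restrict_scalars incl (regular_module R)) V.
      \<forall>x\<in>carrier (restrict_scalars incl (regular_module R)). (x, f x) \<in> \<rho>" by auto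
qed

end

section \<open>Restriction to a factor\<close>

lemma ext_restriction_exists:
  assumes T: "ext_resolution K R \<delta> S" and A: "ext_resolution K A \<epsilon> P" and \<iota>: "\<iota> \<in> ring_hom A R"
    and aug: "\<And>a. a \<in> carrier A \<Longrightarrow> \<delta> (\<iota> a) = \<epsilon> a"
  obtains \<phi> where "ext_restriction K R \<delta> S A \<epsilon> P \<iota> \<phi>"
proof -
  interpret T: ext_resolution K R \<delta> S by fact
  interpret A: ext_resolution K A \<epsilon> P by fact
  have "exact_resolution A (aug_module K \<epsilon>) (restrict_complex \<iota> S)"
    by (rule restrict_exact_resolution[OF T.exact A.A.ring_axioms \<iota> aug])
  then interpret c: comparison A "ob P" "bd P" "aug_module K \<epsilon>" "restrict_complex \<iota> S"
    using A.shifted_comparison[OF A.base_group, of _ 0] by simp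
  obtain \<phi> where \<phi>: "c.chain_map \<phi>"
    and \<phi>0: "\<And>x. x \<in> carrier (ob P 0) \<Longrightarrow> to_base (restrict_complex \<iota> S) (\<phi> 0 x) = to_base P x"
    by (rule c.chain_map_exists[OF A.to_base_linear exact_resolutionD(7)[OF A.exact]]) (assumption | rule that)+
  have "ext_restriction K R \<delta> S A \<epsilon> P \<iota> \<phi>"
    by (intro ext_restriction.intro ext_restriction_axioms.intro T A \<iota> aug)
      (use c.chain_mapD[OF \<phi>] \<phi>0 in auto)
  then show thesis by (rule that)
qed

context coprod_factor
begin

text \<open>\<open>A\<close> is the sum of \<open>IA\<close> and the scalars, so linearity into
  \<open>K\<close> over the factor amounts to linearity over \<open>K\<close> together with
  vanishing on \<open>IA U\<close>.\<close>

lemma factor_linearI: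
  assumes U: "left_module R U"
    and f: "f \<in> carrier U \<rightarrow>\<^sub>E carrier K"
    and add: "\<And>x y. \<lbrakk>x \<in> carrier U; y \<in> carrier U\<rbrakk> \<Longrightarrow> f (x \<oplus>\<^bsub>U\<^esub> y) = f x \<oplus>\<^bsub>K\<^esub> f y"
    and scalar: "\<And>c x. \<lbrakk>c \<in> carrier K; x \<in> carrier U\<rbrakk> \<Longrightarrow> f (scalar c \<odot>\<^bsub>U\<^esub> x) = c \<otimes>\<^bsub>K\<^esub> f x"
    and letter_class: "\<And>l x. \<lbrakk>l \<in> letters; isl l = side; x \<in> carrier U\<rbrakk> \<Longrightarrow> f (word_class [l] \<odot>\<^bsub>U\<^esub> x) = \<zero>\<^bsub>K\<^esub>"
  shows "f \<in> lin_maps A (restrict_scalars incl U) (aug_module K \<alpha>)"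
proof (rule lin_mapsI)
  interpret U: left_module R U by fact
  fix a x assume a: "a \<in> carrier A" and "x \<in> carrier (restrict_scalars incl U)"
  then have x: "x \<in> carrier U" by simp
  note p = aug_part_IA[OF a]
  have "f (incl a \<odot>\<^bsub>U\<^esub> x) = f (letter_class (aug_part a) \<odot>\<^bsub>U\<^esub> x \<oplus>\<^bsub>U\<^esub> scalar (\<alpha> a) \<odot>\<^bsub>U\<^esub> x)"
    using letter_class_closed[OF p] a x by (simp add: incl_def U.smult_l_distr scalar_closed \<alpha>_hom)
  also have "\<dots> = f (letter_class (aug_part a) \<odot>\<^bsub>U\<^esub> x) \<oplus>\<^bsub>K\<^esub> \<alpha> a \<otimes>\<^bsub>K\<^esub> f x"
    using letter_class_closed[OF p] a x by (simp add: add scalar U.smult_closed scalar_closed \<alpha>_hom)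
  also have "f (letter_class (aug_part a) \<odot>\<^bsub>U\<^esub> x) = \<zero>\<^bsub>K\<^esub>"
    unfolding letter_class_def using letter_class[OF j_letter[OF p] j_side x] .
  finally show "f (a \<odot>\<^bsub>restrict_scalars incl U\<^esub> x) = a \<odot>\<^bsub>aug_module K \<alpha>\<^esub> f x"
    using a x PiE_mem[OF f x] by (simp add: \<alpha>_hom)
qed (use f add in auto)

lemma factor_linear_scalar:
  assumes "f \<in> lin_maps A (restrict_scalars incl U) (aug_module K \<alpha>)"
  shows "f \<in> lin_maps K (restrict_scalars scalar U) (aug_module K (\<lambda>c. c))"
proof (rule lin_mapsI)
  fix c x assume c: "c \<in> carrier K" and "x \<in> carrier (restrict_scalars scalar U)"
  then show "f (c \<odot>\<^bsub>restrict_scalars scalar U\<^esub> x) = c \<odot>\<^bsub>aug_module K (\<lambda>c. c)\<^esub> f x"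
    using lin_maps_smult[OF assms, of "c \<odot>\<^bsub>A\<^esub> \<one>\<^bsub>A\<^esub>" x] by (simp add: incl_scalar \<alpha>_hom)
qed (use assms in \<open>auto simp: lin_maps_def\<close>)

end

section \<open>Linear maps from modules over the coproduct to the field\<close>

locale coprod_resolution = coprod K \<Lambda> \<epsilon> \<Gamma> \<eta>
  for K :: "('k, 'r) ring_scheme" and \<Lambda> :: "('k, 'a, 'c) module_scheme" and \<epsilon> :: "'a \<Rightarrow> 'k"
    and \<Gamma> :: "('k, 'b, 'd) module_scheme" and \<eta> :: "'b \<Rightarrow> 'k" +
  fixes S :: "((('a + 'b) list \<Rightarrow> 'k) set, 's, 'k) augmented_complex"
  assumes S_resolution: "projective_resolution R (aug_module K aug_coprod_aug) S"
begin

sublocale L: coprod_factor K \<Lambda> \<epsilon> \<Gamma> \<eta> \<Lambda> \<epsilon> Inl True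
  by unfold_locales auto

sublocale G': coprod_factor K \<Lambda> \<epsilon> \<Gamma> \<eta> \<Gamma> \<eta> Inr False
  by unfold_locales auto

text \<open>The augmentation is multiplicative because \<open>K\<close> is a quotient of the \<open>R\<close>-module \<open>S\<^sub>0\<close>.\<close>

lemma aug_hom: "aug_coprod_aug \<in> ring_hom R K"
proof (rule ring_hom_memI)
  note e = projective_resolution_exact[OF S_resolution]
  interpret S0: left_module R "ob S 0" by (rule exact_resolutionD(1)[OF e])
  note t = exact_resolutionD(3)[OF e]
  have "\<one>\<^bsub>K\<^esub> \<in> to_base S ` carrier (ob S 0)" using exact_resolutionD(8)[OF e] by simp
  then obtain y where y: "y \<in> carrier (ob S 0)" "to_base S y = \<one>\<^bsub>K\<^esub>" by auto
  have a: "to_base S (r \<odot>\<^bsub>ob S 0\<^esub> y) = aug_coprod_aug r" if "r \<in> carrier R" for r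
    using lin_maps_smult[OF t that y(1)] y aug_closed[OF that] by simp
  fix r s assume rs: "r \<in> carrier R" "s \<in> carrier R"
  have "aug_coprod_aug (r \<otimes>\<^bsub>R\<^esub> s) = to_base S (r \<odot>\<^bsub>ob S 0\<^esub> (s \<odot>\<^bsub>ob S 0\<^esub> y))"
    using a[of "r \<otimes>\<^bsub>R\<^esub> s"] rs y by (simp add: S0.smult_assoc1)
  also have "\<dots> = aug_coprod_aug r \<otimes>\<^bsub>K\<^esub> aug_coprod_aug s"
    using lin_maps_smult[OF t rs(1) S0.smult_closed[OF rs(2) y(1)]] a[OF rs(2)] by simp
  finally show "aug_coprod_aug (r \<otimes>\<^bsub>R\<^esub> s) = aug_coprod_aug r \<otimes>\<^bsub>K\<^esub> aug_coprod_aug s" .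
next
  show "aug_coprod_aug \<one>\<^bsub>R\<^esub> = \<one>\<^bsub>K\<^esub>" by (simp add: R_one aug_cw words_Nil)
qed (auto intro: aug_closed aug_add)

sublocale T: ext_resolution K R aug_coprod_aug S
proof
  show "aug_coprod_aug ` carrier R = carrier K"
    using aug_closed aug_scalar scalar_closed by (auto simp: image_iff) metis
qed (rule aug_hom S_resolution)+

abbreviation "lin\<Lambda> U \<equiv> lin_maps \<Lambda> (restrict_scalars L.incl U) (aug_module K \<epsilon>)"
abbreviation "lin\<Gamma> U \<equiv> lin_maps \<Gamma> (restrict_scalars G'.incl U) (aug_module K \<eta>)"
abbreviation "linK U \<equiv> lin_maps K (restrict_scalars scalar U) (aug_module K (\<lambda>c. c))"

lemma letter_cases:
  assumes "l \<in> letters"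
  obtains x where "x \<in> I\<Lambda>" "l = Inl x" "word_class [l] = L.incl x"
    | y where "y \<in> I\<Gamma>" "l = Inr y" "word_class [l] = G'.incl y"
  using assms L.incl_IA G'.incl_IA by (auto simp: L.letter_class_def G'.letter_class_def)

text \<open>Every letter comes from one of the factors and has augmentation zero there, so
  \<open>f\<close> kills all multiples by letters. A nonempty word starts with a letter, hence
  \<open>f\<close> kills its multiples too, which is what the augmentation demands.\<close>

lemma linear_if_both:
  assumes U: "left_module R U" and fL: "f \<in> lin\<Lambda> U" and fG: "f \<in> lin\<Gamma> U"
  shows "f \<in> lin_maps R U (aug_module K aug_coprod_aug)"
proof (rule lin_mapsI)
  interpret U: left_module R U by fact
  have fc: "f x \<in> carrier K" if "x \<in> carrier U" for x using lin_maps_closed[OF fL] that by simp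
  have fadd: "f (x \<oplus>\<^bsub>U\<^esub> y) = f x \<oplus>\<^bsub>K\<^esub> f y" if "x \<in> carrier U" "y \<in> carrier U" for x y
    using lin_maps_add[OF fL] that by simp
  have f0: "f \<zero>\<^bsub>U\<^esub> = \<zero>\<^bsub>K\<^esub>"
    by (rule additive_zero[OF U.M.abelian_group_axioms K.abelian_group_axioms]) (auto simp: fc fadd simp del: U.M.l_zero U.M.r_zero)
  have fs: "f (scalar c \<odot>\<^bsub>U\<^esub> x) = c \<otimes>\<^bsub>K\<^esub> f x" if "c \<in> carrier K" "x \<in> carrier U" for c x
    using lin_maps_smult[OF L.factor_linear_scalar[OF fL] that(1)] that(2) by simp
  have fl: "f (word_class [l] \<odot>\<^bsub>U\<^esub> x) = \<zero>\<^bsub>K\<^esub>" if "l \<in> letters" "x \<in> carrier U" for l x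
    using that(1)
  proof (cases rule: letter_cases)
    case (1 y)
    then show ?thesis using lin_maps_smult[OF fL, of y x] that fc by (simp add: L.IA_iff)
  next
    case (2 y)
    then show ?thesis using lin_maps_smult[OF fG, of y x] that fc by (simp add: G'.IA_iff)
  qed
  have fw: "f (word_class w \<odot>\<^bsub>U\<^esub> x) = (if w = [] then f x else \<zero>\<^bsub>K\<^esub>)" if "w \<in> words" "x \<in> carrier U" for w x
  proof (cases w)
    case Nil
    then show ?thesis using that by (simp add: R_one[symmetric] U.smult_one)
  next
    case (Cons l v)
    have l: "l \<in> letters" "v \<in> words" "[l] \<in> words" using that(1) by (auto simp: Cons words_Cons words_Nil)
    have "f (word_class w \<odot>\<^bsub>U\<^esub> x) = f (word_class [l] \<odot>\<^bsub>U\<^esub> (word_class v \<odot>\<^bsub>U\<^esub> x))"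
      using word_class_Cons[of l v] that l by (simp add: Cons U.smult_assoc1 word_class_closed)
    then show ?thesis using fl[OF l(1)] l that by (simp add: Cons U.smult_closed word_class_closed)
  qed
  show "f (r \<odot>\<^bsub>U\<^esub> x) = r \<odot>\<^bsub>aug_module K aug_coprod_aug\<^esub> f x" if "r \<in> carrier R" and x: "x \<in> carrier U" for r x
    using that(1)
  proof (induction r rule: R_induct)
    case zero
    show ?case
      using x fc[OF x] aug_scalar[of "\<zero>\<^bsub>K\<^esub>"]
      by (simp add: U.smult_l_zero f0 scalar_def RK.smult_l_zero)
  next
    case (add r s)
    then show ?case using x fc by (simp add: U.smult_l_distr U.smult_closed fadd aug_add aug_closed K.l_distr)
  next
    case (word c w)
    have cwc: "word_class w \<in> carrier R" using word by (simp add: word_class_closed)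
    have "f ((c \<odot>\<^bsub>R\<^esub> word_class w) \<odot>\<^bsub>U\<^esub> x) = f (scalar c \<odot>\<^bsub>U\<^esub> (word_class w \<odot>\<^bsub>U\<^esub> x))"
      using word cwc x by (simp add: scalar_mult(1)[symmetric] U.smult_assoc1 scalar_closed)
    also have "\<dots> = c \<otimes>\<^bsub>K\<^esub> f (word_class w \<odot>\<^bsub>U\<^esub> x)" using word cwc x by (simp add: fs U.smult_closed)
    also have "\<dots> = aug_coprod_aug (c \<odot>\<^bsub>R\<^esub> word_class w) \<otimes>\<^bsub>K\<^esub> f x"
      using word cwc x fc[OF x] fw[OF word(2) x] by (simp add: aug_smult aug_cw)
    finally show ?case by simp
  qed
qed (use lin_maps_closed[OF fL] lin_maps_add[OF fL] fL in \<open>auto simp: lin_maps_def\<close>)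

text \<open>Composing with the projection of \<open>R\<close> onto the words that start in \<open>\<Lambda>\<close> kills \<open>I(\<Gamma>)U\<close> and
  changes nothing on \<open>I(\<Lambda>)U\<close>.\<close>

lemma linear_split:
  assumes U: "projective_module R U" and h: "h \<in> linK U"
  obtains f g where "f \<in> lin\<Lambda> U" "g \<in> lin\<Gamma> U" "\<And>x. x \<in> carrier U \<Longrightarrow> h x = f x \<oplus>\<^bsub>K\<^esub> g x"
proof -
  interpret U: left_module R U using U by (simp add: projective_module_def)
  obtain s where s: "s \<in> lin_maps R U (free_module R (carrier U))"
    and sum: "\<And>u. u \<in> carrier U \<Longrightarrow> supp_sum R U (\<lambda>x r. r \<odot>\<^bsub>U\<^esub> x) (s u) = u"
    by (rule projective_module_section[OF U]) (rule that)
  obtain \<pi> where \<pi>: "\<pi> \<in> lin_maps K R R"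
    and \<pi>l: "\<And>l r. \<lbrakk>l \<in> letters; r \<in> carrier R\<rbrakk> \<Longrightarrow>
      \<pi> (word_class [l] \<otimes>\<^bsub>R\<^esub> r) = (if isl l then word_class [l] \<otimes>\<^bsub>R\<^esub> r else \<zero>\<^bsub>R\<^esub>)"
    by (rule left_projection) (rule that)
  note \<pi>c = lin_maps_closed[OF \<pi>]
  let ?H = "\<lambda>x r. \<pi> r \<odot>\<^bsub>U\<^esub> x"
  interpret H: supp_sum_setup R U "carrier U" ?H
    by unfold_locales (auto simp: \<pi>c U.smult_closed lin_maps_add[OF \<pi>] U.smult_l_distr)
  \<comment> \<open>Transports \<open>\<pi>\<close> from \<open>R\<close> to \<open>U\<close>: along
    the section into a free module, there coefficient by coefficient, and back.\<close>
  define p where "p u = supp_sum R U ?H (s u)" for u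
  have sc: "s u \<in> carrier (free_module R (carrier U))" if "u \<in> carrier U" for u
    using lin_maps_closed[OF s that] .
  have sx: "s u x \<in> carrier R" if "u \<in> carrier U" for u x
    using sc[OF that] by (simp add: free_module_carrier_iff)
  have p_closed: "p u \<in> carrier U" if "u \<in> carrier U" for u
    unfolding p_def by (rule H.supp_sum_closed[OF sc[OF that]])
  have p_add: "p (u \<oplus>\<^bsub>U\<^esub> v) = p u \<oplus>\<^bsub>U\<^esub> p v" if "u \<in> carrier U" "v \<in> carrier U" for u v
    unfolding p_def lin_maps_add[OF s that] by (rule H.supp_sum_add) (use that sc in auto)
  have p_scalar: "p (scalar c \<odot>\<^bsub>U\<^esub> u) = scalar c \<odot>\<^bsub>U\<^esub> p u" if c: "c \<in> carrier K" and u: "u \<in> carrier U" for c u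
  proof -
    have "\<pi> (scalar c \<otimes>\<^bsub>R\<^esub> r) = scalar c \<otimes>\<^bsub>R\<^esub> \<pi> r" if "r \<in> carrier R" for r
      using c that by (simp add: scalar_mult lin_maps_smult[OF \<pi>] \<pi>c)
    then show ?thesis
      unfolding p_def lin_maps_smult[OF s scalar_closed[OF c] u]
      by (intro H.supp_sum_smult[OF scalar_closed[OF c] sc[OF u]])
        (use scalar_closed[OF c] in \<open>simp_all add: U.smult_closed U.smult_r_distr \<pi>c U.smult_assoc1\<close>)
  qed
  \<comment> \<open>By linearity of \<open>s\<close> all coefficients of the image of a multiple by
    \<open>l\<close> are left multiples of \<open>l\<close>, so \<open>\<pi>\<close> keeps every one
    of them or kills every one of them.\<close>
  have p_letter: "p (word_class [l] \<odot>\<^bsub>U\<^esub> u) = (if isl l then word_class [l] \<odot>\<^bsub>U\<^esub> u else \<zero>\<^bsub>U\<^esub>)"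
    if l: "l \<in> letters" and u: "u \<in> carrier U" for l u
  proof -
    have lc: "word_class [l] \<in> carrier R" using l by (intro word_class_closed) (simp add: words_Cons words_Nil)
    have lu: "word_class [l] \<odot>\<^bsub>U\<^esub> u \<in> carrier U" using lc u by (rule U.smult_closed)
    have slu: "s (word_class [l] \<odot>\<^bsub>U\<^esub> u) x = word_class [l] \<otimes>\<^bsub>R\<^esub> s u x" for x
      by (simp add: lin_maps_smult[OF s lc u])
    let ?X = "{x. s (word_class [l] \<odot>\<^bsub>U\<^esub> u) x \<noteq> \<zero>\<^bsub>R\<^esub>}"
    have X: "?X \<subseteq> carrier U" using sc[OF lu] by (auto simp: free_module_carrier_iff)
    show ?thesis
    proof (cases "isl l")
      case True
      have "p (word_class [l] \<odot>\<^bsub>U\<^esub> u) = supp_sum R U (\<lambda>x r. r \<odot>\<^bsub>U\<^esub> x) (s (word_class [l] \<odot>\<^bsub>U\<^esub> u))"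
        unfolding p_def supp_sum_def
        by (rule U.M.finsum_cong') (use True X sx[OF u] lc in \<open>auto simp: slu \<pi>l[OF l] U.smult_closed\<close>)
      then show ?thesis using sum[OF lu] True by simp
    next
      case False
      have "p (word_class [l] \<odot>\<^bsub>U\<^esub> u) = (\<Oplus>\<^bsub>U\<^esub>x\<in>?X. \<zero>\<^bsub>U\<^esub>)"
        unfolding p_def supp_sum_def
        by (rule U.M.finsum_cong') (use False X sx[OF u] lc in \<open>auto simp: slu \<pi>l[OF l] U.smult_l_zero\<close>)
      then show ?thesis using False by simp
    qed
  qed
  have hc: "h x \<in> carrier K" if "x \<in> carrier U" for x using lin_maps_closed[OF h] that by simp
  have hadd: "h (x \<oplus>\<^bsub>U\<^esub> y) = h x \<oplus>\<^bsub>K\<^esub> h y" if "x \<in> carrier U" "y \<in> carrier U" for x y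
    using lin_maps_add[OF h] that by simp
  have hs: "h (scalar c \<odot>\<^bsub>U\<^esub> x) = c \<otimes>\<^bsub>K\<^esub> h x" if "c \<in> carrier K" "x \<in> carrier U" for c x
    using lin_maps_smult[OF h] that by simp
  have h0: "h \<zero>\<^bsub>U\<^esub> = \<zero>\<^bsub>K\<^esub>"
    by (rule additive_zero[OF U.M.abelian_group_axioms K.abelian_group_axioms]) (auto simp: hc hadd simp del: U.M.l_zero U.M.r_zero)
  have cwU: "word_class [l] \<odot>\<^bsub>U\<^esub> x \<in> carrier U" if "l \<in> letters" "x \<in> carrier U" for l x
    using that by (intro U.smult_closed word_class_closed) (simp_all add: words_Cons words_Nil)
  define g where "g = (\<lambda>x\<in>carrier U. h (p x))"
  define f where "f = (\<lambda>x\<in>carrier U. h x \<ominus>\<^bsub>K\<^esub> h (p x))"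
  have g: "g \<in> lin\<Gamma> U"
    by (rule G'.factor_linearI[OF U.left_module_axioms])
      (auto simp: g_def hc p_closed p_add hadd hs p_scalar U.smult_closed scalar_closed cwU p_letter h0)
  have f: "f \<in> lin\<Lambda> U"
  proof (rule L.factor_linearI[OF U.left_module_axioms])
    show "f (x \<oplus>\<^bsub>U\<^esub> y) = f x \<oplus>\<^bsub>K\<^esub> f y" if "x \<in> carrier U" "y \<in> carrier U" for x y
      using that by (simp add: f_def hc p_closed p_add hadd K.add_minus_add)
    show "f (scalar c \<odot>\<^bsub>U\<^esub> x) = c \<otimes>\<^bsub>K\<^esub> f x" if "c \<in> carrier K" "x \<in> carrier U" for c x
      using that by (simp add: f_def hc p_closed p_scalar hs U.smult_closed scalar_closed K.minus_eq K.r_distr K.r_minus)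
    show "f (word_class [l] \<odot>\<^bsub>U\<^esub> x) = \<zero>\<^bsub>K\<^esub>" if "l \<in> letters" "isl l = True" "x \<in> carrier U" for l x
      using that cwU[OF that(1,3)] by (simp add: f_def p_letter hc K.minus_eq K.r_neg)
  qed (auto simp: f_def hc p_closed)
  have "h x = f x \<oplus>\<^bsub>K\<^esub> g x" if "x \<in> carrier U" for x
    using that by (simp add: f_def g_def hc p_closed K.minus_add_cancel)
  with f g show thesis by (rule that)
qed

section \<open>The complex of maps that are linear over the field\<close>

abbreviation "SK \<equiv> restrict_complex scalar S"

lemma SK_exact: "exact_resolution K (aug_module K (\<lambda>c. c)) SK"
  by (rule restrict_exact_resolution[OF T.exact K.ring_axioms scalar_hom aug_scalar])

text \<open>Choose \<open>y\<close> with \<open>to_base S y\<close> equal to one and let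
  \<open>q\<close> send \<open>x\<close> to \<open>to_base S x\<close> times \<open>y\<close>. The
  chain map \<open>G\<close>, which is the identity minus \<open>q\<close> in degree 0 and the
  identity above, lifts zero, so it is null homotopic over the field. For a cocycle \<open>f\<close>
  of positive degree, \<open>f\<close> itself becomes a coboundary; in degree 0 it follows that
  \<open>f = f q\<close>, a multiple of \<open>to_base S\<close>.\<close>

lemma K_exact:
  assumes f: "f \<in> linK (ob S n)" and fd: "\<And>x. x \<in> carrier (ob S (Suc n)) \<Longrightarrow> f (bd S n x) = \<zero>\<^bsub>K\<^esub>"
  shows "n = 0 \<Longrightarrow> \<exists>c\<in>carrier K. \<forall>x\<in>carrier (ob S 0). f x = c \<otimes>\<^bsub>K\<^esub> to_base S x"
    and "n = Suc k \<Longrightarrow> \<exists>u\<in>linK (ob S k). \<forall>x\<in>carrier (ob S n). f x = u (bd S k x)"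
proof -
  let ?N = "aug_module K (\<lambda>c. c)"
  note e = exact_resolutionD[OF SK_exact]
  have N: "left_module K ?N" by (rule aug_module_left_module) (auto simp: K.field_axioms K.ring_axioms ring_hom_def)
  note Ng = left_module_abelian_group[OF N]
  \<comment> \<open>The restricted resolution is compared with itself; the lifting property is the
    one that vector spaces have.\<close>
  interpret c: comparison K "ob SK" "bd SK" ?N SK
    by (rule comparison.intro)
      (use e(1,2,5) Ng SK_exact vector_space_selections[OF K.field_axioms e(1,1)] in auto)
  have "\<one>\<^bsub>K\<^esub> \<in> to_base S ` carrier (ob S 0)" using exact_resolutionD(8)[OF T.exact] by simp
  then obtain y where y: "y \<in> carrier (ob S 0)" "to_base S y = \<one>\<^bsub>K\<^esub>" by auto
  interpret S0: left_module R "ob S 0" by (rule T.P_module)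
  have tb: "to_base S x \<in> carrier K" if "x \<in> carrier (ob S 0)" for x
    using lin_maps_closed[OF T.to_base_linear that] by simp
  define q where "q = (\<lambda>x\<in>carrier (ob S 0). scalar (to_base S x) \<odot>\<^bsub>ob S 0\<^esub> y)"
  have q: "q \<in> lin_maps K (ob SK 0) (ob SK 0)"
    by (rule lin_mapsI)
      (use y tb lin_maps_add[OF e(3)] lin_maps_smult[OF e(3)] in
        \<open>auto simp: q_def S0.smult_closed scalar_closed ring_hom_add[OF scalar_hom] ring_hom_mult[OF scalar_hom]
          S0.smult_l_distr S0.smult_assoc1\<close>)
  have id: "(\<lambda>x\<in>carrier (ob SK i). x) \<in> lin_maps K (ob SK i) (ob SK i)" for i
  proof -
    interpret Si: left_module K "ob SK i" by (rule e(1))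
    show ?thesis by (rule lin_mapsI) (use Si.smult_closed Si.M.a_closed in auto)
  qed
  define G where "G i = (if i = 0 then \<lambda>x\<in>carrier (ob SK 0). (\<lambda>x\<in>carrier (ob SK 0). x) x \<ominus>\<^bsub>ob SK 0\<^esub> q x
    else (\<lambda>x\<in>carrier (ob SK i). x))" for i
  interpret SK0: left_module K "ob SK 0" by (rule e(1))
  have G0: "G 0 x = x \<ominus>\<^bsub>ob SK 0\<^esub> q x" if "x \<in> carrier (ob S 0)" for x using that by (simp add: G_def)
  have qc: "q x \<in> carrier (ob SK 0)" if "x \<in> carrier (ob S 0)" for x using lin_maps_closed[OF q] that by simp
  have chain: "c.chain_map G"
    unfolding c.chain_map_def
  proof (intro conjI allI ballI)
    show "G i \<in> lin_maps K (ob SK i) (ob SK i)" for i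
      using lin_maps_diff[OF e(1,1) id q] id[of i] by (auto simp: G_def)
    fix i x assume x: "x \<in> carrier (ob SK (Suc i))"
    show "bd SK i (G (Suc i) x) = G i (bd SK i x)"
    proof (cases i)
      case 0
      have b: "bd S 0 x \<in> carrier (ob S 0)" using x 0 by (simp add: T.bd_closed)
      have "q (bd S 0 x) = \<zero>\<^bsub>ob S 0\<^esub>"
        using x 0 b exact_resolutionD(7)[OF T.exact, of x] y
        by (simp add: q_def ring_hom_closed scalar_def RK.smult_l_zero S0.smult_l_zero)
      then have "G 0 (bd S 0 x) = bd S 0 x"
        using b SK0.M.minus_eq_iff[of "bd S 0 x" "\<zero>\<^bsub>ob SK 0\<^esub>" "bd S 0 x"] SK0.M.r_zero SK0.M.zero_closed
        by (simp add: G0)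
      then show ?thesis using x 0 by (simp add: G_def)
    next
      case (Suc m)
      then show ?thesis using x by (simp add: G_def T.bd_closed)
    qed
  qed
  have base: "to_base SK (G 0 x) = \<zero>\<^bsub>?N\<^esub>" if "x \<in> carrier (ob SK 0)" for x
  proof -
    have x: "x \<in> carrier (ob S 0)" using that by simp
    have "to_base S (q x) = to_base S x"
      using lin_maps_smult[OF T.to_base_linear scalar_closed[OF tb[OF x]] y(1)] x y tb[OF x]
      by (simp add: q_def aug_scalar)
    then have "to_base S (G 0 x) = to_base S x \<ominus>\<^bsub>?N\<^esub> to_base S x"
      using lin_maps_minus[OF SK0.M.abelian_group_axioms Ng e(3) _ qc[OF x], of x] x by (simp add: G0)
    then show ?thesis
      using abelian_group.minus_eq_zero_iff[OF Ng, of "to_base S x" "to_base S x"] tb[OF x] by simp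
  qed
  have f': "f \<in> lin_maps K (ob SK n) ?N" using f by simp
  have fd': "f (bd SK n x) = \<zero>\<^bsub>?N\<^esub>" if "x \<in> carrier (ob SK (Suc n))" for x using fd that by simp
  note null = c.null_coboundary[OF chain base Ng f' fd']
  have fc: "f x \<in> carrier K" if "x \<in> carrier (ob S n)" for x using lin_maps_closed[OF f] that by simp
  show "\<exists>c\<in>carrier K. \<forall>x\<in>carrier (ob S 0). f x = c \<otimes>\<^bsub>K\<^esub> to_base S x" if n: "n = 0"
  proof (intro bexI ballI)
    show "f y \<in> carrier K" using fc y n by simp
    fix x assume x: "x \<in> carrier (ob S 0)"
    note f0 = f'[unfolded n]
    have "f (G 0 x) = \<zero>\<^bsub>?N\<^esub>" using null(1)[OF _ _ n, of x] x n by simp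
    moreover have "f (G 0 x) = f x \<ominus>\<^bsub>?N\<^esub> f (q x)"
      using lin_maps_minus[OF SK0.M.abelian_group_axioms Ng f0 _ qc[OF x], of x] x by (simp add: G0)
    ultimately have "f x = f (q x)"
      using abelian_group.minus_eq_zero_iff[OF Ng, of "f x" "f (q x)"] lin_maps_closed[OF f0] x qc[OF x] by simp
    then show "f x = f y \<otimes>\<^bsub>K\<^esub> to_base S x"
      using lin_maps_smult[OF f0 tb[OF x], of y] x y tb[OF x] fc n by (simp add: q_def K.m_comm)
  qed
  show "\<exists>u\<in>linK (ob S k). \<forall>x\<in>carrier (ob S n). f x = u (bd S k x)" if n: "n = Suc k"
    using null(2)[OF _ _ n] n by (auto simp: G_def)
qed

text \<open>Splitting the primitive \<open>u\<close> instead of \<open>d\<close> makes both parts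
  coboundaries of cochains that are linear over a factor, so correcting a cochain by one of them
  does not change its class.\<close>

lemma K_cocycle_split:
  assumes d: "d \<in> linK (ob S (Suc k))"
    and dd: "\<And>x. x \<in> carrier (ob S (Suc (Suc k))) \<Longrightarrow> d (bd S (Suc k) x) = \<zero>\<^bsub>K\<^esub>"
  obtains f g where "f \<in> lin\<Lambda> (ob S k)" "g \<in> lin\<Gamma> (ob S k)"
    "\<And>x. x \<in> carrier (ob S (Suc k)) \<Longrightarrow> d x = f (bd S k x) \<oplus>\<^bsub>K\<^esub> g (bd S k x)"
proof -
  obtain u where u: "u \<in> linK (ob S k)" "\<forall>x\<in>carrier (ob S (Suc k)). d x = u (bd S k x)"
    using K_exact(2)[OF d dd refl] by blast
  obtain f g where "f \<in> lin\<Lambda> (ob S k)" "g \<in> lin\<Gamma> (ob S k)"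
    "\<And>x. x \<in> carrier (ob S k) \<Longrightarrow> u x = f x \<oplus>\<^bsub>K\<^esub> g x"
    by (rule linear_split[OF T.P_projective u(1)]) (rule that)
  then show thesis using u(2) T.bd_closed by (intro that[of f g]) auto
qed

lemma aug_module_minus: "x \<ominus>\<^bsub>aug_module K \<alpha>\<^esub> y = x \<ominus>\<^bsub>K\<^esub> y"
  by (simp add: a_minus_def a_inv_def m_inv_def)

lemma linK_diff:
  assumes "a \<in> lin\<Lambda> (ob S n)" "b \<in> lin\<Gamma> (ob S n)"
  shows "(\<lambda>x\<in>carrier (ob S n). a x \<ominus>\<^bsub>K\<^esub> b x) \<in> linK (ob S n)"
proof -
  have "left_module K (aug_module K (\<lambda>c. c))"
    by (rule aug_module_left_module) (auto simp: K.field_axioms K.ring_axioms ring_hom_def)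
  then show ?thesis
    using lin_maps_diff[OF restrict_scalars_left_module[OF T.P_module K.ring_axioms scalar_hom] _
        L.factor_linear_scalar[OF assms(1)] G'.factor_linear_scalar[OF assms(2)]]
    by (simp add: aug_module_minus)
qed

lemma base_\<Lambda>: "left_module \<Lambda> (aug_module K \<epsilon>)" and base_\<Gamma>: "left_module \<Gamma> (aug_module K \<eta>)"
  by (rule aug_module_left_module[OF K.field_axioms A.A.ring_axioms A.aug_ring_hom]
      aug_module_left_module[OF K.field_axioms G.A.ring_axioms G.aug_ring_hom])+

lemma S_\<Lambda>: "left_module \<Lambda> (restrict_scalars L.incl (ob S n))"
  and S_\<Gamma>: "left_module \<Gamma> (restrict_scalars G'.incl (ob S n))"
  by (rule restrict_scalars_left_module[OF T.P_module A.A.ring_axioms L.incl_hom]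
      restrict_scalars_left_module[OF T.P_module G.A.ring_axioms G'.incl_hom])+

lemma lin\<Lambda>_bd: "f \<in> lin\<Lambda> (ob S k) \<Longrightarrow> compose (carrier (ob S (Suc k))) f (bd S k) \<in> lin\<Lambda> (ob S (Suc k))"
  and lin\<Gamma>_bd: "g \<in> lin\<Gamma> (ob S k) \<Longrightarrow> compose (carrier (ob S (Suc k))) g (bd S k) \<in> lin\<Gamma> (ob S (Suc k))"
  using lin_maps_compose[OF lin_maps_restrict_scalars[OF T.bd_linear L.incl_hom] _ S_\<Lambda>, of f k]
    lin_maps_compose[OF lin_maps_restrict_scalars[OF T.bd_linear G'.incl_hom] _ S_\<Gamma>, of g k] by simp_all

text \<open>\<open>a - b\<close> is a cocycle over \<open>K\<close>, hence of the form
  \<open>f bd + g bd\<close>. Then \<open>F = a - f bd = b + g bd\<close> is linear over both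
  factors. Agreement of \<open>a\<close> and \<open>b\<close> on boundaries is the common ground of
  the two uses: cocycles, which vanish there, and two primitives of one cochain.\<close>

lemma linear_maps_glue:
  assumes a: "a \<in> lin\<Lambda> (ob S (Suc k))" and b: "b \<in> lin\<Gamma> (ob S (Suc k))"
    and ab: "\<And>x. x \<in> carrier (ob S (Suc (Suc k))) \<Longrightarrow> a (bd S (Suc k) x) = b (bd S (Suc k) x)"
  obtains F f g where "F \<in> T.L (Suc k)" "f \<in> lin\<Lambda> (ob S k)" "g \<in> lin\<Gamma> (ob S k)"
    "\<And>x. x \<in> carrier (ob S (Suc k)) \<Longrightarrow> a x = f (bd S k x) \<oplus>\<^bsub>K\<^esub> F x"
    "\<And>x. x \<in> carrier (ob S (Suc k)) \<Longrightarrow> F x = g (bd S k x) \<oplus>\<^bsub>K\<^esub> b x"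
proof -
  let ?C = "carrier (ob S (Suc k))"
  have ac: "a x \<in> carrier K" "b x \<in> carrier K" if "x \<in> ?C" for x
    using lin_maps_closed[OF a] lin_maps_closed[OF b] that by auto
  define d where "d = (\<lambda>x\<in>?C. a x \<ominus>\<^bsub>K\<^esub> b x)"
  have d: "d \<in> linK (ob S (Suc k))" unfolding d_def by (rule linK_diff[OF a b])
  have dd: "d (bd S (Suc k) x) = \<zero>\<^bsub>K\<^esub>" if "x \<in> carrier (ob S (Suc (Suc k)))" for x
    using that ac T.bd_closed[OF that] by (simp add: d_def ab K.minus_eq K.r_neg)
  obtain f g where f: "f \<in> lin\<Lambda> (ob S k)" and g: "g \<in> lin\<Gamma> (ob S k)"
    and fg: "\<And>x. x \<in> ?C \<Longrightarrow> d x = f (bd S k x) \<oplus>\<^bsub>K\<^esub> g (bd S k x)"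
    by (rule K_cocycle_split[OF d dd]) (assumption | rule that)+
  have fc: "f (bd S k x) \<in> carrier K" "g (bd S k x) \<in> carrier K" if "x \<in> ?C" for x
    using lin_maps_closed[OF f] lin_maps_closed[OF g] T.bd_closed[OF that] by auto
  define F where "F = (\<lambda>x\<in>?C. a x \<ominus>\<^bsub>K\<^esub> f (bd S k x))"
  have aF: "a x = f (bd S k x) \<oplus>\<^bsub>K\<^esub> F x" if "x \<in> ?C" for x
    using that ac fc K.minus_add_cancel[of "a x" "f (bd S k x)"] by (simp add: F_def K.a_comm)
  have Fb: "F x = g (bd S k x) \<oplus>\<^bsub>K\<^esub> b x" if x: "x \<in> ?C" for x
  proof -
    have "a x = (f (bd S k x) \<oplus>\<^bsub>K\<^esub> g (bd S k x)) \<oplus>\<^bsub>K\<^esub> b x"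
      using fg[OF x] x ac[OF x] fc[OF x] K.minus_eq_iff[of "a x" "b x" "f (bd S k x) \<oplus>\<^bsub>K\<^esub> g (bd S k x)"]
      by (simp add: d_def)
    also have "\<dots> = (g (bd S k x) \<oplus>\<^bsub>K\<^esub> b x) \<oplus>\<^bsub>K\<^esub> f (bd S k x)"
      using ac[OF x] fc[OF x] by (simp add: K.a_ac)
    finally show ?thesis
      using x ac[OF x] fc[OF x] K.minus_eq_iff[of "a x" "f (bd S k x)" "g (bd S k x) \<oplus>\<^bsub>K\<^esub> b x"]
      by (simp add: F_def)
  qed
  have "F = (\<lambda>x\<in>?C. a x \<ominus>\<^bsub>aug_module K \<epsilon>\<^esub> compose ?C f (bd S k) x)"
    by (auto simp: F_def aug_module_minus compose_def)
  then have F\<Lambda>: "F \<in> lin\<Lambda> (ob S (Suc k))"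
    using lin_maps_diff[OF S_\<Lambda> base_\<Lambda> a lin\<Lambda>_bd[OF f]] by simp
  have "F = (\<lambda>x\<in>?C. compose ?C g (bd S k) x \<oplus>\<^bsub>aug_module K \<eta>\<^esub> b x)"
    using Fb by (auto simp: F_def compose_def)
  then have "F \<in> lin\<Gamma> (ob S (Suc k))"
    using lin_maps_sum[OF S_\<Gamma> base_\<Gamma> lin\<Gamma>_bd[OF g] b] by simp
  then have "F \<in> T.L (Suc k)" by (rule linear_if_both[OF T.P_module F\<Lambda>])
  then show thesis using f g aF Fb by (rule that)
qed

text \<open>The two primitives agree on boundaries. For \<open>k > 0\<close> they are glued to
  \<open>F\<close>, and \<open>a\<close> differs from \<open>F\<close> by \<open>f bd\<close>, which
  vanishes on boundaries. For \<open>k = 0\<close> there is no lower degree to correct in; but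
  \<open>a - b\<close> is then a multiple of \<open>to_base S\<close>, so \<open>a\<close> is
  already linear over both factors.\<close>

lemma coboundary_if_both:
  assumes e: "e \<in> T.L (Suc k)" and a: "a \<in> lin\<Lambda> (ob S k)" and b: "b \<in> lin\<Gamma> (ob S k)"
    and ea: "\<And>x. x \<in> carrier (ob S (Suc k)) \<Longrightarrow> e x = a (bd S k x)"
    and eb: "\<And>x. x \<in> carrier (ob S (Suc k)) \<Longrightarrow> e x = b (bd S k x)"
  shows "e \<in> T.B (Suc k)"
proof -
  have "\<exists>F\<in>T.L k. \<forall>x\<in>carrier (ob S (Suc k)). e x = F (bd S k x)"
  proof (cases k)
    case 0
    let ?C = "carrier (ob S 0)"
    have a0: "a \<in> lin\<Lambda> (ob S 0)" and b0: "b \<in> lin\<Gamma> (ob S 0)" using a b 0 by auto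
    have ac: "a x \<in> carrier K" "b x \<in> carrier K" if "x \<in> ?C" for x
      using lin_maps_closed[OF a0] lin_maps_closed[OF b0] that by auto
    define d where "d = (\<lambda>x\<in>?C. a x \<ominus>\<^bsub>K\<^esub> b x)"
    have d: "d \<in> linK (ob S 0)" unfolding d_def by (rule linK_diff[OF a0 b0])
    have "d (bd S 0 x) = \<zero>\<^bsub>K\<^esub>" if "x \<in> carrier (ob S (Suc 0))" for x
      using that ea[of x] eb[of x] ac T.bd_closed[OF that] 0 by (simp add: d_def K.minus_eq K.r_neg)
    then obtain c where c: "c \<in> carrier K" "\<forall>x\<in>?C. d x = c \<otimes>\<^bsub>K\<^esub> to_base S x"
      using K_exact(1)[OF d _ refl] by blast
    have "a x = T.const c x \<oplus>\<^bsub>K\<^esub> b x" if x: "x \<in> ?C" for x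
    proof -
      have "a x \<ominus>\<^bsub>K\<^esub> b x = T.const c x" using c(2) x by (simp add: d_def)
      then show ?thesis using K.minus_add_cancel[of "a x" "b x"] ac[OF x] by simp
    qed
    then have "a = (\<lambda>x\<in>?C. T.const c x \<oplus>\<^bsub>aug_module K \<eta>\<^esub> b x)"
      using a0 by (intro extensionalityI[of _ ?C]) (auto simp: lin_maps_def PiE_def)
    moreover have "T.const c \<in> lin\<Gamma> (ob S 0)"
      by (rule lin_maps_restrict_base[OF T.cocycleD(1)[OF T.const_cocycle[OF c(1)]] G'.incl_hom G'.aug_incl])
    ultimately have "a \<in> lin\<Gamma> (ob S 0)"
      using lin_maps_sum[OF S_\<Gamma> base_\<Gamma> _ b0, of "T.const c"] by simp
    then have "a \<in> T.L 0" by (rule linear_if_both[OF T.P_module a0])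
    then show ?thesis using ea 0 by auto
  next
    case (Suc j)
    have ab: "a (bd S k x) = b (bd S k x)" if "x \<in> carrier (ob S (Suc k))" for x using ea eb that by metis
    obtain F f where F: "F \<in> T.L k" and f: "f \<in> lin\<Lambda> (ob S j)"
      and aF: "\<And>x. x \<in> carrier (ob S k) \<Longrightarrow> a x = f (bd S j x) \<oplus>\<^bsub>K\<^esub> F x"
      using linear_maps_glue[OF a[unfolded Suc] b[unfolded Suc] ab[unfolded Suc]] unfolding Suc by metis
    have "e x = F (bd S k x)" if x: "x \<in> carrier (ob S (Suc k))" for x
    proof -
      have "bd S j (bd S k x) = \<zero>\<^bsub>ob S j\<^esub>"
        using exact_resolutionD(5)[OF T.exact] x unfolding Suc by simp
      moreover have "f \<zero>\<^bsub>ob S j\<^esub> = \<zero>\<^bsub>K\<^esub>"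
        using lin_maps_zero[OF left_module_abelian_group[OF S_\<Lambda>] left_module_abelian_group[OF base_\<Lambda>] f] by simp
      ultimately show ?thesis
        using ea[OF x] aF[OF T.bd_closed[OF x]] T.L_closed[OF F T.bd_closed[OF x]] by simp
    qed
    then show ?thesis using F by blast
  qed
  then show ?thesis using e unfolding T.coboundary_Suc_iff by blast
qed

lemma S_selections_\<Lambda>: "left_module \<Lambda> V \<Longrightarrow> selections \<Lambda> (restrict_scalars L.incl (ob S i)) V"
  by (rule projective_module_selections[OF T.P_projective A.A.ring_axioms L.incl_hom _ L.factor_selections])

lemma S_selections_\<Gamma>: "left_module \<Gamma> V \<Longrightarrow> selections \<Gamma> (restrict_scalars G'.incl (ob S i)) V"
  by (rule projective_module_selections[OF T.P_projective G.A.ring_axioms G'.incl_hom _ G'.factor_selections])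

text \<open>The map is the pair of restrictions. Compatibility with all operations is inherited from
  \<open>Res\<close>, which leaves bijectivity, proved degree by degree: by constants in degree 0,
  by glueing above.\<close>

lemma Ext_iso:
  assumes P: "projective_resolution \<Lambda> (aug_module K \<epsilon>) P" and Q: "projective_resolution \<Gamma> (aug_module K \<eta>) Q"
  shows "aug_algebra_isomorphic K
    (Ext_algebra K R aug_coprod_aug S) (Ext_aug K S)
    (aug_prod (Ext_algebra K \<Lambda> \<epsilon> P) (Ext_aug K P) (Ext_algebra K \<Gamma> \<eta> Q) (Ext_aug K Q))
    (aug_prod_aug (Ext_aug K P))"
proof -
  have surj: "\<epsilon> ` carrier \<Lambda> = carrier K" "\<eta> ` carrier \<Gamma> = carrier K"
  proof -
    have "\<epsilon> (c \<odot>\<^bsub>\<Lambda>\<^esub> \<one>\<^bsub>\<Lambda>\<^esub>) = c" "\<eta> (c \<odot>\<^bsub>\<Gamma>\<^esub> \<one>\<^bsub>\<Gamma>\<^esub>) = c" if "c \<in> carrier K" for c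
      using that by (simp_all add: L.\<alpha>_hom G'.\<alpha>_hom)
    then have "c \<in> \<epsilon> ` carrier \<Lambda>" "c \<in> \<eta> ` carrier \<Gamma>" if "c \<in> carrier K" for c
      using that A.smult_closed[OF that A.A.one_closed] G.smult_closed[OF that G.A.one_closed] by (metis imageI)+
    then show "\<epsilon> ` carrier \<Lambda> = carrier K" "\<eta> ` carrier \<Gamma> = carrier K"
      using L.\<alpha>_hom(1) G'.\<alpha>_hom(1) by blast+
  qed
  have EP: "ext_resolution K \<Lambda> \<epsilon> P"
    by (intro ext_resolution.intro ext_resolution_axioms.intro K.field_axioms A.A.ring_axioms A.aug_ring_hom surj P)
  have EQ: "ext_resolution K \<Gamma> \<eta> Q"
    by (intro ext_resolution.intro ext_resolution_axioms.intro K.field_axioms G.A.ring_axioms G.aug_ring_hom surj Q)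
  obtain \<phi> where "ext_restriction K R aug_coprod_aug S \<Lambda> \<epsilon> P L.incl \<phi>"
    by (rule ext_restriction_exists[OF T.ext_resolution_axioms EP L.incl_hom L.aug_incl]) (assumption | rule that)+
  then interpret XL: ext_restriction K R aug_coprod_aug S \<Lambda> \<epsilon> P L.incl \<phi> .
  obtain \<psi> where "ext_restriction K R aug_coprod_aug S \<Gamma> \<eta> Q G'.incl \<psi>"
    by (rule ext_restriction_exists[OF T.ext_resolution_axioms EQ G'.incl_hom G'.aug_incl]) (assumption | rule that)+
  then interpret XG: ext_restriction K R aug_coprod_aug S \<Gamma> \<eta> Q G'.incl \<psi> .

  have inj_pos: "f \<in> T.B (Suc k)"
    if f: "f \<in> T.Z (Suc k)" and fL: "XL.pull (Suc k) f \<in> XL.B (Suc k)" and fG: "XG.pull (Suc k) f \<in> XG.B (Suc k)" for k f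
  proof -
    note fz = T.cocycleD[OF f]
    obtain a where a: "a \<in> lin\<Lambda> (ob S k)" "\<And>x. x \<in> carrier (ob S (Suc k)) \<Longrightarrow> f x = a (bd S k x)"
      by (rule XL.pull_inj[OF S_selections_\<Lambda> S_selections_\<Lambda> XL.L_restrict_scalars[OF fz(1)] fz(2) fL])
        (assumption | simp only: restrict_complex_simps | rule that)+
    obtain b where b: "b \<in> lin\<Gamma> (ob S k)" "\<And>x. x \<in> carrier (ob S (Suc k)) \<Longrightarrow> f x = b (bd S k x)"
      by (rule XG.pull_inj[OF S_selections_\<Gamma> S_selections_\<Gamma> XG.L_restrict_scalars[OF fz(1)] fz(2) fG])
        (assumption | simp only: restrict_complex_simps | rule that)+
    show ?thesis by (rule coboundary_if_both[OF fz(1) a(1) b(1) a(2) b(2)])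
  qed
  have surj_pos: "\<exists>F\<in>T.Z (Suc k). XL.cls (Suc k) (XL.pull (Suc k) F) = XL.cls (Suc k) u \<and>
      XG.cls (Suc k) (XG.pull (Suc k) F) = XG.cls (Suc k) v"
    if u: "u \<in> XL.Z (Suc k)" and v: "v \<in> XG.Z (Suc k)" for k u v
  proof -
    obtain a where a: "a \<in> lin\<Lambda> (ob S (Suc k))"
      and ad: "\<And>x. x \<in> carrier (ob S (Suc (Suc k))) \<Longrightarrow> a (bd S (Suc k) x) = \<zero>\<^bsub>K\<^esub>"
      and au: "XL.cls (Suc k) (XL.pull (Suc k) a) = XL.cls (Suc k) u"
      by (rule XL.pull_surj[OF S_selections_\<Lambda> S_selections_\<Lambda> u])
        (assumption | simp only: restrict_complex_simps | rule that)+
    obtain b where b: "b \<in> lin\<Gamma> (ob S (Suc k))"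
      and bd0: "\<And>x. x \<in> carrier (ob S (Suc (Suc k))) \<Longrightarrow> b (bd S (Suc k) x) = \<zero>\<^bsub>K\<^esub>"
      and bv: "XG.cls (Suc k) (XG.pull (Suc k) b) = XG.cls (Suc k) v"
      by (rule XG.pull_surj[OF S_selections_\<Gamma> S_selections_\<Gamma> v])
        (assumption | simp only: restrict_complex_simps | rule that)+
    have ab: "a (bd S (Suc k) x) = b (bd S (Suc k) x)" if "x \<in> carrier (ob S (Suc (Suc k)))" for x
      using ad bd0 that by simp
    obtain F f g where F: "F \<in> T.L (Suc k)" and f: "f \<in> lin\<Lambda> (ob S k)" and g: "g \<in> lin\<Gamma> (ob S k)"
      and aF: "\<And>x. x \<in> carrier (ob S (Suc k)) \<Longrightarrow> a x = f (bd S k x) \<oplus>\<^bsub>K\<^esub> F x"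
      and Fb: "\<And>x. x \<in> carrier (ob S (Suc k)) \<Longrightarrow> F x = g (bd S k x) \<oplus>\<^bsub>K\<^esub> b x"
      by (rule linear_maps_glue[OF a b ab]) (assumption | rule that)+
    have "F (bd S (Suc k) x) = \<zero>\<^bsub>K\<^esub>" if x: "x \<in> carrier (ob S (Suc (Suc k)))" for x
    proof -
      have "g (bd S k (bd S (Suc k) x)) = \<zero>\<^bsub>K\<^esub>"
        using exact_resolutionD(5)[OF T.exact x]
          lin_maps_zero[OF left_module_abelian_group[OF S_\<Gamma>] left_module_abelian_group[OF base_\<Gamma>] g] by simp
      then show ?thesis using Fb[OF T.bd_closed[OF x]] bd0[OF x] by simp
    qed
    then have FZ: "F \<in> T.Z (Suc k)" using F by (simp add: T.cocycles_iff)
    have aZ: "XL.pull (Suc k) a \<in> XL.Z (Suc k)" by (rule XL.pull_Z) (use a ad in auto)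
    have bZ: "XG.pull (Suc k) b \<in> XG.Z (Suc k)" by (rule XG.pull_Z) (use b bd0 in auto)
    have "XL.cls (Suc k) (XL.pull (Suc k) a) = XL.cls (Suc k) (XL.pull (Suc k) F)"
      by (rule XL.cls_eq_SucI[OF aZ XL.pull_cocycle[OF FZ], of "XL.pull k f"])
        (use XL.pull_L[of f k] f in \<open>auto simp: XL.pull_apply aF XL.\<phi>_closed XL.\<phi>_bd XL.bd_closed\<close>)
    moreover have "XG.cls (Suc k) (XG.pull (Suc k) F) = XG.cls (Suc k) (XG.pull (Suc k) b)"
      by (rule XG.cls_eq_SucI[OF XG.pull_cocycle[OF FZ] bZ, of "XG.pull k g"])
        (use XG.pull_L[of g k] g in \<open>auto simp: XG.pull_apply Fb XG.\<phi>_closed XG.\<phi>_bd XG.bd_closed\<close>)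
    ultimately show ?thesis using FZ au bv by (intro bexI[of _ F]) auto
  qed
  let ?E = "Ext_algebra K R aug_coprod_aug S"
  let ?EP = "Ext_algebra K \<Lambda> \<epsilon> P" and ?EQ = "Ext_algebra K \<Gamma> \<eta> Q"
  let ?X = "aug_prod ?EP (Ext_aug K P) ?EQ (Ext_aug K Q)"
  define \<Phi> where "\<Phi> \<xi> = (XL.Res \<xi>, XG.Res \<xi>)" for \<xi>
  note carr = XL.Ext_algebra_carrier XG.Ext_algebra_carrier(1)
  have res_inj: "F = H" if F: "F \<in> carrier (T.ExtP (Suc k))" and H: "H \<in> carrier (T.ExtP (Suc k))"
    and eqL: "XL.res (Suc k) F = XL.res (Suc k) H" and eqG: "XG.res (Suc k) F = XG.res (Suc k) H" for F H k
  proof -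
    let ?n = "Suc k"
    obtain f h where f: "f \<in> T.Z ?n" "F = T.cls ?n f" and h: "h \<in> T.Z ?n" "H = T.cls ?n h"
      using F H unfolding T.Ext_carrier by blast
    \<comment> \<open>Injectivity is known for single cocycles in \<open>inj_pos\<close>, hence the
      passage to the difference of representatives.\<close>
    define e where "e = (\<lambda>x\<in>carrier (ob S ?n). f x \<ominus>\<^bsub>K\<^esub> h x)"
    note fL = T.cocycleD(1)[OF f(1)] and hL = T.cocycleD(1)[OF h(1)]
    have eL: "e \<in> T.L ?n"
      using lin_maps_diff[OF T.P_module T.base_module fL hL] by (simp add: e_def aug_module_minus)
    have eZ: "e \<in> T.Z ?n"
      using eL T.cocycleD(2)[OF f(1)] T.cocycleD(2)[OF h(1)] T.bd_closed
      by (simp add: T.cocycles_iff e_def K.minus_eq)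
    have fe: "f x = e x \<oplus>\<^bsub>K\<^esub> h x" if "x \<in> carrier (ob S ?n)" for x
      using that T.L_closed[OF fL] T.L_closed[OF hL] by (simp add: e_def K.minus_add_cancel)
    have eqL': "XL.cls ?n (XL.pull ?n f) = XL.cls ?n (XL.pull ?n h)"
      using eqL unfolding f(2) h(2) XL.res_cls[OF f(1)] XL.res_cls[OF h(1)] .
    have eqG': "XG.cls ?n (XG.pull ?n f) = XG.cls ?n (XG.pull ?n h)"
      using eqG unfolding f(2) h(2) XG.res_cls[OF f(1)] XG.res_cls[OF h(1)] .
    have cancel: "y = e x" if "x \<in> carrier (ob S ?n)" "y \<in> carrier K" "f x = y \<oplus>\<^bsub>K\<^esub> h x" for x y
      using that fe T.L_closed[OF eL] T.L_closed[OF hL] by (metis K.add.right_cancel)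
    obtain b where b: "b \<in> XL.B ?n" "\<And>x. x \<in> carrier (ob P ?n) \<Longrightarrow> XL.pull ?n f x = b x \<oplus>\<^bsub>K\<^esub> XL.pull ?n h x"
      by (rule XL.cls_eqE[OF XL.pull_cocycle[OF f(1)] eqL']) (rule that)
    have "b = XL.pull ?n e"
      by (rule XL.L_ext[OF XL.coboundary_L[OF b(1)] XL.cocycleD(1)[OF XL.pull_cocycle[OF eZ]]])
        (use b(2) XL.L_closed[OF XL.coboundary_L[OF b(1)]] in \<open>auto simp: XL.pull_apply XL.\<phi>_closed intro!: cancel\<close>)
    moreover obtain b' where b': "b' \<in> XG.B ?n" "\<And>x. x \<in> carrier (ob Q ?n) \<Longrightarrow> XG.pull ?n f x = b' x \<oplus>\<^bsub>K\<^esub> XG.pull ?n h x"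
      by (rule XG.cls_eqE[OF XG.pull_cocycle[OF f(1)] eqG']) (rule that)
    have "b' = XG.pull ?n e"
      by (rule XG.L_ext[OF XG.coboundary_L[OF b'(1)] XG.cocycleD(1)[OF XG.pull_cocycle[OF eZ]]])
        (use b'(2) XG.L_closed[OF XG.coboundary_L[OF b'(1)]] in \<open>auto simp: XG.pull_apply XG.\<phi>_closed intro!: cancel\<close>)
    ultimately have "e \<in> T.B ?n" using b(1) b'(1) inj_pos[OF eZ] by blast
    then show ?thesis unfolding f(2) h(2) by (rule T.cls_eqI[OF f(1) h(1) _ fe])
  qed
  have res_surj: "\<exists>F\<in>carrier (T.ExtP (Suc k)). XL.res (Suc k) F = U \<and> XG.res (Suc k) F = V"
    if U: "U \<in> carrier (XL.ExtP (Suc k))" and V: "V \<in> carrier (XG.ExtP (Suc k))" for U V k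
  proof -
    obtain u v where uv: "u \<in> XL.Z (Suc k)" "U = XL.cls (Suc k) u" "v \<in> XG.Z (Suc k)" "V = XG.cls (Suc k) v"
      using U V unfolding XL.Ext_carrier XG.Ext_carrier by blast
    obtain F where F: "F \<in> T.Z (Suc k)" "XL.cls (Suc k) (XL.pull (Suc k) F) = U" "XG.cls (Suc k) (XG.pull (Suc k) F) = V"
      using surj_pos[OF uv(1,3)] unfolding uv(2,4) by blast
    show ?thesis
    proof (intro bexI conjI)
      show "T.cls (Suc k) F \<in> carrier (T.ExtP (Suc k))" unfolding T.Ext_carrier using F(1) by blast
      show "XL.res (Suc k) (T.cls (Suc k) F) = U" "XG.res (Suc k) (T.cls (Suc k) F) = V"
        unfolding XL.res_cls[OF F(1)] XG.res_cls[OF F(1)] by (rule F)+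
    qed
  qed
  have inj: "inj_on \<Phi> (carrier ?E)"
  proof (rule inj_onI)
    fix \<xi> \<upsilon> assume \<xi>: "\<xi> \<in> carrier ?E" and \<upsilon>: "\<upsilon> \<in> carrier ?E" and eq: "\<Phi> \<xi> = \<Phi> \<upsilon>"
    have eqs: "XL.Res \<xi> = XL.Res \<upsilon>" "XG.Res \<xi> = XG.Res \<upsilon>" using eq by (simp_all add: \<Phi>_def)
    have c: "\<xi> n \<in> carrier (T.ExtP n)" "\<upsilon> n \<in> carrier (T.ExtP n)" for n using \<xi> \<upsilon> by (auto simp: carr)
    show "\<xi> = \<upsilon>"
    proof
      fix n
      show "\<xi> n = \<upsilon> n"
      proof (cases n)
        case 0
        obtain x where x: "x \<in> carrier K" "\<xi> 0 = T.cls 0 (T.const x)" using c(1) by (rule T.Ext_0_const)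
        obtain y where y: "y \<in> carrier K" "\<upsilon> 0 = T.cls 0 (T.const y)" using c(2) by (rule T.Ext_0_const)
        \<comment> \<open>In degree 0 a class is determined by its augmentation, and restriction
          preserves augmentations, so one of the two factors decides.\<close>
        have "x = Ext_aug K S \<xi>" using T.Ext_aug_const[of x \<xi>] x by simp
        also have "\<dots> = Ext_aug K S \<upsilon>" using XL.Res_aug[OF \<xi>] XL.Res_aug[OF \<upsilon>] eqs by simp
        also have "\<dots> = y" using T.Ext_aug_const[of y \<upsilon>] y by simp
        finally show ?thesis using x(2) y(2) 0 by simp
      next
        case (Suc k)
        have "XL.res (Suc k) (\<xi> (Suc k)) = XL.res (Suc k) (\<upsilon> (Suc k))"
          "XG.res (Suc k) (\<xi> (Suc k)) = XG.res (Suc k) (\<upsilon> (Suc k))"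
          using fun_cong[OF eqs(1), of "Suc k"] fun_cong[OF eqs(2), of "Suc k"]
          by (simp_all only: XL.Res_def XG.Res_def)
        then show ?thesis unfolding Suc by (rule res_inj[OF c])
      qed
    qed
  qed
  have closed: "\<Phi> \<xi> \<in> carrier ?X" if "\<xi> \<in> carrier ?E" for \<xi>
    using XL.Res_closed[OF that] XG.Res_closed[OF that] XL.Res_aug[OF that] XG.Res_aug[OF that]
    by (simp add: \<Phi>_def aug_prod_def)
  have onto: "z \<in> \<Phi> ` carrier ?E" if zX: "z \<in> carrier ?X" for z
  proof -
    obtain \<zeta> \<theta> where z: "z = (\<zeta>, \<theta>)" and \<zeta>: "\<zeta> \<in> carrier ?EP" and \<theta>: "\<theta> \<in> carrier ?EQ"
      and aug: "Ext_aug K P \<zeta> = Ext_aug K Q \<theta>"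
      using zX by (auto simp: aug_prod_def)
    have \<zeta>c: "\<zeta> n \<in> carrier (XL.ExtP n)" and \<theta>c: "\<theta> n \<in> carrier (XG.ExtP n)" for n
      using \<zeta> \<theta> by (auto simp: carr)
    obtain x where x: "x \<in> carrier K" "\<zeta> 0 = XL.cls 0 (XL.const x)" using \<zeta>c by (rule XL.Ext_0_const)
    obtain y where y: "y \<in> carrier K" "\<theta> 0 = XG.cls 0 (XG.const y)" using \<theta>c by (rule XG.Ext_0_const)
    \<comment> \<open>Here the compatibility of augmentations in \<open>aug_prod\<close> enters:
      both components have the same scalar in degree 0.\<close>
    have xy: "x = y"
      using XL.Ext_aug_const[of x \<zeta>] XG.Ext_aug_const[of y \<theta>] x y aug by simp
    \<comment> \<open>The last clause makes the choice zero wherever both components vanish, so that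
      the chosen family has finite support. Degree 0 is exempt, as it adds at most one
      index.\<close>
    have "\<exists>F. F \<in> carrier (T.ExtP n) \<and> XL.res n F = \<zeta> n \<and> XG.res n F = \<theta> n \<and>
        (n \<noteq> 0 \<longrightarrow> \<zeta> n = \<zero>\<^bsub>XL.ExtP n\<^esub> \<longrightarrow> \<theta> n = \<zero>\<^bsub>XG.ExtP n\<^esub> \<longrightarrow> F = \<zero>\<^bsub>T.ExtP n\<^esub>)" for n
    proof (cases n)
      case 0
      have "T.cls 0 (T.const x) \<in> carrier (T.ExtP 0)"
        unfolding T.Ext_carrier using T.const_cocycle[OF x(1)] by blast
      moreover have "XL.res 0 (T.cls 0 (T.const x)) = \<zeta> 0" "XG.res 0 (T.cls 0 (T.const x)) = \<theta> 0"
        unfolding XL.res_cls[OF T.const_cocycle[OF x(1)]] XG.res_cls[OF T.const_cocycle[OF x(1)]]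
          XL.pull_const[OF x(1)] XG.pull_const[OF x(1)] x(2) y(2) xy[symmetric] by (rule refl)+
      ultimately show ?thesis using 0 by blast
    next
      case (Suc k)
      show ?thesis
      proof (cases "\<zeta> n = \<zero>\<^bsub>XL.ExtP n\<^esub> \<and> \<theta> n = \<zero>\<^bsub>XG.ExtP n\<^esub>")
        case True
        have "\<zero>\<^bsub>T.ExtP n\<^esub> \<in> carrier (T.ExtP n)"
          using left_module_abelian_group[OF T.Ext_module] by (simp add: abelian_groupE)
        then show ?thesis using True XL.res_zero[of n] XG.res_zero[of n] by metis
      next
        case False
        obtain F where "F \<in> carrier (T.ExtP n)" "XL.res n F = \<zeta> n" "XG.res n F = \<theta> n"
          using res_surj[OF \<zeta>c \<theta>c, of k] unfolding Suc by blast
        then show ?thesis using False by blast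
      qed
    qed
    then obtain \<xi> where \<xi>: "\<And>n. \<xi> n \<in> carrier (T.ExtP n)" "\<And>n. XL.res n (\<xi> n) = \<zeta> n" "\<And>n. XG.res n (\<xi> n) = \<theta> n"
      and \<xi>0: "\<And>n. \<lbrakk>n \<noteq> 0; \<zeta> n = \<zero>\<^bsub>XL.ExtP n\<^esub>; \<theta> n = \<zero>\<^bsub>XG.ExtP n\<^esub>\<rbrakk> \<Longrightarrow> \<xi> n = \<zero>\<^bsub>T.ExtP n\<^esub>"
      by metis
    have "{n. \<xi> n \<noteq> \<zero>\<^bsub>T.ExtP n\<^esub>} \<subseteq> {0} \<union> {n. \<zeta> n \<noteq> \<zero>\<^bsub>XL.ExtP n\<^esub>} \<union> {n. \<theta> n \<noteq> \<zero>\<^bsub>XG.ExtP n\<^esub>}"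
      using \<xi>0 by blast
    then have "finite {n. \<xi> n \<noteq> \<zero>\<^bsub>T.ExtP n\<^esub>}"
      using \<zeta> \<theta> unfolding carr by (auto intro: finite_subset)
    then have "\<xi> \<in> carrier ?E" unfolding carr using \<xi>(1) by blast
    moreover have "\<Phi> \<xi> = z" by (simp add: \<Phi>_def z XL.Res_def XG.Res_def \<xi>)
    ultimately show ?thesis by blast
  qed
  have "\<Phi> \<in> ring_hom ?E ?X"
    by (rule ring_hom_memI)
      (use ring_hom_add[OF XL.Res_hom] ring_hom_add[OF XG.Res_hom] ring_hom_mult[OF XL.Res_hom]
        ring_hom_mult[OF XG.Res_hom] ring_hom_one[OF XL.Res_hom] ring_hom_one[OF XG.Res_hom] closed in
        \<open>simp_all add: \<Phi>_def aug_prod_def\<close>)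
  moreover have "bij_betw \<Phi> (carrier ?E) (carrier ?X)"
    unfolding bij_betw_def using inj closed onto by blast
  moreover have "\<Phi> (c \<odot>\<^bsub>?E\<^esub> \<xi>) = c \<odot>\<^bsub>?X\<^esub> \<Phi> \<xi>" if "c \<in> carrier K" "\<xi> \<in> carrier ?E" for c \<xi>
    using XL.Res_smult[OF that] XG.Res_smult[OF that] by (simp add: \<Phi>_def aug_prod_def)
  moreover have "aug_prod_aug (Ext_aug K P) (\<Phi> \<xi>) = Ext_aug K S \<xi>" if "\<xi> \<in> carrier ?E" for \<xi>
    using XL.Res_aug[OF that] by (simp add: \<Phi>_def aug_prod_aug_def)
  ultimately have "\<Phi> \<in> aug_algebra_iso K ?E (Ext_aug K S) ?X (aug_prod_aug (Ext_aug K P))"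
    by (simp add: aug_algebra_iso_def ring_iso_def)
  then show ?thesis unfolding aug_algebra_isomorphic_def by blast
qed

end

theorem theorem4p1:
  fixes K :: "('k, 'r) ring_scheme"
    and \<Lambda> :: "('k, 'a, 'c) module_scheme" and \<epsilon> :: "'a \<Rightarrow> 'k"
    and \<Gamma> :: "('k, 'b, 'd) module_scheme" and \<eta> :: "'b \<Rightarrow> 'k"
    and P :: "('a, 'p, 'k) augmented_complex"
    and Q :: "('b, 'q, 'k) augmented_complex"
    and S :: "((('a + 'b) list \<Rightarrow> 'k) set, 's, 'k) augmented_complex"
  assumes "field K"
    and "augmented_algebra K \<Lambda> \<epsilon>"
    and "augmented_algebra K \<Gamma> \<eta>"
    and "projective_resolution \<Lambda> (aug_module K \<epsilon>) P"
    and "projective_resolution \<Gamma> (aug_module K \<eta>) Q"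
    and "projective_resolution (aug_coprod K \<Lambda> \<epsilon> \<Gamma> \<eta>) (aug_module K aug_coprod_aug) S"
  shows "aug_algebra_isomorphic K
    (Ext_algebra K (aug_coprod K \<Lambda> \<epsilon> \<Gamma> \<eta>) aug_coprod_aug S) (Ext_aug K S)
    (aug_prod (Ext_algebra K \<Lambda> \<epsilon> P) (Ext_aug K P) (Ext_algebra K \<Gamma> \<eta> Q) (Ext_aug K Q))
    (aug_prod_aug (Ext_aug K P))"
proof -
  have "ring (aug_coprod K \<Lambda> \<epsilon> \<Gamma> \<eta>)"
    using exact_resolutionD(1)[OF projective_resolution_exact[OF assms(6)]] by (rule left_module_ring)
  then have "coprod_resolution K \<Lambda> \<epsilon> \<Gamma> \<eta> S"
    by (intro coprod_resolution.intro coprod_resolution_axioms.intro coprod.intro coprod_axioms.intro assms)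
  then show ?thesis using assms(4,5) by (rule coprod_resolution.Ext_iso)
qed

end
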